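(* Fix a mesh drawn from a quasi-uniform sequence (so that the inverse estimates hold), and let $\mathbf{f}\in[H^{-1}(\Omega)]^3$. Then the Picard iterates $\mathbf{u}_h^n,\mathbf{E}_h^n,\mathbf{j}_h^n,\mathbf{B}_h^n,p_h^n$ converge as $n\to\infty$ if $\mathrm{Re_m}$ and $\mathrm{Re}$ are small enough. That is, there are thresholds (depending on the mesh and on the remaining data $\Omega$, $\mathbf{f}$, $S$, $\mathrm{R_H}$ and the finite element spaces) such that, whenever $\mathrm{Re}$ and $\mathrm{Re_m}$ lie below them, for every initial guess $(\mathbf{u}_h^0,\mathbf{B}_h^0)\in\mathbf{V}_h\times H_0^h(\mathrm{div})$ with $\nabla\cdot\mathbf{u}_h^0=0$ the sequence $(\mathbf{u}_h^n,p_h^n,\mathbf{E}_h^n,\mathbf{B}_h^n,\mathbf{j}_h^n)_{n\ge1}$ converges in the finite-dimensional space $\mathbf{X}_h$.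
   Context: $\Omega\subset\mathbb{R}^3$ is a bounded, contractible Lipschitz polyhedron; $(\cdot,\cdot)$ is the $L^2(\Omega)$ inner product and $\langle\cdot,\cdot\rangle$ the duality pairing between $H^{-1}$ and $H^1_0$. $\mathrm{Re},\mathrm{Re_m},S>0$ and $\mathrm{R_H}\ge0$ are constants. $H_0(\mathrm{curl})$ and $H_0(\mathrm{div})$ denote the $H(\mathrm{curl},\Omega)$, $H(\mathrm{div},\Omega)$ fields with vanishing tangential, respectively normal, trace on $\partial\Omega$. $H_0^h(\mathrm{grad})\subset H_0^1(\Omega)$, $H_0^h(\mathrm{curl})\subset H_0(\mathrm{curl})$, $H_0^h(\mathrm{div})\subset H_0(\mathrm{div})$, $L_h^2$ are conforming finite element spaces forming a finite element de Rham sequence $$0\to H_0^h(\mathrm{grad})\xrightarrow{\mathrm{grad}}H_0^h(\mathrm{curl})\xrightarrow{\mathrm{curl}}H_0^h(\mathrm{div})\xrightarrow{\mathrm{div}}L^2_h\to0,$$ exact since $\Omega$ is contractible. $\mathbf{V}_h\subset[H_0^1(\Omega)]^3$ and $Q_h\subset L_0^2(\Omega)$ (mean-zero functions) are an inf-sup stable pair of finite element spaces enforcing incompressibility exactly: if $\mathbf{v}_h\in\mathbf{V}_h$ and $(\nabla\cdot\mathbf{v}_h,q_h)=0$ for all $q_h\in Q_h$, then $\nabla\cdot\mathbf{v}_h=0$. Put $\mathbf{X}_h:=\mathbf{V}_h\times Q_h\times H_0^h(\mathrm{curl})\times H_0^h(\mathrm{div})\times H_0^h(\mathrm{curl})$.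 Picard step: given $(\mathbf{u}_h^{n-1},\mathbf{B}_h^{n-1})$, find $(\mathbf{u}_h^n,p_h^n,\mathbf{E}_h^n,\mathbf{B}_h^n,\mathbf{j}_h^n)\in\mathbf{X}_h$ such that for all $(\mathbf{v}_h,q_h,\mathbf{F}_h,\mathbf{C}_h,\mathbf{k}_h)\in\mathbf{X}_h$ $$\mathrm{Re}^{-1}(\nabla\mathbf{u}_h^n,\nabla\mathbf{v}_h)+((\mathbf{u}_h^{n-1}\cdot\nabla)\mathbf{u}_h^n,\mathbf{v}_h)-S(\mathbf{j}_h^n\times\mathbf{B}_h^{n-1},\mathbf{v}_h)-(p_h^n,\nabla\cdot\mathbf{v}_h)=\langle\mathbf{f},\mathbf{v}_h\rangle,$$ $$(\mathbf{j}_h^n,\mathbf{F}_h)-(\mathbf{B}_h^n,\nabla\times\mathbf{F}_h)=0,$$ $$(\nabla\times\mathbf{E}_h^n,\mathbf{C}_h)+(\nabla\cdot\mathbf{B}_h^n,\nabla\cdot\mathbf{C}_h)=0,$$ $$\mathrm{Re_m}^{-1}(\mathbf{j}_h^n,\mathbf{k}_h)-(\mathbf{E}_h^n+\mathbf{u}_h^n\times\mathbf{B}_h^{n-1}-\mathrm{R_H}\,\mathbf{j}_h^n\times\mathbf{B}_h^{n-1},\mathbf{k}_h)=0,$$ $$-(\nabla\cdot\mathbf{u}_h^n,q_h)=0.$$ *)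

theory Defs
  imports "HOL-Analysis.Analysis"
begin

type_synonym scalar_fun = "real^3 \<Rightarrow> real"
type_synonym vector_fun = "real^3 \<Rightarrow> real^3"


section \<open>The domain and its meshes\<close>

definition lipschitz_boundary :: "(real^3) set \<Rightarrow> bool" where
  "lipschitz_boundary \<Omega> \<longleftrightarrow>
     (\<forall>x\<in>frontier \<Omega>. \<exists>n \<epsilon> L. \<exists>g :: scalar_fun.
        norm n = 1 \<and> 0 < \<epsilon> \<and> L-lipschitz_on UNIV g \<and>
        \<Omega> \<inter> ball x \<epsilon> = {y \<in> ball x \<epsilon>. y \<bullet> n < g (y - (y \<bullet> n) *\<^sub>R n)})"

text \<open>The polyhedron itself need not be convex; \<^const>\<open>polytope\<close> sets are convex hulls.\<close>

definition lipschitz_polyhedron :: "(real^3) set \<Rightarrow> bool" where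
  "lipschitz_polyhedron \<Omega> \<longleftrightarrow>
     open \<Omega> \<and> connected \<Omega> \<and> \<Omega> \<noteq> {} \<and> lipschitz_boundary \<Omega> \<and>
     (\<exists>\<P>. finite \<P> \<and> (\<forall>P\<in>\<P>. polytope P) \<and> closure \<Omega> = \<Union>\<P>)"

definition mesh :: "(real^3) set \<Rightarrow> (real^3) set set \<Rightarrow> bool" where
  "mesh \<Omega> \<T> \<longleftrightarrow>
     finite \<T> \<and> (\<forall>K\<in>\<T>. polytope K \<and> interior K \<noteq> {}) \<and> \<Union>\<T> = closure \<Omega> \<and>
     (\<forall>K\<in>\<T>. \<forall>K'\<in>\<T>. (K \<inter> K') face_of K \<and> (K \<inter> K') face_of K')"

definition mesh_size :: "(real^3) set set \<Rightarrow> real" where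
  "mesh_size \<T> = Max (diameter ` \<T>)"

text \<open>One inradius bound relative to the global mesh size gives both shape regularity and
  quasi-uniformity.\<close>

definition quasi_uniform :: "(real^3) set \<Rightarrow> (nat \<Rightarrow> (real^3) set set) \<Rightarrow> bool" where
  "quasi_uniform \<Omega> \<T> \<longleftrightarrow>
     (\<forall>k. mesh \<Omega> (\<T> k)) \<and>
     (\<exists>c>0. \<forall>k. \<forall>K\<in>\<T> k. \<exists>x. cball x (c * mesh_size (\<T> k)) \<subseteq> K)"


section \<open>Square integrable functions and test functions\<close>

text \<open>Functions on \<open>\<Omega>\<close> are represented by total functions; their values outside \<open>\<Omega>\<close> and on null
  sets are irrelevant.\<close>

definition ae_eq :: "(real^3) set \<Rightarrow> (real^3 \<Rightarrow> 'b) \<Rightarrow> (real^3 \<Rightarrow> 'b) \<Rightarrow> bool" where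
  "ae_eq \<Omega> f g \<longleftrightarrow> (AE x in lebesgue. x \<in> \<Omega> \<longrightarrow> f x = g x)"

definition L2 :: "(real^3) set \<Rightarrow> (real^3 \<Rightarrow> 'b::euclidean_space) set" where
  "L2 \<Omega> = {f. set_borel_measurable lebesgue \<Omega> f \<and> set_integrable lebesgue \<Omega> (\<lambda>x. (norm (f x))\<^sup>2)}"

definition l2_inner :: "(real^3) set \<Rightarrow> (real^3 \<Rightarrow> 'b::euclidean_space) \<Rightarrow> (real^3 \<Rightarrow> 'b) \<Rightarrow> real" where
  "l2_inner \<Omega> f g = (LINT x:\<Omega>|lebesgue. f x \<bullet> g x)"

definition l2_norm :: "(real^3) set \<Rightarrow> (real^3 \<Rightarrow> 'b::euclidean_space) \<Rightarrow> real" where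
  "l2_norm \<Omega> f = sqrt (l2_inner \<Omega> f f)"

definition L20 :: "(real^3) set \<Rightarrow> scalar_fun set" where
  "L20 \<Omega> = {q \<in> L2 \<Omega>. (LINT x:\<Omega>|lebesgue. q x) = 0}"

definition partial :: "3 \<Rightarrow> scalar_fun \<Rightarrow> scalar_fun" where
  "partial i f x = frechet_derivative f (at x) (axis i 1)"

definition grad :: "scalar_fun \<Rightarrow> vector_fun" where
  "grad f x = (\<chi> i. partial i f x)"

definition component :: "vector_fun \<Rightarrow> 3 \<Rightarrow> scalar_fun" where
  "component v i x = v x $ i"

definition curl :: "vector_fun \<Rightarrow> vector_fun" where
  "curl v x = vector [partial 2 (component v 3) x - partial 3 (component v 2) x,
                      partial 3 (component v 1) x - partial 1 (component v 3) x,
                      partial 1 (component v 2) x - partial 2 (component v 1) x]"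

primrec Ck :: "nat \<Rightarrow> scalar_fun \<Rightarrow> bool" where
  "Ck 0 f \<longleftrightarrow> continuous_on UNIV f"
| "Ck (Suc k) f \<longleftrightarrow> (\<forall>x. f differentiable (at x)) \<and> (\<forall>i. Ck k (partial i f))"

definition smooth :: "scalar_fun set" where
  "smooth = {\<phi>. \<forall>k. Ck k \<phi>}"

definition smooth_vec :: "vector_fun set" where
  "smooth_vec = {\<phi>. \<forall>i. component \<phi> i \<in> smooth}"

definition test :: "(real^3) set \<Rightarrow> scalar_fun set" where
  "test \<Omega> = {\<phi> \<in> smooth. \<exists>K. compact K \<and> K \<subseteq> \<Omega> \<and> (\<forall>x. x \<notin> K \<longrightarrow> \<phi> x = 0)}"

definition test_vec :: "(real^3) set \<Rightarrow> vector_fun set" where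
  "test_vec \<Omega> = {\<phi>. \<forall>i. component \<phi> i \<in> test \<Omega>}"


section \<open>Weak derivatives and Sobolev spaces\<close>

definition is_weak_grad :: "(real^3) set \<Rightarrow> scalar_fun \<Rightarrow> vector_fun \<Rightarrow> bool" where
  "is_weak_grad \<Omega> u G \<longleftrightarrow> G \<in> L2 \<Omega> \<and>
     (\<forall>\<phi>\<in>test \<Omega>. \<forall>i. l2_inner \<Omega> u (partial i \<phi>) = - l2_inner \<Omega> (component G i) \<phi>)"

definition is_weak_curl :: "(real^3) set \<Rightarrow> vector_fun \<Rightarrow> vector_fun \<Rightarrow> bool" where
  "is_weak_curl \<Omega> u c \<longleftrightarrow> c \<in> L2 \<Omega> \<and>
     (\<forall>\<phi>\<in>test_vec \<Omega>. l2_inner \<Omega> u (curl \<phi>) = l2_inner \<Omega> c \<phi>)"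

definition is_weak_div :: "(real^3) set \<Rightarrow> vector_fun \<Rightarrow> scalar_fun \<Rightarrow> bool" where
  "is_weak_div \<Omega> u d \<longleftrightarrow> d \<in> L2 \<Omega> \<and>
     (\<forall>\<phi>\<in>test \<Omega>. l2_inner \<Omega> u (grad \<phi>) = - l2_inner \<Omega> d \<phi>)"

text \<open>Weak derivatives are unique almost everywhere in \<open>\<Omega>\<close>; the operators below pick a
  representative.\<close>

definition weak_grad :: "(real^3) set \<Rightarrow> scalar_fun \<Rightarrow> vector_fun" where
  "weak_grad \<Omega> u = (SOME G. is_weak_grad \<Omega> u G)"

definition weak_curl :: "(real^3) set \<Rightarrow> vector_fun \<Rightarrow> vector_fun" where
  "weak_curl \<Omega> u = (SOME c. is_weak_curl \<Omega> u c)"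

definition weak_div :: "(real^3) set \<Rightarrow> vector_fun \<Rightarrow> scalar_fun" where
  "weak_div \<Omega> u = (SOME d. is_weak_div \<Omega> u d)"

definition H1 :: "(real^3) set \<Rightarrow> scalar_fun set" where
  "H1 \<Omega> = {u \<in> L2 \<Omega>. \<exists>G. is_weak_grad \<Omega> u G}"

definition Hcurl :: "(real^3) set \<Rightarrow> vector_fun set" where
  "Hcurl \<Omega> = {u \<in> L2 \<Omega>. \<exists>c. is_weak_curl \<Omega> u c}"

definition Hdiv :: "(real^3) set \<Rightarrow> vector_fun set" where
  "Hdiv \<Omega> = {u \<in> L2 \<Omega>. \<exists>d. is_weak_div \<Omega> u d}"

definition h1_norm :: "(real^3) set \<Rightarrow> scalar_fun \<Rightarrow> real" where
  "h1_norm \<Omega> u = sqrt ((l2_norm \<Omega> u)\<^sup>2 + (l2_norm \<Omega> (weak_grad \<Omega> u))\<^sup>2)"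

definition h1_norm_vec :: "(real^3) set \<Rightarrow> vector_fun \<Rightarrow> real" where
  "h1_norm_vec \<Omega> v = sqrt (\<Sum>i\<in>UNIV. (h1_norm \<Omega> (component v i))\<^sup>2)"

definition hcurl_norm :: "(real^3) set \<Rightarrow> vector_fun \<Rightarrow> real" where
  "hcurl_norm \<Omega> u = sqrt ((l2_norm \<Omega> u)\<^sup>2 + (l2_norm \<Omega> (weak_curl \<Omega> u))\<^sup>2)"

definition hdiv_norm :: "(real^3) set \<Rightarrow> vector_fun \<Rightarrow> real" where
  "hdiv_norm \<Omega> u = sqrt ((l2_norm \<Omega> u)\<^sup>2 + (l2_norm \<Omega> (weak_div \<Omega> u))\<^sup>2)"

definition H10 :: "(real^3) set \<Rightarrow> scalar_fun set" where
  "H10 \<Omega> = {u \<in> H1 \<Omega>. \<exists>\<phi>. (\<forall>k::nat. \<phi> k \<in> test \<Omega>) \<and>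
                           (\<lambda>k. h1_norm \<Omega> (\<lambda>x. u x - \<phi> k x)) \<longlonglongrightarrow> 0}"

definition H10_vec :: "(real^3) set \<Rightarrow> vector_fun set" where
  "H10_vec \<Omega> = {v. \<forall>i. component v i \<in> H10 \<Omega>}"

text \<open>The tangential trace \<open>n \<times> u\<close> and the normal trace \<open>u \<bullet> n\<close> of fields in \<open>H(curl)\<close> and \<open>H(div)\<close>
  are the functionals on smooth boundary data defined by Green's formula.\<close>

definition tangential_trace :: "(real^3) set \<Rightarrow> vector_fun \<Rightarrow> vector_fun \<Rightarrow> real" where
  "tangential_trace \<Omega> u \<phi> = l2_inner \<Omega> (weak_curl \<Omega> u) \<phi> - l2_inner \<Omega> u (curl \<phi>)"

definition normal_trace :: "(real^3) set \<Rightarrow> vector_fun \<Rightarrow> scalar_fun \<Rightarrow> real" where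
  "normal_trace \<Omega> u \<phi> = l2_inner \<Omega> (weak_div \<Omega> u) \<phi> + l2_inner \<Omega> u (grad \<phi>)"

definition H0curl :: "(real^3) set \<Rightarrow> vector_fun set" where
  "H0curl \<Omega> = {u \<in> Hcurl \<Omega>. \<forall>\<phi>\<in>smooth_vec. tangential_trace \<Omega> u \<phi> = 0}"

definition H0div :: "(real^3) set \<Rightarrow> vector_fun set" where
  "H0div \<Omega> = {u \<in> Hdiv \<Omega>. \<forall>\<phi>\<in>smooth. normal_trace \<Omega> u \<phi> = 0}"

definition Hm1 :: "(real^3) set \<Rightarrow> (scalar_fun \<Rightarrow> real) set" where
  "Hm1 \<Omega> = {f. (\<forall>u\<in>H10 \<Omega>. \<forall>v\<in>H10 \<Omega>. f (\<lambda>x. u x + v x) = f u + f v) \<and>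
               (\<forall>c. \<forall>u\<in>H10 \<Omega>. f (\<lambda>x. c * u x) = c * f u) \<and>
               (\<exists>M. \<forall>u\<in>H10 \<Omega>. \<bar>f u\<bar> \<le> M * h1_norm \<Omega> u)}"

definition duality :: "(3 \<Rightarrow> scalar_fun \<Rightarrow> real) \<Rightarrow> vector_fun \<Rightarrow> real" where
  "duality f v = (\<Sum>i\<in>UNIV. f i (component v i))"


section \<open>Finite element spaces\<close>

text \<open>The span of finitely many functions, with polynomial restrictions to the cells.\<close>

definition fe_space :: "(real^3) set set \<Rightarrow> (real^3 \<Rightarrow> 'b::euclidean_space) set \<Rightarrow> bool" where
  "fe_space \<T> V \<longleftrightarrow>
     (\<exists>B. finite B \<and> V = {(\<lambda>x. \<Sum>b\<in>B. c b *\<^sub>R b x) | c. True}) \<and>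
     (\<forall>v\<in>V. \<forall>K\<in>\<T>. \<exists>p. polynomial_function p \<and> (\<forall>x\<in>interior K. v x = p x))"

definition exact_de_rham ::
  "(real^3) set \<Rightarrow> scalar_fun set \<Rightarrow> vector_fun set \<Rightarrow> vector_fun set \<Rightarrow> scalar_fun set \<Rightarrow> bool" where
  "exact_de_rham \<Omega> Hg Hc Hd Lh \<longleftrightarrow>
     (\<forall>\<phi>\<in>Hg. \<exists>E\<in>Hc. ae_eq \<Omega> E (weak_grad \<Omega> \<phi>)) \<and>
     (\<forall>E\<in>Hc. \<exists>C\<in>Hd. ae_eq \<Omega> C (weak_curl \<Omega> E)) \<and>
     (\<forall>C\<in>Hd. \<exists>q\<in>Lh. ae_eq \<Omega> q (weak_div \<Omega> C)) \<and>
     (\<forall>\<phi>\<in>Hg. ae_eq \<Omega> (weak_grad \<Omega> \<phi>) (\<lambda>x. 0) \<longrightarrow> ae_eq \<Omega> \<phi> (\<lambda>x. 0)) \<and>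
     (\<forall>E\<in>Hc. ae_eq \<Omega> (weak_curl \<Omega> E) (\<lambda>x. 0) \<longleftrightarrow> (\<exists>\<phi>\<in>Hg. ae_eq \<Omega> E (weak_grad \<Omega> \<phi>))) \<and>
     (\<forall>C\<in>Hd. ae_eq \<Omega> (weak_div \<Omega> C) (\<lambda>x. 0) \<longleftrightarrow> (\<exists>E\<in>Hc. ae_eq \<Omega> C (weak_curl \<Omega> E))) \<and>
     (\<forall>q\<in>Lh. \<exists>C\<in>Hd. ae_eq \<Omega> q (weak_div \<Omega> C))"

definition inf_sup_stable :: "(real^3) set \<Rightarrow> vector_fun set \<Rightarrow> scalar_fun set \<Rightarrow> bool" where
  "inf_sup_stable \<Omega> V Q \<longleftrightarrow>
     0 < (INF q\<in>{q\<in>Q. l2_norm \<Omega> q \<noteq> 0}. SUP v\<in>{v\<in>V. h1_norm_vec \<Omega> v \<noteq> 0}.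
            ereal (l2_inner \<Omega> (weak_div \<Omega> v) q / (h1_norm_vec \<Omega> v * l2_norm \<Omega> q)))"

definition exactly_incompressible :: "(real^3) set \<Rightarrow> vector_fun set \<Rightarrow> scalar_fun set \<Rightarrow> bool" where
  "exactly_incompressible \<Omega> V Q \<longleftrightarrow>
     (\<forall>v\<in>V. (\<forall>q\<in>Q. l2_inner \<Omega> (weak_div \<Omega> v) q = 0) \<longrightarrow> ae_eq \<Omega> (weak_div \<Omega> v) (\<lambda>x. 0))"


section \<open>The Picard iteration\<close>

type_synonym state = "vector_fun \<times> scalar_fun \<times> vector_fun \<times> vector_fun \<times> vector_fun"

definition state_space ::
  "vector_fun set \<Rightarrow> scalar_fun set \<Rightarrow> vector_fun set \<Rightarrow> vector_fun set \<Rightarrow> state set" where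
  "state_space V Q Hc Hd = V \<times> Q \<times> Hc \<times> Hd \<times> Hc"

text \<open>The natural norm of \<open>[H\<^sup>1]\<^sup>3 \<times> L\<^sup>2 \<times> H(curl) \<times> H(div) \<times> H(curl)\<close>.\<close>

fun state_norm :: "(real^3) set \<Rightarrow> state \<Rightarrow> real" where
  "state_norm \<Omega> (u, p, E, B, j) =
     h1_norm_vec \<Omega> u + l2_norm \<Omega> p + hcurl_norm \<Omega> E + hdiv_norm \<Omega> B + hcurl_norm \<Omega> j"

fun state_diff :: "state \<Rightarrow> state \<Rightarrow> state" where
  "state_diff (u, p, E, B, j) (u', p', E', B', j') =
     (\<lambda>x. u x - u' x, \<lambda>x. p x - p' x, \<lambda>x. E x - E' x, \<lambda>x. B x - B' x, \<lambda>x. j x - j' x)"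

definition converges_in :: "(real^3) set \<Rightarrow> state set \<Rightarrow> (nat \<Rightarrow> state) \<Rightarrow> bool" where
  "converges_in \<Omega> X z \<longleftrightarrow> (\<exists>z'\<in>X. (\<lambda>n. state_norm \<Omega> (state_diff (z n) z')) \<longlonglongrightarrow> 0)"

definition grad_inner :: "(real^3) set \<Rightarrow> vector_fun \<Rightarrow> vector_fun \<Rightarrow> real" where
  "grad_inner \<Omega> u v =
     (\<Sum>i\<in>UNIV. l2_inner \<Omega> (weak_grad \<Omega> (component u i)) (weak_grad \<Omega> (component v i)))"

text \<open>The field \<open>(w \<bullet> \<nabla>) u\<close>.\<close>

definition convection :: "(real^3) set \<Rightarrow> vector_fun \<Rightarrow> vector_fun \<Rightarrow> vector_fun" where
  "convection \<Omega> w u x = (\<chi> i. w x \<bullet> weak_grad \<Omega> (component u i) x)"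

text \<open>In \<open>picard_step\<close>, \<open>(u0, B0)\<close> is the previous iterate and \<open>(u, p, E, B, j)\<close> the new one.\<close>

definition picard_step ::
  "(real^3) set \<Rightarrow> real \<Rightarrow> real \<Rightarrow> real \<Rightarrow> real \<Rightarrow> (3 \<Rightarrow> scalar_fun \<Rightarrow> real) \<Rightarrow> state set
    \<Rightarrow> vector_fun \<Rightarrow> vector_fun \<Rightarrow> state \<Rightarrow> bool" where
  "picard_step \<Omega> Rey Rem S RH f X u0 B0 = (\<lambda>(u, p, E, B, j).
     (u, p, E, B, j) \<in> X \<and>
     (\<forall>(v, q, F, C, k)\<in>X.
        inverse Rey * grad_inner \<Omega> u v + l2_inner \<Omega> (convection \<Omega> u0 u) v
          - S * l2_inner \<Omega> (\<lambda>x. cross3 (j x) (B0 x)) v - l2_inner \<Omega> p (weak_div \<Omega> v)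
          = duality f v \<and>
        l2_inner \<Omega> j F - l2_inner \<Omega> B (weak_curl \<Omega> F) = 0 \<and>
        l2_inner \<Omega> (weak_curl \<Omega> E) C + l2_inner \<Omega> (weak_div \<Omega> B) (weak_div \<Omega> C) = 0 \<and>
        inverse Rem * l2_inner \<Omega> j k
          - l2_inner \<Omega> (\<lambda>x. E x + cross3 (u x) (B0 x) - RH *\<^sub>R cross3 (j x) (B0 x)) k = 0 \<and>
        - l2_inner \<Omega> (weak_div \<Omega> u) q = 0))"

text \<open>Only the velocity and the magnetic field are prescribed at \<open>n = 0\<close>; the other three components
  of \<open>z 0\<close> play no role.\<close>

definition velocity :: "state \<Rightarrow> vector_fun" where
  "velocity = (\<lambda>(u, p, E, B, j). u)"

definition magnetic :: "state \<Rightarrow> vector_fun" where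
  "magnetic = (\<lambda>(u, p, E, B, j). B)"

definition picard_iterates ::
  "(real^3) set \<Rightarrow> real \<Rightarrow> real \<Rightarrow> real \<Rightarrow> real \<Rightarrow> (3 \<Rightarrow> scalar_fun \<Rightarrow> real) \<Rightarrow> state set
    \<Rightarrow> vector_fun \<Rightarrow> vector_fun \<Rightarrow> (nat \<Rightarrow> state) \<Rightarrow> bool" where
  "picard_iterates \<Omega> Rey Rem S RH f X u0 B0 z \<longleftrightarrow>
     velocity (z 0) = u0 \<and> magnetic (z 0) = B0 \<and>
     (\<forall>n\<ge>1. picard_step \<Omega> Rey Rem S RH f X (velocity (z (n - 1))) (magnetic (z (n - 1))) (z n))"

end

(*
  The whole argument takes place in finite-dimensional spaces, where every form that vanishes on null
  functions is bounded. Testing a Picard step with its own solution (v = u, k = j, F = E) cancels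
  the coupling terms and gives Re^-1 |grad u|^2 + (S / Re_m) |j|^2 = <f, u>, so from the first
  step on u and j are bounded independently of the initial guess and, for small Re and Re_m, of the
  parameters. Exactness forces curl E = 0 and div B = 0, hence B = curl A and |B| <= C |j|.
  Subtracting two consecutive steps and testing with the differences of u and j yields a
  contraction by 1/2 for small Re and Re_m. Thus u and j converge, B is determined by j, and E and p
  converge because their inner products with test functions are continuous expressions in u, j, B
  (for p through the inf-sup condition). Each step is solvable because the adjoint system is
  injective in the velocity component, by the same energy identity with zero load.
*)
theory Submission
  imports Defs "HOL-Library.Function_Algebras" "HOL-Computational_Algebra.Polynomial"
begin

section \<open>Semi-inner products on finite-dimensional spaces\<close>

text \<open>Functions are total and weak derivatives are arbitrary choices, so the operators are
  linear only almost everywhere and all inner products are merely semidefinite. No quotient is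
  formed: linearity is asked only on a subset, and vanishing on null vectors accompanies each form
  as a side condition. Finite dimension then supplies every constant, including those of inverse
  estimates, which is why the thresholds depend on the mesh.

  Three facts about the concrete fields feed the abstract argument. Triple products such as (j
  \<times> B, v) are integrable because finite element fields are essentially bounded. Convection is
  skew because exact incompressibility gives a divergence vanishing almost everywhere, after which
  integration by parts passes from test functions to H10 by density. The gradient form has only null
  functions in its kernel, by the Poincare inequality. Uniqueness of weak derivatives rests on the
  fundamental lemma of the calculus of variations, proved with explicit bumps.

  The initial magnetic field need not be a curl, so magnetic increments are bounded by current
  increments only between iterates that a step has produced.\<close>

definition lin_on :: "'a::real_vector set \<Rightarrow> ('a \<Rightarrow> real) \<Rightarrow> bool" where
  "lin_on X l \<longleftrightarrow> (\<forall>x\<in>X. \<forall>y\<in>X. l (x + y) = l x + l y) \<and> (\<forall>c. \<forall>x\<in>X. l (c *\<^sub>R x) = c * l x)"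

definition bilin :: "'a::real_vector set \<Rightarrow> 'b::real_vector set \<Rightarrow> ('a \<Rightarrow> 'b \<Rightarrow> real) \<Rightarrow> bool" where
  "bilin X Y a \<longleftrightarrow> (\<forall>x\<in>X. lin_on Y (a x)) \<and> (\<forall>y\<in>Y. lin_on X (\<lambda>x. a x y))"

definition trilin ::
  "'a::real_vector set \<Rightarrow> 'b::real_vector set \<Rightarrow> 'c::real_vector set \<Rightarrow> ('a \<Rightarrow> 'b \<Rightarrow> 'c \<Rightarrow> real) \<Rightarrow> bool" where
  "trilin X Y Z t \<longleftrightarrow> (\<forall>x\<in>X. bilin Y Z (t x)) \<and> (\<forall>y\<in>Y. \<forall>z\<in>Z. lin_on X (\<lambda>x. t x y z))"

definition semi_inner :: "'a::real_vector set \<Rightarrow> ('a \<Rightarrow> 'a \<Rightarrow> real) \<Rightarrow> bool" where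
  "semi_inner X g \<longleftrightarrow> bilin X X g \<and> (\<forall>x\<in>X. \<forall>y\<in>X. g x y = g y x) \<and> (\<forall>x\<in>X. 0 \<le> g x x)"

definition fin_dim :: "'a::real_vector set \<Rightarrow> bool" where
  "fin_dim X \<longleftrightarrow> (\<exists>S. finite S \<and> X = span S)"

section \<open>Linear functionals and linear systems\<close>

lemma lin_on_add: "lin_on X l \<Longrightarrow> x \<in> X \<Longrightarrow> y \<in> X \<Longrightarrow> l (x + y) = l x + l y"
  and lin_on_scale: "lin_on X l \<Longrightarrow> x \<in> X \<Longrightarrow> l (c *\<^sub>R x) = c * l x"
  by (auto simp: lin_on_def)

lemma lin_on_zero: "lin_on X l \<Longrightarrow> subspace X \<Longrightarrow> l 0 = 0"
  using lin_on_scale[of X l 0 0] by (simp add: subspace_0)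

lemma lin_on_diff: "lin_on X l \<Longrightarrow> subspace X \<Longrightarrow> x \<in> X \<Longrightarrow> y \<in> X \<Longrightarrow> l (x - y) = l x - l y"
  using lin_on_add[of X l x "(-1) *\<^sub>R y"] lin_on_scale[of X l y "-1"]
  by (simp add: subspace_scale[of X y "-1", simplified])

lemma lin_on_sum:
  assumes "lin_on X l" "subspace X" "\<And>i. i \<in> I \<Longrightarrow> x i \<in> X"
  shows "l (\<Sum>i\<in>I. x i) = (\<Sum>i\<in>I. l (x i))"
  using assms(3)
proof (induction I rule: infinite_finite_induct)
  case (insert i I)
  then show ?case
    using assms by (simp add: lin_on_add[OF assms(1)] subspace_sum)
qed (auto simp: lin_on_zero[OF assms(1,2)])

lemma lin_on_subset: "lin_on X l \<Longrightarrow> Y \<subseteq> X \<Longrightarrow> lin_on Y l"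
  unfolding lin_on_def by blast

lemma bilin_subset: "bilin X Y a \<Longrightarrow> X' \<subseteq> X \<Longrightarrow> Y' \<subseteq> Y \<Longrightarrow> bilin X' Y' a"
  unfolding bilin_def using lin_on_subset[of Y _ Y'] lin_on_subset[of X _ X'] by blast

lemma semi_inner_subset: "semi_inner X g \<Longrightarrow> Y \<subseteq> X \<Longrightarrow> semi_inner Y g"
  unfolding semi_inner_def using bilin_subset[of X X g Y Y] by auto

lemma lin_on_vanish_span:
  assumes "lin_on (span S) l" "\<And>s. s \<in> S \<Longrightarrow> l s = 0" "x \<in> span S"
  shows "l x = 0"
proof -
  have "subspace {x \<in> span S. l x = 0}"
    by (auto simp: subspace_def span_zero span_add span_scale lin_on_add[OF assms(1)]
        lin_on_scale[OF assms(1)] lin_on_zero[OF assms(1)])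
  then have "span S \<subseteq> {x \<in> span S. l x = 0}"
    using assms(2) by (intro span_minimal) (auto simp: span_base)
  then show ?thesis using assms(3) by blast
qed

text \<open>Induction on \<open>I\<close>: restrict to the kernel of one functional, then correct along a vector
  on which that functional does not vanish.\<close>

lemma functional_combination:
  assumes "finite I" "subspace X" "\<And>i. i \<in> I \<Longrightarrow> lin_on X (a i)" "lin_on X l"
    and "\<And>x. x \<in> X \<Longrightarrow> (\<And>i. i \<in> I \<Longrightarrow> a i x = 0) \<Longrightarrow> l x = 0"
  shows "\<exists>c. \<forall>x\<in>X. l x = (\<Sum>i\<in>I. c i * a i x)"
  using assms
proof (induction I arbitrary: X rule: finite_induct)
  case empty
  then show ?case by auto
next
  case (insert i I)
  define Y where "Y = {x\<in>X. a i x = 0}"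
  have ai: "lin_on X (a i)" using insert.prems by auto
  have Y: "subspace Y"
    unfolding subspace_def Y_def using insert.prems(1) lin_on_zero[OF ai]
    by (auto simp: subspace_0 subspace_add subspace_scale lin_on_add[OF ai] lin_on_scale[OF ai])
  have sub: "Y \<subseteq> X" by (auto simp: Y_def)
  have "\<exists>c. \<forall>x\<in>Y. l x = (\<Sum>i\<in>I. c i * a i x)"
    using insert.prems sub Y by (intro insert.IH) (auto intro: lin_on_subset simp: Y_def)
  then obtain c where c: "\<And>x. x \<in> Y \<Longrightarrow> l x = (\<Sum>i\<in>I. c i * a i x)" by blast
  have upd: "(\<Sum>j\<in>I. (c(i := d)) j * a j x) = (\<Sum>j\<in>I. c j * a j x)" for d x
    using insert.hyps by (intro sum.cong) auto
  show ?case
  proof (cases "\<forall>x\<in>X. a i x = 0")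
    case True
    then have "\<forall>x\<in>X. l x = (\<Sum>j\<in>insert i I. (c(i := 0)) j * a j x)"
      using insert.hyps c by (auto simp: upd Y_def simp del: fun_upd_apply simp: fun_upd_same)
    then show ?thesis by blast
  next
    case False
    then obtain x0 where x0: "x0 \<in> X" "a i x0 \<noteq> 0" by blast
    \<comment> \<open>This coefficient makes both sides agree at \<open>x0\<close>; together with
      agreement on the kernel \<open>Y\<close> this gives agreement on \<open>X\<close>.\<close>
    define d where "d = (l x0 - (\<Sum>j\<in>I. c j * a j x0)) / a i x0"
    have "l x = (\<Sum>j\<in>insert i I. (c(i := d)) j * a j x)" if x: "x \<in> X" for x
    proof -
      define r where "r = a i x / a i x0"
      have rx: "r *\<^sub>R x0 \<in> X" using x0 insert.prems(1) by (simp add: subspace_scale)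
      have "x - r *\<^sub>R x0 \<in> Y"
        using x x0 rx insert.prems(1)
        by (simp add: Y_def subspace_diff lin_on_diff[OF ai] lin_on_scale[OF ai] r_def)
      from c[OF this] have "l x - r * l x0 = (\<Sum>j\<in>I. c j * (a j x - r * a j x0))"
        using x x0 rx insert.prems
        by (simp add: lin_on_diff[OF insert.prems(3)] lin_on_scale[OF insert.prems(3)]
              lin_on_diff[OF insert.prems(2)] lin_on_scale[OF insert.prems(2)])
      also have "\<dots> = (\<Sum>j\<in>I. c j * a j x) - r * (\<Sum>j\<in>I. c j * a j x0)"
        by (simp add: sum_subtractf right_diff_distrib sum_distrib_left mult.left_commute)
      finally have "l x = (\<Sum>j\<in>I. c j * a j x) + r * (l x0 - (\<Sum>j\<in>I. c j * a j x0))"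
        by (simp add: algebra_simps)
      also have "r * (l x0 - (\<Sum>j\<in>I. c j * a j x0)) = d * a i x"
        by (simp add: r_def d_def)
      finally show ?thesis using insert.hyps by (simp add: upd fun_upd_same del: fun_upd_apply)
    qed
    then show ?thesis by blast
  qed
qed

text \<open>Fredholm alternative: the functionals \<open>a s\<close>, with \<open>s\<close> in a
  spanning set of \<open>X\<close>, combine to every functional that vanishes on their common
  kernel, which is the kernel of the adjoint problem. Only \<open>l\<close> has to vanish there, so
  the system may be singular, as it is in the presence of null functions.\<close>

lemma bilin_solve:
  assumes X: "fin_dim X" and Y: "subspace Y" and a: "bilin X Y a" and l: "lin_on Y l"
    and adj: "\<And>y. y \<in> Y \<Longrightarrow> (\<And>x. x \<in> X \<Longrightarrow> a x y = 0) \<Longrightarrow> l y = 0"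
  obtains x where "x \<in> X" "\<And>y. y \<in> Y \<Longrightarrow> a x y = l y"
proof -
  obtain S where S: "finite S" "X = span S" using X by (auto simp: fin_dim_def)
  have ay: "lin_on X (\<lambda>x. a x y)" if "y \<in> Y" for y using a that by (auto simp: bilin_def)
  have "\<exists>c. \<forall>y\<in>Y. l y = (\<Sum>s\<in>S. c s * a s y)"
  proof (rule functional_combination)
    show "lin_on Y (a s)" if "s \<in> S" for s
      using a that S by (auto simp: bilin_def span_base)
    show "l y = 0" if "y \<in> Y" "\<And>s. s \<in> S \<Longrightarrow> a s y = 0" for y
      using adj[OF that(1)] lin_on_vanish_span[of S "\<lambda>x. a x y"] ay[OF that(1)] S that(2) by auto
  qed (use S Y l in auto)
  then obtain c where c: "\<And>y. y \<in> Y \<Longrightarrow> l y = (\<Sum>s\<in>S. c s * a s y)" by blast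
  show thesis
  proof
    show "(\<Sum>s\<in>S. c s *\<^sub>R s) \<in> X" by (simp add: S span_sum span_scale span_base)
    show "a (\<Sum>s\<in>S. c s *\<^sub>R s) y = l y" if "y \<in> Y" for y
      using c[OF that] lin_on_sum[OF ay[OF that], of S "\<lambda>s. c s *\<^sub>R s"] S
      by (simp add: lin_on_scale[OF ay[OF that]] span_base span_scale)
  qed
qed

lemma fin_dim_subspace: "fin_dim X \<Longrightarrow> subspace X"
  by (auto simp: fin_dim_def)

lemma fin_dim_subset:
  assumes "fin_dim X" "subspace Y" "Y \<subseteq> X"
  shows "fin_dim Y"
proof -
  obtain S where S: "finite S" "X = span S" using assms by (auto simp: fin_dim_def)
  obtain B where B: "B \<subseteq> Y" "independent B" "Y \<subseteq> span B"
    using maximal_independent_subset by blast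
  have "finite B" using independent_span_bound[OF S(1) B(2)] B S assms by blast
  moreover have "Y = span B" using B assms by (metis span_minimal subset_antisym)
  ultimately show ?thesis by (auto simp: fin_dim_def)
qed

lemma fin_dim_Times:
  fixes X :: "'a::real_vector set" and Y :: "'b::real_vector set"
  assumes "fin_dim X" "fin_dim Y"
  shows "fin_dim (X \<times> Y)"
proof -
  obtain S T where S: "finite S" "X = span S" and T: "finite T" "Y = span T"
    using assms by (auto simp: fin_dim_def)
  have "X \<times> Y = span ((\<lambda>x. (x, 0)) ` S \<union> Pair 0 ` T)" (is "_ = span ?U")
  proof
    have l: "linear (\<lambda>x::'a. (x, 0::'b))" "linear (Pair (0::'a) :: 'b \<Rightarrow> _)"
      by (auto intro!: linearI simp: zero_prod_def)
    show "X \<times> Y \<subseteq> span ?U"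
    proof
      fix z assume "z \<in> X \<times> Y"
      then obtain x y where z: "z = (x, y)" "x \<in> span S" "y \<in> span T" using S T by auto
      have "(x, 0::'b) \<in> span ((\<lambda>x. (x, 0)) ` S)" "(0::'a, y) \<in> span (Pair 0 ` T)"
        using z by (auto simp: linear_span_image[OF l(1)] linear_span_image[OF l(2)])
      then have "(x, 0) + (0, y) \<in> span ?U"
        by (intro span_add) (auto intro: subsetD[OF span_mono, rotated])
      then show "z \<in> span ?U" by (simp add: z)
    qed
    have "subspace (X \<times> Y)" by (simp add: S T subspace_Times)
    then show "span ?U \<subseteq> X \<times> Y"
      using S T by (intro span_minimal) (auto simp: span_base span_zero)
  qed
  moreover have "finite ?U" using S T by simp
  ultimately show ?thesis unfolding fin_dim_def by blast
qed

lemma bilinD1: "bilin X Y a \<Longrightarrow> x \<in> X \<Longrightarrow> lin_on Y (a x)"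
  and bilinD2: "bilin X Y a \<Longrightarrow> y \<in> Y \<Longrightarrow> lin_on X (\<lambda>x. a x y)"
  by (auto simp: bilin_def)

lemma trilinD1: "trilin X Y Z t \<Longrightarrow> y \<in> Y \<Longrightarrow> z \<in> Z \<Longrightarrow> lin_on X (\<lambda>x. t x y z)"
  and trilinD2: "trilin X Y Z t \<Longrightarrow> x \<in> X \<Longrightarrow> z \<in> Z \<Longrightarrow> lin_on Y (\<lambda>y. t x y z)"
  and trilinD3: "trilin X Y Z t \<Longrightarrow> x \<in> X \<Longrightarrow> y \<in> Y \<Longrightarrow> lin_on Z (t x y)"
  by (auto simp: trilin_def bilin_def)

lemma trilin_subset:
  "trilin X Y Z t \<Longrightarrow> X' \<subseteq> X \<Longrightarrow> Y' \<subseteq> Y \<Longrightarrow> Z' \<subseteq> Z \<Longrightarrow> trilin X' Y' Z' t"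
  unfolding trilin_def using bilin_subset[of Y Z _ Y' Z'] lin_on_subset[of X _ X'] by blast

section \<open>Cauchy-Schwarz and seminorms for semidefinite forms\<close>

locale semi_inner_space =
  fixes X :: "'a::real_vector set" and g :: "'a \<Rightarrow> 'a \<Rightarrow> real"
  assumes subspace: "subspace X" and semi_inner: "semi_inner X g"
begin

definition nrm :: "'a \<Rightarrow> real" where "nrm x = sqrt (g x x)"

lemma bilin: "bilin X X g" using semi_inner by (auto simp: semi_inner_def)

lemmas add_l = lin_on_add[OF bilinD2[OF bilin]]
lemmas add_r = lin_on_add[OF bilinD1[OF bilin]]
lemmas scale_l = lin_on_scale[OF bilinD2[OF bilin]]
lemmas scale_r = lin_on_scale[OF bilinD1[OF bilin]]
lemmas diff_l = lin_on_diff[OF bilinD2[OF bilin] subspace]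
lemmas diff_r = lin_on_diff[OF bilinD1[OF bilin] subspace]

lemma sym: "x \<in> X \<Longrightarrow> y \<in> X \<Longrightarrow> g x y = g y x"
  and nonneg: "x \<in> X \<Longrightarrow> 0 \<le> g x x"
  using semi_inner by (auto simp: semi_inner_def)

lemma nrm_nonneg [simp]: "x \<in> X \<Longrightarrow> 0 \<le> nrm x" by (simp add: nrm_def nonneg)

lemma nrm_sq: "x \<in> X \<Longrightarrow> (nrm x)\<^sup>2 = g x x" by (simp add: nrm_def nonneg)

text \<open>The usual minimisation of the form along a line, kept homogeneous in two parameters so
  that \<open>g y y\<close>, which may be 0, is never a divisor.\<close>

lemma cauchy_schwarz_sq:
  assumes x: "x \<in> X" and y: "y \<in> X"
  shows "(g x y)\<^sup>2 \<le> g x x * g y y"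
proof -
  have *: "0 \<le> s\<^sup>2 * g x x - 2 * s * t * g x y + t\<^sup>2 * g y y" for s t
  proof -
    have m: "s *\<^sub>R x \<in> X" "t *\<^sub>R y \<in> X" using x y subspace by (auto simp: subspace_scale)
    have "0 \<le> g (s *\<^sub>R x - t *\<^sub>R y) (s *\<^sub>R x - t *\<^sub>R y)"
      using m subspace by (intro nonneg subspace_diff)
    also have "\<dots> = s\<^sup>2 * g x x - 2 * s * t * g x y + t\<^sup>2 * g y y"
      using m x y subspace sym[OF y x]
      by (simp add: diff_l diff_r scale_l scale_r subspace_diff power2_eq_square algebra_simps)
    finally show ?thesis .
  qed
  show ?thesis
  proof (cases "g y y = 0")
    case False
    then have pos: "g y y > 0" using nonneg[OF y] by simp
    have "0 \<le> g y y * (g y y * g x x - (g x y)\<^sup>2)"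
      using *[of "g y y" "g x y"] by (simp add: algebra_simps power2_eq_square)
    then show ?thesis using pos by (simp add: zero_le_mult_iff mult.commute)
  next
    case True
    show ?thesis
    proof (cases "g x y = 0")
      case False
      \<comment> \<open>For \<open>g y y = 0\<close> the form is affine in the second parameter;
        this value makes it equal to -1.\<close>
      have "0 \<le> g x x - 2 * ((g x x + 1) / (2 * g x y)) * g x y"
        using *[of 1 "(g x x + 1) / (2 * g x y)"] True by simp
      then show ?thesis using False by (simp add: field_simps)
    qed (use True in simp)
  qed
qed

lemma cauchy_schwarz: "x \<in> X \<Longrightarrow> y \<in> X \<Longrightarrow> \<bar>g x y\<bar> \<le> nrm x * nrm y"
  using real_sqrt_le_mono[OF cauchy_schwarz_sq[of x y]] by (simp add: nrm_def real_sqrt_mult)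

text \<open>Replaces definiteness throughout: null vectors may be discarded in either
  argument.\<close>

lemma null: "x \<in> X \<Longrightarrow> y \<in> X \<Longrightarrow> g x x = 0 \<Longrightarrow> g x y = 0"
  using cauchy_schwarz[of x y] by (simp add: nrm_def)

lemma nrm_scale: "x \<in> X \<Longrightarrow> nrm (c *\<^sub>R x) = \<bar>c\<bar> * nrm x"
  using subspace by (simp add: nrm_def scale_l scale_r subspace_scale real_sqrt_mult mult.assoc[symmetric])

lemma nrm_triangle: "x \<in> X \<Longrightarrow> y \<in> X \<Longrightarrow> nrm (x + y) \<le> nrm x + nrm y"
proof -
  assume m: "x \<in> X" "y \<in> X"
  have "(nrm (x + y))\<^sup>2 = g x x + 2 * g x y + g y y"
    using m subspace by (simp add: nrm_sq subspace_add add_l add_r sym[of y x])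
  also have "\<dots> \<le> (nrm x + nrm y)\<^sup>2"
    using cauchy_schwarz[of x y] m by (simp add: power2_sum nrm_sq)
  finally show ?thesis by (rule power2_le_imp_le) (simp add: m)
qed

lemma nrm_triangle_diff: "x \<in> X \<Longrightarrow> y \<in> X \<Longrightarrow> nrm x \<le> nrm y + nrm (x - y)"
  using nrm_triangle[of y "x - y"] subspace by (simp add: subspace_diff)

end

section \<open>Finite dimension: reproducing families and automatic boundedness\<close>

locale fin_semi_inner_space = semi_inner_space +
  assumes fin_dim: "fin_dim X"
begin

text \<open>A Gram--Schmidt family; only its reproducing property modulo null vectors is needed.\<close>

lemma reproducing_family:
  obtains E where "finite E" "E \<subseteq> X"
    "\<And>x y. x \<in> X \<Longrightarrow> y \<in> X \<Longrightarrow> g (x - (\<Sum>e\<in>E. g x e *\<^sub>R e)) y = 0"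
proof -
  obtain S where S: "finite S" "X = span S" using fin_dim by (auto simp: fin_dim_def)
  \<comment> \<open>Orthonormality is carried along only to run the induction over the spanning
    set.\<close>
  have "\<exists>E. finite E \<and> E \<subseteq> X \<and>
    (\<forall>x\<in>span T. \<forall>y\<in>X. g (x - (\<Sum>e\<in>E. g x e *\<^sub>R e)) y = 0) \<and>
    (\<forall>e\<in>E. \<forall>e'\<in>E. g e e' = (if e = e' then 1 else 0))" if "finite T" "T \<subseteq> S" for T
    using that
  proof (induction T rule: finite_induct)
    case empty
    show ?case
      by (rule exI[of _ "{}"]) (auto simp: lin_on_zero[OF bilinD2[OF bilin] subspace])
  next
    case (insert b T)
    then obtain E where E: "finite E" "E \<subseteq> X"
      and rep: "\<And>x y. x \<in> span T \<Longrightarrow> y \<in> X \<Longrightarrow> g (x - (\<Sum>e\<in>E. g x e *\<^sub>R e)) y = 0"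
      and on: "\<And>e e'. e \<in> E \<Longrightarrow> e' \<in> E \<Longrightarrow> g e e' = (if e = e' then 1 else 0)" by auto
    define P where "P x = x - (\<Sum>e\<in>E. g x e *\<^sub>R e)" for x
    have TX: "span T \<subseteq> X" using S insert.prems by (auto intro: subsetD[OF span_mono])
    have b: "b \<in> X" using S insert.prems by (auto simp: span_base)
    have sumX: "(\<Sum>e\<in>E. c e *\<^sub>R e) \<in> X" for c :: "'a \<Rightarrow> real"
      using E subspace by (auto intro!: subspace_sum subspace_scale)
    have PX: "P x \<in> X" if "x \<in> X" for x
      unfolding P_def using that sumX subspace by (auto intro: subspace_diff)
    have gP: "g (P x) y = g x y - (\<Sum>e\<in>E. g x e * g e y)" if "x \<in> X" "y \<in> X" for x y
    proof -
      have "g (\<Sum>e\<in>E. g x e *\<^sub>R e) y = (\<Sum>e\<in>E. g (g x e *\<^sub>R e) y)"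
        using E subspace that by (intro lin_on_sum[OF bilinD2[OF bilin] subspace]) (auto simp: subspace_scale)
      also have "\<dots> = (\<Sum>e\<in>E. g x e * g e y)"
        using E that by (intro sum.cong) (auto simp: scale_l)
      finally show ?thesis using that sumX by (simp add: P_def diff_l)
    qed
    have Pe: "g (P x) e = 0" if "x \<in> X" "e \<in> E" for x e
    proof -
      have "(\<Sum>e'\<in>E. g x e' * g e' e) = (\<Sum>e'\<in>E. if e' = e then g x e' else 0)"
        using on that by (intro sum.cong) auto
      then show ?thesis using gP[of x e] that E by (auto simp: subsetD)
    qed
    have split: "\<exists>k y. y \<in> span T \<and> x = k *\<^sub>R b + y" if "x \<in> span (insert b T)" for x
      using that by (metis add.commute diff_add_cancel span_breakdown_eq)
    have linP: "g (P x) y = k * g (P b) y + g (P z) y"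
      if "z \<in> span T" "x = k *\<^sub>R b + z" "y \<in> X" for x y z k
    proof -
      have zX: "z \<in> X" "k *\<^sub>R b \<in> X" "x \<in> X"
        using that TX b subspace by (auto simp: subspace_scale subspace_add)
      have gx: "g x w = k * g b w + g z w" if "w \<in> X" for w
        using that b zX \<open>x = _\<close> by (simp add: add_l scale_l)
      have "(\<Sum>e\<in>E. g x e * g e y) = (\<Sum>e\<in>E. k * (g b e * g e y) + g z e * g e y)"
        using gx E by (intro sum.cong) (auto simp: subsetD algebra_simps)
      also have "\<dots> = k * (\<Sum>e\<in>E. g b e * g e y) + (\<Sum>e\<in>E. g z e * g e y)"
        by (simp add: sum.distrib sum_distrib_left)
      finally show ?thesis using gP[OF zX(3) that(3)] gP[OF b that(3)] gP[OF zX(1) that(3)] gx[OF that(3)]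
        by (simp add: right_diff_distrib)
    qed
    show ?case
    \<comment> \<open>A null residual of \<open>b\<close> is invisible to \<open>g\<close>, so the
      old family already works; otherwise the normalised residual joins it.\<close>
    proof (cases "g (P b) (P b) = 0")
      case True
      have "g (x - (\<Sum>e\<in>E. g x e *\<^sub>R e)) y = 0" if x: "x \<in> span (insert b T)" and y: "y \<in> X" for x y
      proof -
        obtain k z where z: "z \<in> span T" "x = k *\<^sub>R b + z" using split[OF x] by blast
        have "g (P x) y = k * g (P b) y + g (P z) y" using linP[OF z y] .
        then show ?thesis using null[OF PX[OF b] y] True rep[OF z(1) y] by (simp add: P_def)
      qed
      with E on show ?thesis by (intro exI[of _ E] conjI) blast+
    next
      case False
      define n where "n = nrm (P b)"
      have n: "n > 0" using False nonneg[OF PX[OF b]] by (auto simp: n_def nrm_def)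
      define e0 where "e0 = (1 / n) *\<^sub>R P b"
      have e0X: "e0 \<in> X" unfolding e0_def using PX[OF b] subspace by (simp add: subspace_scale)
      have e0e: "g e0 e = 0" "g e e0 = 0" if "e \<in> E" for e
        using Pe[OF b that] PX[OF b] that E sym[of e e0] e0X by (auto simp: e0_def scale_l subsetD)
      have nn: "g (P b) (P b) = n * n" using nrm_sq[OF PX[OF b]] by (simp add: n_def power2_eq_square)
      have e00: "g e0 e0 = 1"
        using PX[OF b] e0X n by (simp add: e0_def scale_l scale_r subspace_scale[OF subspace] nn)
      have e0E: "e0 \<notin> E" using e0e e00 by fastforce
      \<comment> \<open>The component of \<open>b\<close> along \<open>e0\<close> is its whole
        residual: \<open>P b\<close> is orthogonal to \<open>E\<close>, so \<open>g b (P b)\<close>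
        equals \<open>g (P b) (P b)\<close>.\<close>
      have bP: "g b e0 *\<^sub>R e0 = P b"
      proof -
        have "g (P b) (P b) = g b (P b) - (\<Sum>e\<in>E. g b e * g e (P b))" using gP[OF b PX[OF b]] .
        also have "(\<Sum>e\<in>E. g b e * g e (P b)) = 0"
          using Pe[OF b] sym[OF _ PX[OF b]] E by (intro sum.neutral) (auto simp: subsetD)
        finally have "g b (P b) = n * n" using nn by simp
        then have "g b e0 = n" using b PX[OF b] n by (simp add: e0_def scale_r)
        then show ?thesis using n by (simp add: e0_def)
      qed
      have "g (x - (\<Sum>e\<in>insert e0 E. g x e *\<^sub>R e)) y = 0"
        if x: "x \<in> span (insert b T)" and y: "y \<in> X" for x y
      proof -
        obtain k z where z: "z \<in> span T" "x = k *\<^sub>R b + z" using split[OF x] by blast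
        have zX: "z \<in> X" "k *\<^sub>R b \<in> X" "x \<in> X" using z TX b subspace by (auto simp: subspace_scale subspace_add)
        \<comment> \<open>Vectors of the old span have null residuals, so they are orthogonal to the
          new member.\<close>
        have z0: "g z e0 = 0"
        proof -
          have "g (P z) e0 = 0" using rep[OF z(1) e0X] by (simp add: P_def)
          moreover have "g (P z) e0 = g z e0 - (\<Sum>e\<in>E. g z e * g e e0)" using gP zX e0X by blast
          ultimately show ?thesis using e0e by (simp cong: sum.cong)
        qed
        have xe0: "g x e0 *\<^sub>R e0 = k *\<^sub>R P b"
          using z zX b e0X z0 bP by (simp add: add_l scale_l flip: bP)
        have "x - (\<Sum>e\<in>insert e0 E. g x e *\<^sub>R e) = P x - k *\<^sub>R P b"
          using E e0E by (simp add: P_def[of x] xe0 algebra_simps)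
        then have "g (x - (\<Sum>e\<in>insert e0 E. g x e *\<^sub>R e)) y = g (P x) y - k * g (P b) y"
          using PX zX b y subspace by (simp add: diff_l scale_l subspace_scale)
        also have "\<dots> = 0" using linP[OF z y] rep[OF z(1) y] by (simp add: P_def[of z])
        finally show ?thesis .
      qed
      then have "\<forall>x\<in>span (insert b T). \<forall>y\<in>X. g (x - (\<Sum>e\<in>insert e0 E. g x e *\<^sub>R e)) y = 0"
        by blast
      moreover have "\<forall>e\<in>insert e0 E. \<forall>e'\<in>insert e0 E. g e e' = (if e = e' then 1 else 0)"
        using on e0e e00 e0E by auto
      ultimately show ?thesis using E e0X by (intro exI[of _ "insert e0 E"] conjI) (simp_all only:, auto)
    qed
  qed
  from this[OF S(1) subset_refl] that show thesis using S by blast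
qed

text \<open>The difference between \<open>x\<close> and its reproducing sum is a null vector, on
  which \<open>l\<close> vanishes.\<close>

lemma lin_on_expand:
  assumes "finite E" "E \<subseteq> X"
    and "\<And>x y. x \<in> X \<Longrightarrow> y \<in> X \<Longrightarrow> g (x - (\<Sum>e\<in>E. g x e *\<^sub>R e)) y = 0"
    and l: "lin_on X l" "\<And>x. x \<in> X \<Longrightarrow> g x x = 0 \<Longrightarrow> l x = 0" and x: "x \<in> X"
  shows "l x = (\<Sum>e\<in>E. g x e * l e)"
proof -
  have sX: "(\<Sum>e\<in>E. g x e *\<^sub>R e) \<in> X"
    using assms(2) subspace by (auto intro!: subspace_sum subspace_scale)
  then have d: "x - (\<Sum>e\<in>E. g x e *\<^sub>R e) \<in> X" using x subspace by (auto intro: subspace_diff)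
  then have "l (x - (\<Sum>e\<in>E. g x e *\<^sub>R e)) = 0" using assms(3) x by (intro l) auto
  then have "l x = l (\<Sum>e\<in>E. g x e *\<^sub>R e)" using lin_on_diff[OF l(1) subspace x sX] by simp
  also have "\<dots> = (\<Sum>e\<in>E. l (g x e *\<^sub>R e))"
    using assms(2) subspace by (intro lin_on_sum[OF l(1) subspace]) (auto intro: subspace_scale)
  also have "\<dots> = (\<Sum>e\<in>E. g x e * l e)"
    using assms(2) by (intro sum.cong) (auto simp: lin_on_scale[OF l(1)])
  finally show ?thesis .
qed

text \<open>The expansion reduces a bound on all of \<open>X\<close> to bounds at finitely many
  vectors, with one constant for the whole family. The weight \<open>h\<close> will be the seminorm
  of the remaining arguments, which turns this into bounds for bilinear and trilinear forms.\<close>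

lemma lin_on_bound_family:
  assumes "\<And>i. i \<in> I \<Longrightarrow> lin_on X (l i)" "\<And>i x. i \<in> I \<Longrightarrow> x \<in> X \<Longrightarrow> g x x = 0 \<Longrightarrow> l i x = 0"
    and "\<And>e. e \<in> X \<Longrightarrow> \<exists>K. \<forall>i\<in>I. \<bar>l i e\<bar> \<le> K * h i" and h: "\<And>i. i \<in> I \<Longrightarrow> h i \<ge> 0"
  shows "\<exists>K\<ge>0. \<forall>i\<in>I. \<forall>x\<in>X. \<bar>l i x\<bar> \<le> K * nrm x * h i"
proof -
  obtain E where E: "finite E" "E \<subseteq> X"
    "\<And>x y. x \<in> X \<Longrightarrow> y \<in> X \<Longrightarrow> g (x - (\<Sum>e\<in>E. g x e *\<^sub>R e)) y = 0"
    by (rule reproducing_family) blast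
  have "\<forall>e\<in>X. \<exists>K. \<forall>i\<in>I. \<bar>l i e\<bar> \<le> K * h i" using assms(3) by blast
  then obtain k where k: "\<And>e i. e \<in> X \<Longrightarrow> i \<in> I \<Longrightarrow> \<bar>l i e\<bar> \<le> k e * h i" by metis
  have k': "\<bar>l i e\<bar> \<le> \<bar>k e\<bar> * h i" if "e \<in> X" "i \<in> I" for e i
    using k[OF that] h[OF that(2)] by (meson abs_ge_self mult_right_mono order_trans)
  define K where "K = (\<Sum>e\<in>E. nrm e * \<bar>k e\<bar>)"
  have nE: "0 \<le> nrm e" if "e \<in> E" for e using that E by auto
  have "\<bar>l i x\<bar> \<le> K * nrm x * h i" if x: "x \<in> X" and i: "i \<in> I" for i x
  proof -
    have "\<bar>l i x\<bar> = \<bar>\<Sum>e\<in>E. g x e * l i e\<bar>"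
      using lin_on_expand[OF E assms(1,2)[OF i] x] by (rule arg_cong)
    also have "\<dots> \<le> (\<Sum>e\<in>E. \<bar>g x e\<bar> * \<bar>l i e\<bar>)"
      by (rule order_trans[OF sum_abs]) (simp add: abs_mult)
    also have "\<dots> \<le> (\<Sum>e\<in>E. (nrm x * nrm e) * (\<bar>k e\<bar> * h i))"
      using E x i by (intro sum_mono mult_mono cauchy_schwarz k') (auto simp: subsetD)
    also have "\<dots> = K * nrm x * h i" by (simp add: K_def sum_distrib_left sum_distrib_right algebra_simps)
    finally show ?thesis .
  qed
  moreover have "K \<ge> 0" unfolding K_def using nE by (auto intro!: sum_nonneg)
  ultimately show ?thesis by blast
qed

lemma lin_on_bound:
  assumes "lin_on X l" "\<And>x. x \<in> X \<Longrightarrow> g x x = 0 \<Longrightarrow> l x = 0"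
  shows "\<exists>K\<ge>0. \<forall>x\<in>X. \<bar>l x\<bar> \<le> K * nrm x"
proof -
  have "\<exists>K\<ge>0. \<forall>i\<in>{()}. \<forall>x\<in>X. \<bar>l x\<bar> \<le> K * nrm x * 1"
    using assms by (intro lin_on_bound_family[where h="\<lambda>_. 1"]) (auto intro: exI[of _ "\<bar>l e\<bar>" for e])
  then show ?thesis by auto
qed

text \<open>Only the finitely many coefficients against a reproducing family matter. Their limits
  define \<open>x\<close> explicitly, so it lies in \<open>X\<close> by construction; it is
  determined only up to null vectors.\<close>

lemma weak_imp_strong:
  assumes z: "\<And>n::nat. z n \<in> X" and conv: "\<And>e. e \<in> X \<Longrightarrow> convergent (\<lambda>n. g (z n) e)"
  obtains x where "x \<in> X" "(\<lambda>n. nrm (z n - x)) \<longlonglongrightarrow> 0"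
proof -
  obtain E where E: "finite E" "E \<subseteq> X"
    "\<And>x y. x \<in> X \<Longrightarrow> y \<in> X \<Longrightarrow> g (x - (\<Sum>e\<in>E. g x e *\<^sub>R e)) y = 0"
    by (rule reproducing_family) blast
  define c where "c e = lim (\<lambda>n. g (z n) e)" for e
  have c: "(\<lambda>n. g (z n) e) \<longlonglongrightarrow> c e" if "e \<in> E" for e
    unfolding c_def using conv that E by (auto simp: convergent_LIMSEQ_iff)
  define x where "x = (\<Sum>e\<in>E. c e *\<^sub>R e)"
  have sX: "(\<Sum>e\<in>E. d e *\<^sub>R e) \<in> X" for d :: "'a \<Rightarrow> real"
    using E(2) subspace by (auto intro!: subspace_sum subspace_scale)
  have xX: "x \<in> X" by (simp add: x_def sX)
  have nrm_sum: "nrm (\<Sum>e\<in>F. d e *\<^sub>R e) \<le> (\<Sum>e\<in>F. \<bar>d e\<bar> * nrm e)" if "F \<subseteq> X" "finite F" for F d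
    using that(2,1)
  proof (induction F rule: finite_induct)
    case empty
    then show ?case using lin_on_zero[OF bilinD2[OF bilin] subspace, of 0]
      by (simp add: nrm_def subspace subspace_0)
  next
    case (insert e F)
    have "(\<Sum>e\<in>F. d e *\<^sub>R e) \<in> X" using insert.prems subspace by (auto intro!: subspace_sum subspace_scale)
    then have "nrm (d e *\<^sub>R e + (\<Sum>e\<in>F. d e *\<^sub>R e)) \<le> nrm (d e *\<^sub>R e) + nrm (\<Sum>e\<in>F. d e *\<^sub>R e)"
      using insert.prems subspace by (intro nrm_triangle) (auto simp: subspace_scale)
    then show ?case using insert by (simp add: nrm_scale)
  qed
  have bound: "nrm (z n - x) \<le> (\<Sum>e\<in>E. \<bar>g (z n) e - c e\<bar> * nrm e)" for n
  proof -
    let ?s = "\<Sum>e\<in>E. g (z n) e *\<^sub>R e"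
    have dX: "z n - ?s \<in> X" using z sX subspace by (auto intro: subspace_diff)
    have eq: "?s - x = (\<Sum>e\<in>E. (g (z n) e - c e) *\<^sub>R e)"
      by (simp add: x_def scaleR_diff_left sum_subtractf)
    \<comment> \<open>The reproducing sum may differ from \<open>z n\<close> as a vector, but the
      difference has length zero.\<close>
    have "nrm (z n - ?s) = 0" using E(3)[OF z dX] by (simp add: nrm_def)
    moreover have "nrm ((z n - ?s) + (?s - x)) \<le> nrm (z n - ?s) + nrm (?s - x)"
      by (rule nrm_triangle) (use dX sX xX subspace in \<open>auto intro: subspace_diff\<close>)
    ultimately have "nrm (z n - x) \<le> nrm (?s - x)" by simp
    also have "\<dots> \<le> (\<Sum>e\<in>E. \<bar>g (z n) e - c e\<bar> * nrm e)"
      unfolding eq using E by (intro nrm_sum)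
    finally show ?thesis .
  qed
  have "(\<lambda>n. \<Sum>e\<in>E. \<bar>g (z n) e - c e\<bar> * nrm e) \<longlonglongrightarrow> (\<Sum>e\<in>E. \<bar>c e - c e\<bar> * nrm e)"
    using c by (intro tendsto_intros) auto
  then have "(\<lambda>n. \<Sum>e\<in>E. \<bar>g (z n) e - c e\<bar> * nrm e) \<longlonglongrightarrow> 0" by simp
  then have "(\<lambda>n. nrm (z n - x)) \<longlonglongrightarrow> 0"
  proof (rule Lim_null_comparison[OF always_eventually, rotated], intro allI)
    show "norm (nrm (z n - x)) \<le> (\<Sum>e\<in>E. \<bar>g (z n) e - c e\<bar> * nrm e)" for n
      using bound[of n] nrm_nonneg[OF subspace_diff[OF subspace z[of n] xX]] by simp
  qed
  then show thesis using that xX by blast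
qed

end

section \<open>Boundedness and continuity of multilinear forms\<close>

lemma bilin_bound:
  assumes X: "fin_semi_inner_space X g" and Y: "fin_semi_inner_space Y h" and a: "bilin X Y a"
    and null: "\<And>x y. x \<in> X \<Longrightarrow> y \<in> Y \<Longrightarrow> g x x = 0 \<or> h y y = 0 \<Longrightarrow> a x y = 0"
  obtains K where "K \<ge> 0"
    "\<And>x y. x \<in> X \<Longrightarrow> y \<in> Y \<Longrightarrow> \<bar>a x y\<bar> \<le> K * semi_inner_space.nrm g x * semi_inner_space.nrm h y"
proof -
  interpret X: fin_semi_inner_space X g by fact
  interpret Y: fin_semi_inner_space Y h by fact
  have "\<exists>K\<ge>0. \<forall>y\<in>Y. \<forall>x\<in>X. \<bar>a x y\<bar> \<le> K * X.nrm x * Y.nrm y"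
  proof (rule X.lin_on_bound_family)
    show "\<exists>K. \<forall>y\<in>Y. \<bar>a x y\<bar> \<le> K * Y.nrm y" if "x \<in> X" for x
      using Y.lin_on_bound[OF bilinD1[OF a that]] null that by blast
  qed (use null bilinD2[OF a] in auto)
  then show thesis using that by blast
qed

text \<open>The family is indexed by the pairs (y, z), weighted by the product of their seminorms;
  for each fixed x its bound is the bilinear one.\<close>

lemma trilin_bound:
  assumes X: "fin_semi_inner_space X g" and Y: "fin_semi_inner_space Y h" and Z: "fin_semi_inner_space Z k"
    and t: "trilin X Y Z t"
    and null: "\<And>x y z. x \<in> X \<Longrightarrow> y \<in> Y \<Longrightarrow> z \<in> Z \<Longrightarrow> g x x = 0 \<or> h y y = 0 \<or> k z z = 0 \<Longrightarrow> t x y z = 0"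
  obtains K where "K \<ge> 0" "\<And>x y z. x \<in> X \<Longrightarrow> y \<in> Y \<Longrightarrow> z \<in> Z \<Longrightarrow>
    \<bar>t x y z\<bar> \<le> K * semi_inner_space.nrm g x * semi_inner_space.nrm h y * semi_inner_space.nrm k z"
proof -
  interpret X: fin_semi_inner_space X g by fact
  interpret Y: fin_semi_inner_space Y h by fact
  interpret Z: fin_semi_inner_space Z k by fact
  have "\<exists>K\<ge>0. \<forall>p\<in>Y\<times>Z. \<forall>x\<in>X.
    \<bar>t x (fst p) (snd p)\<bar> \<le> K * X.nrm x * (Y.nrm (fst p) * Z.nrm (snd p))"
  proof (rule X.lin_on_bound_family)
    show "\<exists>K. \<forall>p\<in>Y\<times>Z. \<bar>t x (fst p) (snd p)\<bar> \<le> K * (Y.nrm (fst p) * Z.nrm (snd p))"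
      if x: "x \<in> X" for x
    proof -
      have "bilin Y Z (t x)" using t x by (auto simp: trilin_def)
      from bilin_bound[OF Y Z this] null x obtain K where
        "\<And>y z. y \<in> Y \<Longrightarrow> z \<in> Z \<Longrightarrow> \<bar>t x y z\<bar> \<le> K * Y.nrm y * Z.nrm z" by metis
      then show ?thesis by (intro exI[of _ K]) (auto simp: mult.assoc)
    qed
  qed (use null trilinD1[OF t] in auto)
  then show thesis using that by (fastforce simp: mult.assoc)
qed

text \<open>The bound is a hypothesis rather than a consequence of finite dimension, so that the
  lemma also serves the full spaces H1 and L2 when test functions approximate.\<close>

lemma bounded_bilin_tendsto:
  assumes X: "semi_inner_space X g" and Y: "semi_inner_space Y h" and a: "bilin X Y a"
    and bound: "\<And>x y. x \<in> X \<Longrightarrow> y \<in> Y \<Longrightarrow>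
      \<bar>a x y\<bar> \<le> K * semi_inner_space.nrm g x * semi_inner_space.nrm h y"
    and x: "\<And>n. x n \<in> X" "x' \<in> X" "(\<lambda>n. semi_inner_space.nrm g (x n - x')) \<longlonglongrightarrow> 0"
    and y: "\<And>n. y n \<in> Y" "y' \<in> Y" "(\<lambda>n. semi_inner_space.nrm h (y n - y')) \<longlonglongrightarrow> 0"
  shows "(\<lambda>n. a (x n) (y n)) \<longlonglongrightarrow> a x' y'"
proof -
  interpret X: semi_inner_space X g by fact
  interpret Y: semi_inner_space Y h by fact
  have dx: "x n - x' \<in> X" and dy: "y n - y' \<in> Y" for n
    using x y X.subspace Y.subspace by (auto intro: subspace_diff)
  have null: "(\<lambda>n. a (u n) (v n)) \<longlonglongrightarrow> 0"
    if "\<And>n. u n \<in> X" "\<And>n. v n \<in> Y" "(\<lambda>n. X.nrm (u n) * Y.nrm (v n)) \<longlonglongrightarrow> 0" for u v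
  proof (rule Lim_null_comparison[OF always_eventually])
    show "\<forall>n. norm (a (u n) (v n)) \<le> K * (X.nrm (u n) * Y.nrm (v n))"
      using bound that by (simp add: mult.assoc)
    show "(\<lambda>n. K * (X.nrm (u n) * Y.nrm (v n))) \<longlonglongrightarrow> 0"
      using tendsto_mult_right_zero[OF that(3)] .
  qed
  have 1: "(\<lambda>n. a (x n - x') (y n - y')) \<longlonglongrightarrow> 0"
    using tendsto_mult_zero[OF x(3) y(3)] dx dy by (intro null) auto
  have 2: "(\<lambda>n. a x' (y n - y')) \<longlonglongrightarrow> 0"
    using tendsto_mult_right_zero[OF y(3)] x dy by (intro null) auto
  have 3: "(\<lambda>n. a (x n - x') y') \<longlonglongrightarrow> 0"
    using tendsto_mult_left_zero[OF x(3)] y dx by (intro null) auto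
  have eq: "a (x n - x') (y n - y') + a x' (y n - y') + a (x n - x') y' + a x' y' = a (x n) (y n)" for n
  proof -
    note l = lin_on_diff[OF bilinD2[OF a] X.subspace] lin_on_diff[OF bilinD1[OF a] Y.subspace]
    show ?thesis using x y dx dy by (simp add: l)
  qed
  have "(\<lambda>n. a (x n - x') (y n - y') + a x' (y n - y') + a (x n - x') y' + a x' y') \<longlonglongrightarrow> 0 + 0 + 0 + a x' y'"
    by (intro tendsto_add 1 2 3 tendsto_const)
  then show ?thesis by (simp add: eq)
qed

lemma bilin_tendsto:
  assumes X: "fin_semi_inner_space X g" and Y: "fin_semi_inner_space Y h" and a: "bilin X Y a"
    and null: "\<And>x y. x \<in> X \<Longrightarrow> y \<in> Y \<Longrightarrow> g x x = 0 \<or> h y y = 0 \<Longrightarrow> a x y = 0"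
    and x: "\<And>n. x n \<in> X" "x' \<in> X" "(\<lambda>n. semi_inner_space.nrm g (x n - x')) \<longlonglongrightarrow> 0"
    and y: "\<And>n. y n \<in> Y" "y' \<in> Y" "(\<lambda>n. semi_inner_space.nrm h (y n - y')) \<longlonglongrightarrow> 0"
  shows "(\<lambda>n. a (x n) (y n)) \<longlonglongrightarrow> a x' y'"
proof -
  interpret X: fin_semi_inner_space X g by fact
  interpret Y: fin_semi_inner_space Y h by fact
  obtain K where "\<And>x y. x \<in> X \<Longrightarrow> y \<in> Y \<Longrightarrow> \<bar>a x y\<bar> \<le> K * X.nrm x * Y.nrm y"
    by (rule bilin_bound[OF X Y a]) (use null in blast)+
  from bounded_bilin_tendsto[OF X.semi_inner_space_axioms Y.semi_inner_space_axioms a this x y] show ?thesis .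
qed

lemma lin_tendsto:
  assumes X: "fin_semi_inner_space X g" and l: "lin_on X l"
    and null: "\<And>x. x \<in> X \<Longrightarrow> g x x = 0 \<Longrightarrow> l x = 0"
    and x: "\<And>n. x n \<in> X" "x' \<in> X" "(\<lambda>n. semi_inner_space.nrm g (x n - x')) \<longlonglongrightarrow> 0"
  shows "(\<lambda>n. l (x n)) \<longlonglongrightarrow> l x'"
proof -
  interpret X: fin_semi_inner_space X g by fact
  obtain K where K: "\<And>x. x \<in> X \<Longrightarrow> \<bar>l x\<bar> \<le> K * X.nrm x"
    using X.lin_on_bound[OF l null] by blast
  have "(\<lambda>n. l (x n) - l x') \<longlonglongrightarrow> 0"
  proof (rule Lim_null_comparison[OF always_eventually])
    show "(\<lambda>n. K * X.nrm (x n - x')) \<longlonglongrightarrow> 0" using tendsto_mult_right_zero[OF x(3)] .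
    show "\<forall>n. norm (l (x n) - l x') \<le> K * X.nrm (x n - x')"
      using K[OF subspace_diff[OF X.subspace x(1,2)]] x by (simp add: lin_on_diff[OF l X.subspace])
  qed
  then show ?thesis by (simp add: LIM_zero_iff)
qed

text \<open>The increments are summable and their partial sums telescope; 1/2 is the contraction
  factor of the iteration.\<close>

lemma convergent_geometric:
  fixes x :: "nat \<Rightarrow> real"
  assumes "\<And>n. \<bar>x (Suc n) - x n\<bar> \<le> c * (1/2) ^ n"
  shows "convergent x"
proof -
  have "summable (\<lambda>n. x (Suc n) - x n)"
    by (rule summable_comparison_test'[where g="\<lambda>n. c * (1/2) ^ n"])
      (use assms in \<open>auto intro!: summable_mult summable_geometric\<close>)
  then have "convergent (\<lambda>n. \<Sum>i<n. x (Suc i) - x i)" by (simp add: summable_iff_convergent)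
  then have "convergent (\<lambda>n. x n - x 0)" by (simp add: sum_lessThan_telescope)
  then show ?thesis using convergent_add_const_right_iff[of x "- x 0"] by simp
qed

text \<open>Equivalence of norms in semidefinite form: whatever vanishes on the null vectors of
  \<open>g\<close> is dominated by \<open>g\<close>. This upgrades convergence in the energy
  seminorms to H1 and H(curl), taking the place of an inverse estimate for the latter.\<close>

lemma dominated_tendsto:
  assumes X: "fin_semi_inner_space X g" and N: "semi_inner X N"
    and null: "\<And>x. x \<in> X \<Longrightarrow> g x x = 0 \<Longrightarrow> N x x = 0"
    and x: "\<And>n. x n \<in> X" "x' \<in> X" "(\<lambda>n. semi_inner_space.nrm g (x n - x')) \<longlonglongrightarrow> 0"
  shows "(\<lambda>n. sqrt (N (x n - x') (x n - x'))) \<longlonglongrightarrow> 0"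
proof -
  interpret X: fin_semi_inner_space X g by fact
  interpret N: semi_inner_space X N using X.subspace N by unfold_locales
  obtain K where K: "K \<ge> 0" "\<And>x y. x \<in> X \<Longrightarrow> y \<in> X \<Longrightarrow> \<bar>N x y\<bar> \<le> K * X.nrm x * X.nrm y"
  proof (rule bilin_bound[OF X X N.bilin])
    show "N x y = 0" if "x \<in> X" "y \<in> X" "g x x = 0 \<or> g y y = 0" for x y
      using that N.null[of x y] N.null[of y x] N.sym[of x y] null by auto
  qed blast
  have d: "x n - x' \<in> X" for n using x X.subspace by (auto intro: subspace_diff)
  have "(\<lambda>n. sqrt (K * X.nrm (x n - x') * X.nrm (x n - x'))) \<longlonglongrightarrow> sqrt (K * 0 * 0)"
    by (intro tendsto_intros x(3))
  then have lim: "(\<lambda>n. sqrt (K * X.nrm (x n - x') * X.nrm (x n - x'))) \<longlonglongrightarrow> 0" by simp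
  show ?thesis
    by (rule Lim_null_comparison[OF always_eventually lim])
      (use N.nonneg[OF d] in \<open>auto intro!: real_sqrt_le_mono order_trans[OF abs_ge_self K(2)] d\<close>)
qed

lemma semi_inner_add:
  "semi_inner X g \<Longrightarrow> semi_inner X h \<Longrightarrow> semi_inner X (\<lambda>u v. g u v + h u v)"
  by (auto simp: semi_inner_def bilin_def lin_on_def algebra_simps)

lemma semi_inner_sum:
  assumes "\<And>i. i \<in> I \<Longrightarrow> semi_inner X (g i)"
  shows "semi_inner X (\<lambda>u v. \<Sum>i\<in>I. g i u v)"
  using assms unfolding semi_inner_def bilin_def lin_on_def
  by (auto simp: sum.distrib sum_distrib_left intro!: sum_nonneg sum.cong)

section \<open>The abstract Picard iteration\<close>

text \<open>\<open>W\<close> and \<open>D\<close> stand for the discrete \<open>H(curl)\<close> and \<open>H(div)\<close> spaces, and \<open>L\<close> for an ambient space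
  (later: the essentially bounded fields) on which the triple product \<open>cr a B c = (a \<times> B, c)\<close> makes
  sense. The forms \<open>gi\<close>, \<open>ip\<close>, \<open>dd\<close>, \<open>iq\<close>, \<open>b\<close>, \<open>conv\<close> are \<open>(\<nabla>u, \<nabla>v)\<close>, \<open>(u, v)\<close>, \<open>(div B, div C)\<close>,
  \<open>(p, q)\<close>, \<open>(div u, q)\<close>, \<open>((w \<bullet> \<nabla>) u, v)\<close>. Since functions are not identified almost everywhere,
  the inner products are only semidefinite.\<close>

locale picard =
  fixes V W D L :: "'a::real_vector set" and Q :: "'b::real_vector set"
    and gi ip dd :: "'a \<Rightarrow> 'a \<Rightarrow> real" and iq :: "'b \<Rightarrow> 'b \<Rightarrow> real"
    and b :: "'a \<Rightarrow> 'b \<Rightarrow> real" and rot :: "'a \<Rightarrow> 'a" and conv cr :: "'a \<Rightarrow> 'a \<Rightarrow> 'a \<Rightarrow> real"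
    and f :: "'a \<Rightarrow> real" and S RH :: real
  assumes fin: "fin_dim V" "fin_dim W" "fin_dim D" "fin_dim Q"
    and L: "subspace L" "V \<subseteq> L" "W \<subseteq> L" "D \<subseteq> L"
    and inner: "semi_inner V gi" "semi_inner L ip" "semi_inner D dd" "semi_inner Q iq"
    and poincare: "\<And>v. v \<in> V \<Longrightarrow> gi v v = 0 \<Longrightarrow> ip v v = 0"
    and b: "bilin V Q b"
    and inf_sup: "\<And>q. q \<in> Q \<Longrightarrow> (\<And>v. v \<in> V \<Longrightarrow> b v q = 0) \<Longrightarrow> iq q q = 0"
    and rot_L: "\<And>F. F \<in> W \<Longrightarrow> rot F \<in> L"
    and rot: "bilin L W (\<lambda>B F. ip B (rot F))"
    and rot_range: "\<And>F. F \<in> W \<Longrightarrow> \<exists>C\<in>D. (\<forall>B\<in>L. ip B C = ip B (rot F)) \<and> (\<forall>B\<in>D. dd B C = 0)"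
    and rot_onto: "\<And>B. B \<in> D \<Longrightarrow> dd B B = 0 \<Longrightarrow> \<exists>F\<in>W. \<forall>C\<in>L. ip C B = ip C (rot F)"
    and conv: "trilin V V V conv"
    and conv_null: "\<And>x y z. x \<in> V \<Longrightarrow> y \<in> V \<Longrightarrow> z \<in> V \<Longrightarrow> gi x x = 0 \<or> gi y y = 0 \<or> gi z z = 0 \<Longrightarrow> conv x y z = 0"
    and conv_skew: "\<And>w u. w \<in> V \<Longrightarrow> u \<in> V \<Longrightarrow> (\<And>q. q \<in> Q \<Longrightarrow> b w q = 0) \<Longrightarrow> conv w u u = 0"
    and cr: "trilin L L L cr"
    and cr_anti: "\<And>x y z. x \<in> L \<Longrightarrow> y \<in> L \<Longrightarrow> z \<in> L \<Longrightarrow> cr x y z = - cr z y x"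
    and cr_null: "\<And>x y z. x \<in> L \<Longrightarrow> y \<in> L \<Longrightarrow> z \<in> L \<Longrightarrow> ip x x = 0 \<or> ip y y = 0 \<Longrightarrow> cr x y z = 0"
    and f: "lin_on V f"
    and f_null: "\<And>v. v \<in> V \<Longrightarrow> gi v v = 0 \<Longrightarrow> f v = 0"
    and S: "S > 0" and RH: "RH \<ge> 0"
begin

text \<open>The cross-product terms are already separated by linearity and each equation has its own
  test variable; \<open>picard_step_iff\<close> links this to the coupled formulation.\<close>

definition step :: "real \<Rightarrow> real \<Rightarrow> 'a \<Rightarrow> 'a \<Rightarrow> 'a \<Rightarrow> 'b \<Rightarrow> 'a \<Rightarrow> 'a \<Rightarrow> 'a \<Rightarrow> bool" where
  "step re rm u0 B0 u p E B j \<longleftrightarrow> u \<in> V \<and> p \<in> Q \<and> E \<in> W \<and> B \<in> D \<and> j \<in> W \<and>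
     (\<forall>v\<in>V. inverse re * gi u v + conv u0 u v - S * cr j B0 v - b v p = f v) \<and>
     (\<forall>F\<in>W. ip j F - ip B (rot F) = 0) \<and>
     (\<forall>C\<in>D. ip (rot E) C + dd B C = 0) \<and>
     (\<forall>k\<in>W. inverse rm * ip j k - (ip E k + cr u B0 k - RH * cr j B0 k) = 0) \<and>
     (\<forall>q\<in>Q. b u q = 0)"

definition div_free :: "'a \<Rightarrow> bool" where "div_free u \<longleftrightarrow> u \<in> V \<and> (\<forall>q\<in>Q. b u q = 0)"

lemmas sub = fin[THEN fin_dim_subspace]

sublocale V: fin_semi_inner_space V gi
  using fin inner sub by unfold_locales
sublocale Lp: semi_inner_space L ip
  using inner L by unfold_locales
sublocale W: fin_semi_inner_space W ip
  using fin sub semi_inner_subset[OF inner(2)] L by unfold_locales auto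
sublocale D: fin_semi_inner_space D ip
  using fin sub semi_inner_subset[OF inner(2)] L by unfold_locales auto
sublocale Dd: fin_semi_inner_space D dd
  using fin inner sub by unfold_locales
sublocale Q: fin_semi_inner_space Q iq
  using fin inner sub by unfold_locales

lemmas V_fin = V.fin_semi_inner_space_axioms
lemmas W_fin = W.fin_semi_inner_space_axioms
lemmas D_fin = D.fin_semi_inner_space_axioms

text \<open>The seminorms are the energy ones: the gradient form for \<open>u\<close>, the plain
  inner products for the rest. The last conjunct supplies the divergence part for \<open>B\<close>;
  it starts at \<open>Suc n\<close> since the initial field need not be divergence free.\<close>

definition has_limits :: "(nat \<Rightarrow> 'a) \<Rightarrow> (nat \<Rightarrow> 'b) \<Rightarrow> (nat \<Rightarrow> 'a) \<Rightarrow> (nat \<Rightarrow> 'a) \<Rightarrow> (nat \<Rightarrow> 'a) \<Rightarrow> bool" where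
  "has_limits u p E B j \<longleftrightarrow> (\<exists>u'\<in>V. \<exists>p'\<in>Q. \<exists>E'\<in>W. \<exists>B'\<in>D. \<exists>j'\<in>W.
     (\<lambda>n. V.nrm (u n - u')) \<longlonglongrightarrow> 0 \<and> (\<lambda>n. Q.nrm (p n - p')) \<longlonglongrightarrow> 0 \<and>
     (\<lambda>n. W.nrm (E n - E')) \<longlonglongrightarrow> 0 \<and> (\<lambda>n. D.nrm (B n - B')) \<longlonglongrightarrow> 0 \<and>
     (\<lambda>n. W.nrm (j n - j')) \<longlonglongrightarrow> 0 \<and> (\<forall>n. dd (B (Suc n) - B') (B (Suc n) - B') = 0))"

section \<open>Structure and solvability of a single step\<close>

lemma VL: "v \<in> V \<Longrightarrow> v \<in> L" and WL: "w \<in> W \<Longrightarrow> w \<in> L" and DL: "d \<in> D \<Longrightarrow> d \<in> L"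
  using L by auto

text \<open>Test with the member \<open>C\<close> of \<open>D\<close> that represents
  \<open>rot E\<close>: being a curl, it drops out of the \<open>dd\<close> term, and the squared
  length of \<open>rot E\<close> remains. Testing with \<open>B\<close> itself then leaves
  \<open>dd B B\<close>.\<close>

lemma rot_E_null:
  assumes E: "E \<in> W" and B: "B \<in> D" and e: "\<And>C. C \<in> D \<Longrightarrow> ip (rot E) C + dd B C = 0"
  shows "x \<in> L \<Longrightarrow> ip x (rot E) = 0" and "dd B B = 0"
proof -
  obtain C where C: "C \<in> D" "\<And>B. B \<in> L \<Longrightarrow> ip B C = ip B (rot E)" "\<And>B. B \<in> D \<Longrightarrow> dd B C = 0"
    using rot_range[OF E(1)] by blast
  have "ip (rot E) (rot E) = 0" using C E rot_L e[OF C(1)] B by simp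
  then have *: "ip x (rot E) = 0" if "x \<in> L" for x
    using Lp.null Lp.sym that rot_L E by metis
  then show "x \<in> L \<Longrightarrow> ip x (rot E) = 0" .
  show "dd B B = 0" using e[OF B] *[OF DL[OF B]] Lp.sym[OF rot_L[OF E] DL[OF B]] by simp
qed

lemma cr_self: "x \<in> L \<Longrightarrow> y \<in> L \<Longrightarrow> cr x y x = 0"
  using cr_anti[of x y x] by simp

text \<open>Antisymmetry exchanges the outer slots, so the third inherits \<open>cr_null\<close>
  from the first.\<close>

lemma cr_null_any:
  assumes "x \<in> L" "y \<in> L" "z \<in> L" "ip x x = 0 \<or> ip y y = 0 \<or> ip z z = 0"
  shows "cr x y z = 0"
  using cr_null[of x y z] cr_null[of z y x] cr_anti[of x y z] assms by auto

text \<open>Injectivity of the adjoint system gives solvability; testing it with its own solution reproduces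
  the energy identity with zero load.\<close>

lemma step_exists:
  assumes re: "re > 0" and rm: "rm > 0" and u0: "div_free u0" and B0: "B0 \<in> D"
  shows "\<exists>u p E B j. step re rm u0 B0 u p E B j"
proof -
  let ?X = "V \<times> Q \<times> W \<times> D \<times> W"
  \<comment> \<open>The five equations are added into one form on the product space; test tuples
    with a single nonzero entry separate them again.\<close>
  define a where "a = (\<lambda>(u, p, E, B, j) (v, q, F, C, k).
     (inverse re * gi u v + conv u0 u v - S * cr j B0 v - b v p) + (ip j F - ip B (rot F)) +
     (ip (rot E) C + dd B C) + (inverse rm * ip j k - (ip E k + cr u B0 k - RH * cr j B0 k)) - b u q)"
  have u0V: "u0 \<in> V" using u0 by (simp add: div_free_def)
  have X: "fin_dim ?X" by (intro fin_dim_Times fin)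
  have rotl: "lin_on W (\<lambda>F. ip (rot F) C)" if "C \<in> L" for C
    using bilinD1[OF rot that] Lp.sym[OF that rot_L] by (simp add: lin_on_def sub subspace_add subspace_scale)
  note ls = bilinD1[OF V.bilin] bilinD2[OF V.bilin] bilinD1[OF Lp.bilin] bilinD2[OF Lp.bilin]
    bilinD1[OF Dd.bilin] bilinD2[OF Dd.bilin] bilinD1[OF b] bilinD2[OF b] bilinD1[OF rot] bilinD2[OF rot]
    trilinD2[OF conv] trilinD3[OF conv] trilinD1[OF cr] trilinD3[OF cr] rotl
  note lins = ls[THEN lin_on_add] ls[THEN lin_on_scale]
  have a_bilin: "bilin ?X ?X a"
    unfolding bilin_def lin_on_def a_def
    using u0V DL[OF B0] sub L(1)
    by (auto simp: lins VL WL DL rot_L subspace_add subspace_scale algebra_simps)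
  have l: "lin_on ?X (\<lambda>(v, q, F, C, k). f v)"
    using f by (auto simp: lin_on_def)
  have z: "(0::'a) \<in> V" "(0::'a) \<in> W" "(0::'a) \<in> D" "(0::'a) \<in> L" "(0::'b) \<in> Q"
    using sub L by (auto simp: subspace_0)
  note zs = ls[THEN lin_on_zero]
  have zero: "gi v 0 = 0" "gi 0 v = 0" "conv u0 0 v = 0" "conv u0 v 0 = 0" "b v 0 = 0" if "v \<in> V" for v
    using zs that u0V sub by auto
  have zero': "cr 0 B0 v = 0" "cr v B0 0 = 0" "ip v 0 = 0" "ip 0 v = 0" "ip v (rot 0) = 0" "ip (rot 0) v = 0" if "v \<in> L" for v
    using zs that DL[OF B0] sub L by auto
  have zero'': "dd v 0 = 0" "dd 0 v = 0" if "v \<in> D" for v using zs that sub by auto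
  have zero3: "b 0 q = 0" if "q \<in> Q" for q using zs that sub by auto
  note zero = zero zero' zero'' zero3
  have adj: "(case y of (v, q, F, C, k) \<Rightarrow> f v) = 0" if y: "y \<in> ?X" and ay: "\<And>x. x \<in> ?X \<Longrightarrow> a x y = 0" for y
  proof -
    obtain v q F C k where yy: "y = (v, q, F, C, k)" by (metis prod_cases5)
    with y have m: "v \<in> V" "q \<in> Q" "F \<in> W" "C \<in> D" "k \<in> W" by auto
    note zz = z zero VL WL DL rot_L m DL[OF B0]
    \<comment> \<open>Trial tuples supported in one entry isolate the adjoint equations. The current
      and velocity entries are tried only with \<open>k\<close> and \<open>v\<close>, as the energy
      identity requires.\<close>
    have e2: "b v p = 0" if "p \<in> Q" for p
      using ay[of "(0, p, 0, 0, 0)"] that by (simp add: yy a_def zz)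
    have eE: "ip (rot E) C = ip E k" if "E \<in> W" for E
      using ay[of "(0, 0, E, 0, 0)"] that by (simp add: yy a_def zz)
    have eB: "- ip B (rot F) + dd B C = 0" if "B \<in> D" for B
      using ay[of "(0, 0, 0, B, 0)"] that by (simp add: yy a_def zz)
    have ej: "- S * cr k B0 v + ip k F + inverse rm * ip k k + RH * cr k B0 k = 0"
      using ay[of "(0, 0, 0, 0, k)"] by (simp add: yy a_def zz)
    have eu: "inverse re * gi v v + conv u0 v v - cr v B0 k - b v q = 0"
      using ay[of "(v, 0, 0, 0, 0)"] by (simp add: yy a_def zz)
    \<comment> \<open>In the adjoint system \<open>F\<close> takes the part of the electric field.
      The trial field \<open>C'\<close> representing \<open>rot F\<close> has zero divergence, so
      \<open>eB\<close> shows \<open>rot F\<close> to be null, and \<open>rot_E_null\<close> applies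
      with zero magnetic field.\<close>
    have "ip x (rot F) = 0" if x: "x \<in> L" for x
    proof (rule rot_E_null(1)[OF m(3) z(3) _ x])
      obtain C' where C': "C' \<in> D" "\<And>B. B \<in> L \<Longrightarrow> ip B C' = ip B (rot F)" "\<And>B. B \<in> D \<Longrightarrow> dd B C' = 0"
        using rot_range[OF m(3)] by blast
      have "ip C' (rot F) = 0" using eB[OF C'(1)] C'(3)[OF m(4)] Dd.sym[OF C'(1) m(4)] by simp
      then have "ip (rot F) (rot F) = 0"
        using C'(2)[OF rot_L[OF m(3)]] Lp.sym[OF DL[OF C'(1)] rot_L[OF m(3)]] by simp
      then show "ip (rot F) B + dd 0 B = 0" if "B \<in> D" for B
        using that by (simp add: zz Lp.null)
    qed
    then have "ip k F = 0" using eE[OF m(3)] Lp.sym m rot_L WL DL by metis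
    moreover have "cr k B0 k = 0" using m by (simp add: cr_self zz)
    moreover have "conv u0 v v = 0" using u0 m by (intro conv_skew) (auto simp: div_free_def)
    moreover have "cr k B0 v = - cr v B0 k" using zz by (intro cr_anti) auto
    \<comment> \<open>Here \<open>S\<close> weights the velocity equation, whereas in the forward
      energy identity it weights Ohm's law: passing to the adjoint moves the coupling term with
      factor \<open>S\<close> into the current equation.\<close>
    ultimately have "S * (inverse re * gi v v) + inverse rm * ip k k = 0"
      using ej eu e2[OF m(2)] by (simp add: algebra_simps)
    moreover have "0 \<le> S * (inverse re * gi v v)" "0 \<le> inverse rm * ip k k"
      using S re rm V.nonneg m Lp.nonneg WL by auto
    ultimately have "S * (inverse re * gi v v) = 0" by linarith
    then have "gi v v = 0" using S re by simp
    then show ?thesis using f_null m yy by simp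
  qed
  obtain x where x: "x \<in> ?X" and eq: "\<And>y. y \<in> ?X \<Longrightarrow> a x y = (\<lambda>(v, q, F, C, k). f v) y"
  proof (rule bilin_solve[OF X fin_dim_subspace[OF X] a_bilin l])
    show "(case y of (v, q, F, C, k) \<Rightarrow> f v) = 0" if "y \<in> ?X" "\<And>x. x \<in> ?X \<Longrightarrow> a x y = 0" for y
      using that by (rule adj)
  qed blast
  obtain u p E B j where xx: "x = (u, p, E, B, j)" by (metis prod_cases5)
  with x have m: "u \<in> V" "p \<in> Q" "E \<in> W" "B \<in> D" "j \<in> W" by auto
  note zz = z zero VL WL DL rot_L m DL[OF B0]
  have f0: "f 0 = 0" using lin_on_zero[OF f] sub by auto
  have "step re rm u0 B0 u p E B j"
    unfolding step_def
  proof (intro conjI ballI)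
    show "inverse re * gi u v + conv u0 u v - S * cr j B0 v - b v p = f v" if "v \<in> V" for v
      using eq[of "(v, 0, 0, 0, 0)"] that by (simp add: xx a_def zz)
    show "ip j F - ip B (rot F) = 0" if "F \<in> W" for F
      using eq[of "(0, 0, F, 0, 0)"] that by (simp add: xx a_def zz f0)
    show "ip (rot E) C + dd B C = 0" if "C \<in> D" for C
      using eq[of "(0, 0, 0, C, 0)"] that by (simp add: xx a_def zz f0)
    show "inverse rm * ip j k - (ip E k + cr u B0 k - RH * cr j B0 k) = 0" if "k \<in> W" for k
      using eq[of "(0, 0, 0, 0, k)"] that by (simp add: xx a_def zz f0)
    show "b u q = 0" if "q \<in> Q" for q
      using eq[of "(0, q, 0, 0, 0)"] that by (simp add: xx a_def zz f0)
  qed (use m in auto)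
  then show ?thesis by blast
qed

text \<open>The third equation is kept only through its two consequences from
  \<open>rot_E_null\<close>.\<close>

lemma stepD:
  assumes "step re rm u0 B0 u p E B j"
  shows "u \<in> V" "p \<in> Q" "E \<in> W" "B \<in> D" "j \<in> W"
    and "\<And>v. v \<in> V \<Longrightarrow> inverse re * gi u v + conv u0 u v - S * cr j B0 v - b v p = f v"
    and "\<And>F. F \<in> W \<Longrightarrow> ip j F = ip B (rot F)"
    and "\<And>x. x \<in> L \<Longrightarrow> ip x (rot E) = 0"
    and "dd B B = 0"
    and "\<And>k. k \<in> W \<Longrightarrow> inverse rm * ip j k = ip E k + cr u B0 k - RH * cr j B0 k"
    and "div_free u"
proof -
  show *: "u \<in> V" "p \<in> Q" "E \<in> W" "B \<in> D" "j \<in> W"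
    and "\<And>v. v \<in> V \<Longrightarrow> inverse re * gi u v + conv u0 u v - S * cr j B0 v - b v p = f v"
    and "\<And>F. F \<in> W \<Longrightarrow> ip j F = ip B (rot F)"
    and "\<And>k. k \<in> W \<Longrightarrow> inverse rm * ip j k = ip E k + cr u B0 k - RH * cr j B0 k"
    and "div_free u"
    using assms by (auto simp: step_def div_free_def)
  have "\<And>C. C \<in> D \<Longrightarrow> ip (rot E) C + dd B C = 0" using assms by (auto simp: step_def)
  then show "\<And>x. x \<in> L \<Longrightarrow> ip x (rot E) = 0" "dd B B = 0"
    using rot_E_null * by auto
qed

section \<open>Energy, magnetic bound and contraction\<close>

lemma step_energy:
  assumes st: "step re rm u0 B0 u p E B j" and u0: "div_free u0" and B0: "B0 \<in> D"
  shows "inverse re * gi u u + S * inverse rm * ip j j = f u"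
proof -
  note d = stepD[OF st]
  note mL = VL[OF d(1)] WL[OF d(3)] WL[OF d(5)] DL[OF B0] DL[OF d(4)]
  have "conv u0 u u = 0" using u0 d by (intro conv_skew) (auto simp: div_free_def)
  moreover have "b u p = 0" using d by (auto simp: div_free_def)
  moreover have "ip E j = 0" using d(7)[OF d(3)] d(8)[OF mL(5)] Lp.sym[OF mL(2,3)] by simp
  moreover have "cr j B0 j = 0" using mL by (simp add: cr_self)
  moreover have "cr u B0 j = - cr j B0 u" using mL by (intro cr_anti)
  moreover have "S * inverse rm * ip j j = S * (inverse rm * ip j j)" by simp
  ultimately show ?thesis using d(6)[OF d(1)] d(10)[OF d(5)] by simp
qed

text \<open>A step is linear in its new unknowns, with coefficients frozen at the previous iterate.
  In the difference the newer coefficients meet only the new increments, where skew-symmetry removes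
  or cancels them. What remains on the right pairs the previous increments \<open>u - u0\<close> and
  \<open>B - B0\<close> with the intermediate solution and is linear in a new increment, as a
  contraction needs.\<close>

lemma step_difference:
  assumes st0: "step re rm u0 B0 u p E B j" and st: "step re rm u B u' p' E' B' j'"
    and u0: "u0 \<in> V" and B0: "B0 \<in> D"
  shows "inverse re * gi (u' - u) (u' - u) + S * inverse rm * ip (j' - j) (j' - j) =
    - conv (u - u0) u (u' - u) + S * cr j (B - B0) (u' - u) + S * cr u (B - B0) (j' - j)
    - S * RH * cr j (B - B0) (j' - j)"
proof -
  note d = stepD[OF st0] and d' = stepD[OF st]
  note mL = VL[OF d(1)] WL[OF d(3)] WL[OF d(5)] DL[OF B0] DL[OF d(4)]
    VL[OF d'(1)] WL[OF d'(3)] WL[OF d'(5)] DL[OF d'(4)]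
  define v where "v = u' - u"
  define k where "k = j' - j"
  have v: "v \<in> V" and k: "k \<in> W" using d d' sub by (auto simp: v_def k_def subspace_diff)
  note vL = VL[OF v] WL[OF k]
  have BB: "B - B0 \<in> L" using mL L(1) by (auto intro: subspace_diff)
  have uu: "u - u0 \<in> V" using u0 d sub by (auto intro: subspace_diff)
  note cl = trilinD1[OF conv, THEN lin_on_diff, OF _ _ sub(1)]
    trilinD2[OF conv, THEN lin_on_diff, OF _ _ sub(1)]
  note xl = trilinD1[OF cr, THEN lin_on_diff, OF _ _ L(1)] trilinD2[OF cr, THEN lin_on_diff, OF _ _ L(1)]
  have div: "b v p = 0" "b v p' = 0"
    using d d' lin_on_diff[OF bilinD2[OF b] sub(1)] by (auto simp: v_def div_free_def)
  have "conv u v v = 0" using d v by (intro conv_skew) (auto simp: div_free_def)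
  moreover have "conv u v v = conv u u' v - conv u u v" unfolding v_def
    using d d' v by (intro cl(2)) (auto simp: v_def)
  ultimately have c1: "conv u u' v = conv u u v" by simp
  have c2: "conv (u - u0) u v = conv u u v - conv u0 u v" using d u0 v by (intro cl(1))
  have g1: "gi v v = gi u' v - gi u v" unfolding v_def
    using d d' v by (intro V.diff_l) (auto simp: v_def)
  have x1: "cr k B v = cr j' B v - cr j B v" unfolding k_def using mL vL by (intro xl(1))
  have x2: "cr j (B - B0) v = cr j B v - cr j B0 v" using mL vL by (intro xl(2))
  have x3: "cr v B k = cr u' B k - cr u B k" unfolding v_def using mL vL by (intro xl(1))
  have x4: "cr u (B - B0) k = cr u B k - cr u B0 k" using mL vL by (intro xl(2))
  have x5: "cr j (B - B0) k = cr j B k - cr j B0 k" using mL vL by (intro xl(2))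
  have "cr k B k = 0" using mL vL by (simp add: cr_self)
  moreover have "cr k B k = cr j' B k - cr j B k" unfolding k_def
    using mL vL by (intro xl(1)) (auto simp: k_def)
  ultimately have x6: "cr j' B k = cr j B k" by simp
  have x7: "cr v B k = - cr k B v" using mL vL by (intro cr_anti)
  have i1: "ip k k = ip j' k - ip j k" unfolding k_def
    using mL vL by (intro Lp.diff_l) (auto simp: k_def)
  \<comment> \<open>All four pairings vanish, the mixed ones too: either current satisfies Ampere's
    law and either electric field is curl free.\<close>
  have z: "ip E k = 0" "ip E' k = 0"
  proof -
    have "ip j E = 0" "ip j' E = 0" "ip j E' = 0" "ip j' E' = 0"
      using d(7) d'(7) d(8) d'(8) d(3) d'(3) mL by auto
    then show "ip E k = 0" "ip E' k = 0"
      using mL by (simp_all add: k_def Lp.diff_r Lp.sym[of E] Lp.sym[of E'])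
  qed
  have A: "inverse re * gi v v = - conv (u - u0) u v + S * cr k B v + S * cr j (B - B0) v"
    using d(6)[OF v] d'(6)[OF v] div c1 by (simp add: g1 c2 x1 x2 right_diff_distrib)
  have "inverse rm * ip k k = cr v B k + cr u (B - B0) k - RH * cr j (B - B0) k"
    using d(10)[OF k] d'(10)[OF k] z x6 by (simp add: x3 x4 x5 i1 right_diff_distrib)
  \<comment> \<open>The weight \<open>S\<close> matches the coupling in the momentum identity
    \<open>A\<close>; by \<open>x7\<close> the two copies of \<open>cr k B v\<close> will
    cancel.\<close>
  then have "S * (inverse rm * ip k k) = S * (- cr k B v + cr u (B - B0) k - RH * cr j (B - B0) k)"
    using x7 by simp
  then show ?thesis using A unfolding v_def[symmetric] k_def[symmetric] by (simp add: algebra_simps)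
qed

text \<open>The condition is quadratic, but for a semidefinite form it amounts to orthogonality to
  everything, which is linear.\<close>

lemma dd_kernel_subspace: "subspace {B\<in>D. dd B B = 0}"
    unfolding subspace_def
  proof (intro conjI ballI allI)
    show "0 \<in> {B\<in>D. dd B B = 0}"
      using lin_on_zero[OF bilinD1[OF Dd.bilin] sub(3), of 0] subspace_0[OF sub(3)] by (simp)
    show "x + y \<in> {B\<in>D. dd B B = 0}" if "x \<in> {B\<in>D. dd B B = 0}" "y \<in> {B\<in>D. dd B B = 0}" for x y
      using that subspace_add[OF sub(3)] Dd.null[of x y] Dd.null[of y x]
      by (simp add: Dd.add_l Dd.add_r)
    show "c *\<^sub>R x \<in> {B\<in>D. dd B B = 0}" if "x \<in> {B\<in>D. dd B B = 0}" for c x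
      using that subspace_scale[OF sub(3)] by (simp add: Dd.scale_l Dd.scale_r)
  qed

text \<open>Duality stands in for a bounded right inverse of the curl: potentials \<open>F c\<close>
  are chosen only for the finitely many members \<open>c\<close> of a reproducing family of
  divergence-free fields. Ampere's law turns \<open>ip B c\<close> into \<open>ip j (F c)\<close>,
  and expanding \<open>ip B B\<close> over the family leaves one factor of the length of
  \<open>B\<close> to cancel.\<close>

lemma magnetic_bound:
  obtains K where "K \<ge> 0" "\<And>B j. B \<in> D \<Longrightarrow> j \<in> W \<Longrightarrow> dd B B = 0 \<Longrightarrow>
    (\<And>F. F \<in> W \<Longrightarrow> ip j F = ip B (rot F)) \<Longrightarrow> D.nrm B \<le> K * W.nrm j"
proof -
  define Z where "Z = {B\<in>D. dd B B = 0}"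
  have ZD: "Z \<subseteq> D" by (auto simp: Z_def)
  have Zs: "subspace Z" unfolding Z_def by (rule dd_kernel_subspace)
  interpret Z: fin_semi_inner_space Z ip
    using Zs fin_dim_subset[OF fin(3) Zs ZD] semi_inner_subset[OF D.semi_inner ZD] by unfold_locales
  obtain e where e: "finite e" "e \<subseteq> Z" "\<And>x y. x \<in> Z \<Longrightarrow> y \<in> Z \<Longrightarrow> ip (x - (\<Sum>c\<in>e. ip x c *\<^sub>R c)) y = 0"
    by (rule Z.reproducing_family) blast
  have "\<forall>B\<in>Z. \<exists>F\<in>W. \<forall>C\<in>L. ip C B = ip C (rot F)" using rot_onto by (auto simp: Z_def)
  then obtain F where F: "\<And>B. B \<in> Z \<Longrightarrow> F B \<in> W" "\<And>B C. B \<in> Z \<Longrightarrow> C \<in> L \<Longrightarrow> ip C B = ip C (rot (F B))"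
    by metis
  define K where "K = (\<Sum>c\<in>e. W.nrm (F c) * W.nrm c)"
  have eD: "c \<in> Z" "c \<in> D" if "c \<in> e" for c using that e(2) ZD by auto
  have nn: "0 \<le> W.nrm (F c)" "0 \<le> W.nrm c" if "c \<in> e" for c
    using eD[OF that] F(1) D.nrm_nonneg W.nrm_nonneg by auto
  show thesis
  proof
    show "K \<ge> 0" unfolding K_def using nn by (auto intro: sum_nonneg)
    fix B j assume B: "B \<in> D" and j: "j \<in> W" and d: "dd B B = 0"
      and eq: "\<And>F. F \<in> W \<Longrightarrow> ip j F = ip B (rot F)"
    have BZ: "B \<in> Z" using B d by (simp add: Z_def)
    have "ip B B = (\<Sum>c\<in>e. ip B c * ip c B)"
    proof (rule Z.lin_on_expand[OF e(1,2), where l="\<lambda>x. ip x B"])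
      show "ip (x - (\<Sum>c\<in>e. ip x c *\<^sub>R c)) y = 0" if "x \<in> Z" "y \<in> Z" for x y
        using e(3) that .
    qed (use Z.null bilinD2[OF Z.bilin] BZ in auto)
    also have "\<dots> \<le> (\<Sum>c\<in>e. (W.nrm j * W.nrm (F c)) * (W.nrm c * W.nrm B))"
    proof (rule sum_mono)
      fix c assume c: "c \<in> e"
      have "ip B c = ip j (F c)" using F(2)[OF eD(1)[OF c] DL[OF B]] eq[OF F(1)[OF eD(1)[OF c]]] by simp
      then have "\<bar>ip B c\<bar> \<le> W.nrm j * W.nrm (F c)"
        using W.cauchy_schwarz[OF j F(1)[OF eD(1)[OF c]]] by simp
      moreover have "\<bar>ip c B\<bar> \<le> W.nrm c * W.nrm B" using D.cauchy_schwarz[OF eD(2)[OF c] B] .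
      ultimately have "\<bar>ip B c\<bar> * \<bar>ip c B\<bar> \<le> (W.nrm j * W.nrm (F c)) * (W.nrm c * W.nrm B)"
        using nn[OF c] W.nrm_nonneg[OF j] by (intro mult_mono) auto
      then show "ip B c * ip c B \<le> (W.nrm j * W.nrm (F c)) * (W.nrm c * W.nrm B)"
        by (simp add: abs_mult[symmetric])
    qed
    also have "\<dots> = W.nrm B * (K * W.nrm j)"
      by (simp add: K_def sum_distrib_left sum_distrib_right algebra_simps)
    finally have "D.nrm B * D.nrm B \<le> D.nrm B * (K * W.nrm j)"
      using D.nrm_sq[OF B] by (simp add: power2_eq_square)
    moreover have "0 \<le> K * W.nrm j" using \<open>K \<ge> 0\<close> W.nrm_nonneg[OF j] by simp
    ultimately show "D.nrm B \<le> K * W.nrm j" using D.nrm_nonneg[OF B]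
      by (cases "D.nrm B = 0") auto
  qed
qed

text \<open>For \<open>re\<close> and \<open>rm\<close> at most 1 the coefficients in the energy
  identity are at least 1 and \<open>S\<close>, so neither the parameters nor the previous iterate
  enter the bounds.\<close>

lemma step_bound:
  obtains M J where "M \<ge> 0" "J \<ge> 0"
    "\<And>re rm u0 B0 u p E B j. 0 < re \<Longrightarrow> re \<le> 1 \<Longrightarrow> 0 < rm \<Longrightarrow> rm \<le> 1 \<Longrightarrow>
       step re rm u0 B0 u p E B j \<Longrightarrow> div_free u0 \<Longrightarrow> B0 \<in> D \<Longrightarrow> V.nrm u \<le> M \<and> W.nrm j \<le> J"
proof -
  obtain M where M: "M \<ge> 0" "\<And>v. v \<in> V \<Longrightarrow> \<bar>f v\<bar> \<le> M * V.nrm v"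
    using V.lin_on_bound[OF f f_null] by blast
  show thesis
  \<comment> \<open>\<open>M\<close> bounds the load in the dual sense, and the energy identity
    gives S |j|^2 <= M |u| <= M^2.\<close>
  proof (rule that[of M "sqrt (M\<^sup>2 / S)"])
    fix re rm u0 B0 u p E B j
    assume re: "0 < re" "re \<le> 1" and rm: "0 < rm" "rm \<le> 1"
      and st: "step re rm u0 B0 u p E B j" and u0: "div_free u0" and B0: "B0 \<in> D"
    note d = stepD[OF st]
    define a where "a = V.nrm u"
    define c where "c = W.nrm j"
    have a0: "a \<ge> 0" using d by (simp add: a_def)
    have "inverse re * a\<^sup>2 + S * inverse rm * c\<^sup>2 = f u"
      using step_energy[OF st u0 B0] d by (simp add: a_def c_def V.nrm_sq W.nrm_sq)
    also have "f u \<le> M * a" using M(2)[OF d(1)] by (simp add: a_def)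
    finally have e: "inverse re * a\<^sup>2 + S * inverse rm * c\<^sup>2 \<le> M * a" .
    have 1: "1 * a\<^sup>2 \<le> inverse re * a\<^sup>2"
      using re by (intro mult_right_mono) (auto simp: one_le_inverse)
    have "S * 1 * c\<^sup>2 \<le> S * inverse rm * c\<^sup>2"
      using rm S by (intro mult_right_mono mult_left_mono) (auto simp: one_le_inverse)
    then have 2: "S * c\<^sup>2 \<le> S * inverse rm * c\<^sup>2" by simp
    have "S * c\<^sup>2 \<ge> 0" using S by simp
    then have "a * a \<le> M * a" using e 1 2 by (simp add: power2_eq_square)
    then have aM: "a \<le> M" using a0 M(1) by (cases "a = 0") auto
    have "S * c\<^sup>2 \<le> M * a" using e 1 2 by (smt (verit) zero_le_power2)
    also have "\<dots> \<le> M * M" using aM M by (intro mult_left_mono)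
    finally have "c\<^sup>2 \<le> M\<^sup>2 / S" using S by (simp add: field_simps power2_eq_square)
    then show "V.nrm u \<le> M \<and> W.nrm j \<le> sqrt (M\<^sup>2 / S)"
      using aM by (simp add: a_def c_def real_le_rsqrt)
  qed (use M S in auto)
qed

text \<open>Three steps are involved because both fields in \<open>B2 - B1\<close> must come from a
  step: only then is the increment divergence free and bounded by \<open>j2 - j1\<close>.
  \<open>step_difference\<close> is applied to the last two steps, with \<open>step_bound\<close>
  controlling \<open>u2\<close> and \<open>j2\<close>.\<close>

lemma step_contraction:
  obtains \<epsilon> where "0 < \<epsilon>" "\<epsilon> \<le> 1"
    "\<And>re rm u0 B0 u1 p1 E1 B1 j1 u2 p2 E2 B2 j2 u3 p3 E3 B3 j3.
       0 < re \<Longrightarrow> re < \<epsilon> \<Longrightarrow> 0 < rm \<Longrightarrow> rm < \<epsilon> \<Longrightarrow> div_free u0 \<Longrightarrow> B0 \<in> D \<Longrightarrow>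
       step re rm u0 B0 u1 p1 E1 B1 j1 \<Longrightarrow> step re rm u1 B1 u2 p2 E2 B2 j2 \<Longrightarrow>
       step re rm u2 B2 u3 p3 E3 B3 j3 \<Longrightarrow>
       V.nrm (u3 - u2) + W.nrm (j3 - j2) \<le> (V.nrm (u2 - u1) + W.nrm (j2 - j1)) / 2"
proof -
  obtain M J where MJ: "M \<ge> 0" "J \<ge> 0" and bound:
    "\<And>re rm u0 B0 u p E B j. 0 < re \<Longrightarrow> re \<le> 1 \<Longrightarrow> 0 < rm \<Longrightarrow> rm \<le> 1 \<Longrightarrow>
       step re rm u0 B0 u p E B j \<Longrightarrow> div_free u0 \<Longrightarrow> B0 \<in> D \<Longrightarrow> V.nrm u \<le> M \<and> W.nrm j \<le> J"
    by (rule step_bound) blast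
  obtain K1 where K1: "K1 \<ge> 0" "\<And>x y z. x \<in> V \<Longrightarrow> y \<in> V \<Longrightarrow> z \<in> V \<Longrightarrow>
      \<bar>conv x y z\<bar> \<le> K1 * V.nrm x * V.nrm y * V.nrm z"
    by (rule trilin_bound[OF V_fin V_fin
          V_fin conv]) (use conv_null in blast)+
  obtain K2 where K2: "K2 \<ge> 0" "\<And>x y z. x \<in> W \<Longrightarrow> y \<in> D \<Longrightarrow> z \<in> V \<Longrightarrow>
      \<bar>cr x y z\<bar> \<le> K2 * W.nrm x * D.nrm y * V.nrm z"
  proof (rule trilin_bound[OF W_fin D_fin
          V_fin trilin_subset[OF cr L(3,4,2)]])
    show "cr x y z = 0" if "x \<in> W" "y \<in> D" "z \<in> V" "ip x x = 0 \<or> ip y y = 0 \<or> gi z z = 0" for x y z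
      using cr_null_any[OF WL[OF that(1)] DL[OF that(2)] VL[OF that(3)]] that poincare by auto
  qed blast
  obtain K3 where K3: "K3 \<ge> 0" "\<And>x y z. x \<in> V \<Longrightarrow> y \<in> D \<Longrightarrow> z \<in> W \<Longrightarrow>
      \<bar>cr x y z\<bar> \<le> K3 * V.nrm x * D.nrm y * W.nrm z"
  proof (rule trilin_bound[OF V_fin D_fin
          W_fin trilin_subset[OF cr L(2,4,3)]])
    show "cr x y z = 0" if "x \<in> V" "y \<in> D" "z \<in> W" "gi x x = 0 \<or> ip y y = 0 \<or> ip z z = 0" for x y z
      using cr_null_any[OF VL[OF that(1)] DL[OF that(2)] WL[OF that(3)]] that poincare by auto
  qed blast
  obtain K4 where K4: "K4 \<ge> 0" "\<And>x y z. x \<in> W \<Longrightarrow> y \<in> D \<Longrightarrow> z \<in> W \<Longrightarrow>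
      \<bar>cr x y z\<bar> \<le> K4 * W.nrm x * D.nrm y * W.nrm z"
  proof (rule trilin_bound[OF W_fin D_fin
          W_fin trilin_subset[OF cr L(3,4,3)]])
    show "cr x y z = 0" if "x \<in> W" "y \<in> D" "z \<in> W" "ip x x = 0 \<or> ip y y = 0 \<or> ip z z = 0" for x y z
      using cr_null_any[OF WL[OF that(1)] DL[OF that(2)] WL[OF that(3)]] that poincare by auto
  qed blast
  obtain KB where KB: "KB \<ge> 0" "\<And>B j. B \<in> D \<Longrightarrow> j \<in> W \<Longrightarrow> dd B B = 0 \<Longrightarrow>
      (\<And>F. F \<in> W \<Longrightarrow> ip j F = ip B (rot F)) \<Longrightarrow> D.nrm B \<le> KB * W.nrm j"
    by (rule magnetic_bound) blast
  \<comment> \<open>One summand per term on the right of \<open>step_difference\<close>;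
    \<open>KB\<close> appears wherever the magnetic increment is traded for a current
    increment.\<close>
  define C where "C = K1 * M + S * K2 * J * KB + S * K3 * M * KB + S * RH * K4 * J * KB"
  have C0: "C \<ge> 0" using K1 K2 K3 K4 KB MJ S RH by (simp add: C_def)
  define m where "m = min 1 S"
  have m: "0 < m" "m \<le> 1" "m \<le> S" using S by (auto simp: m_def)
  \<comment> \<open>Below \<epsilon> the coefficients \<open>inverse re\<close> and
    \<open>S * inverse rm\<close> are both at least \<open>m / \<epsilon>\<close>. Of the 4, one
    factor 2 pays for \<open>(x + y)\<^sup>2\<close>, the other yields the contraction factor 1/2;
    adding 1 to \<open>C\<close> keeps the denominator positive.\<close>
  define \<epsilon> where "\<epsilon> = m / (4 * (C + 1))"
  have eps: "0 < \<epsilon>" "\<epsilon> \<le> 1" using C0 m by (auto simp: \<epsilon>_def field_simps)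
  have epsC: "4 * (\<epsilon> * C) \<le> m"
  proof -
    have "4 * (\<epsilon> * C) \<le> 4 * (\<epsilon> * (C + 1))" using eps by simp
    also have "\<dots> = m" using C0 by (simp add: \<epsilon>_def field_simps)
    finally show ?thesis .
  qed
  show thesis
  proof (rule that[OF eps])
    fix re rm u0 B0 u1 p1 E1 B1 j1 u2 p2 E2 B2 j2 u3 p3 E3 B3 j3
    assume re: "0 < re" "re < \<epsilon>" and rm: "0 < rm" "rm < \<epsilon>" and u0: "div_free u0" and B0: "B0 \<in> D"
      and s1: "step re rm u0 B0 u1 p1 E1 B1 j1" and s2: "step re rm u1 B1 u2 p2 E2 B2 j2"
      and s3: "step re rm u2 B2 u3 p3 E3 B3 j3"
    note d1 = stepD[OF s1] and d2 = stepD[OF s2] and d3 = stepD[OF s3]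
    define x where "x = V.nrm (u3 - u2)"
    define y where "y = W.nrm (j3 - j2)"
    define s where "s = V.nrm (u2 - u1)"
    define t where "t = W.nrm (j2 - j1)"
    have mem: "u3 - u2 \<in> V" "j3 - j2 \<in> W" "u2 - u1 \<in> V" "j2 - j1 \<in> W" "B2 - B1 \<in> D"
      using d1 d2 d3 sub by (auto intro: subspace_diff)
    have nn: "x \<ge> 0" "y \<ge> 0" "s \<ge> 0" "t \<ge> 0" using mem by (auto simp: x_def y_def s_def t_def)
    have b2: "V.nrm u2 \<le> M" "W.nrm j2 \<le> J"
      using bound[OF _ _ _ _ s2 d1(11) d1(4)] re rm eps by auto
    \<comment> \<open>\<open>magnetic_bound\<close> applies to the increment, since Ampere's law and
      vanishing divergence are linear conditions.\<close>
    have dB: "D.nrm (B2 - B1) \<le> KB * t"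
      unfolding t_def
    proof (rule KB(2)[OF mem(5,4)])
      have "dd B2 B1 = 0" "dd B1 B2 = 0" using Dd.null d1(4,9) d2(4,9) by auto
      then show "dd (B2 - B1) (B2 - B1) = 0"
        using d1 d2 mem by (simp add: Dd.diff_l Dd.diff_r)
      show "ip (j2 - j1) F = ip (B2 - B1) (rot F)" if "F \<in> W" for F
        using d1 d2 that rot_L[OF that] DL WL by (simp add: Lp.diff_l)
    qed
    note nnB = D.nrm_nonneg[OF mem(5)] and nnu = V.nrm_nonneg[OF d2(1)] and nnj = W.nrm_nonneg[OF d2(5)]
    have t1: "\<bar>conv (u2 - u1) u2 (u3 - u2)\<bar> \<le> K1 * s * M * x"
      by (rule order_trans[OF K1(2)[OF mem(3) d2(1) mem(1)]])
        (use K1(1) nn nnu b2 MJ in \<open>auto simp: s_def x_def intro!: mult_mono\<close>)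
    have t2: "\<bar>cr j2 (B2 - B1) (u3 - u2)\<bar> \<le> K2 * J * (KB * t) * x"
      by (rule order_trans[OF K2(2)[OF d2(5) mem(5,1)]])
        (use K2(1) nn nnB nnj b2 MJ dB KB(1) in \<open>auto simp: x_def intro!: mult_mono\<close>)
    have t3: "\<bar>cr u2 (B2 - B1) (j3 - j2)\<bar> \<le> K3 * M * (KB * t) * y"
      by (rule order_trans[OF K3(2)[OF d2(1) mem(5,2)]])
        (use K3(1) nn nnB nnu b2 MJ dB KB(1) in \<open>auto simp: y_def intro!: mult_mono\<close>)
    have t4: "\<bar>cr j2 (B2 - B1) (j3 - j2)\<bar> \<le> K4 * J * (KB * t) * y"
      by (rule order_trans[OF K4(2)[OF d2(5) mem(5,2)]])
        (use K4(1) nn nnB nnj b2 MJ dB KB(1) in \<open>auto simp: y_def intro!: mult_mono\<close>)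
    have e: "inverse re * x\<^sup>2 + S * inverse rm * y\<^sup>2 =
      - conv (u2 - u1) u2 (u3 - u2) + S * cr j2 (B2 - B1) (u3 - u2) + S * cr u2 (B2 - B1) (j3 - j2)
      - S * RH * cr j2 (B2 - B1) (j3 - j2)"
      using step_difference[OF s2 s3 d1(1,4)] mem by (simp add: x_def y_def V.nrm_sq W.nrm_sq)
    have a1: "- conv (u2 - u1) u2 (u3 - u2) \<le> K1 * s * M * x" using t1 by simp
    have a2: "S * cr j2 (B2 - B1) (u3 - u2) \<le> S * (K2 * J * (KB * t) * x)"
      using t2 S by (intro mult_left_mono) auto
    have a3: "S * cr u2 (B2 - B1) (j3 - j2) \<le> S * (K3 * M * (KB * t) * y)"
      using t3 S by (intro mult_left_mono) auto
    have a4: "S * RH * (- cr j2 (B2 - B1) (j3 - j2)) \<le> S * RH * (K4 * J * (KB * t) * y)"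
      using t4 S RH by (intro mult_left_mono) auto
    \<comment> \<open>Crude but uniform: every product of an old and a new increment is at most
      \<open>(s + t) * (x + y)\<close>.\<close>
    have w: "c * v * r \<le> c * (s + t) * (x + y)" if "c \<ge> 0" "0 \<le> v" "v \<le> s + t" "0 \<le> r" "r \<le> x + y" for c v r
      using that by (intro mult_mono) auto
    have "inverse re * x\<^sup>2 + S * inverse rm * y\<^sup>2 \<le>
        (K1 * M) * s * x + (S * K2 * J * KB) * t * x + (S * K3 * M * KB) * t * y + (S * RH * K4 * J * KB) * t * y"
      using e a1 a2 a3 a4 by (simp add: algebra_simps)
    also have "\<dots> \<le> (K1 * M) * (s + t) * (x + y) + (S * K2 * J * KB) * (s + t) * (x + y)
        + (S * K3 * M * KB) * (s + t) * (x + y) + (S * RH * K4 * J * KB) * (s + t) * (x + y)"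
      using K1 K2 K3 K4 KB MJ S RH nn by (intro add_mono w) auto
    also have "\<dots> = C * (s + t) * (x + y)" by (simp add: C_def algebra_simps)
    finally have up: "inverse re * x\<^sup>2 + S * inverse rm * y\<^sup>2 \<le> C * (s + t) * (x + y)" .
    have "1 \<le> \<epsilon> * inverse re" using re by (simp add: field_simps)
    with m have ire: "m \<le> \<epsilon> * inverse re" by simp
    have irm: "1 \<le> \<epsilon> * inverse rm" using rm by (simp add: field_simps)
    have "m * x\<^sup>2 \<le> \<epsilon> * inverse re * x\<^sup>2" using ire by (intro mult_right_mono) auto
    moreover have "m * y\<^sup>2 \<le> S * (\<epsilon> * inverse rm) * y\<^sup>2"
    proof (intro mult_right_mono)
      have "S * 1 \<le> S * (\<epsilon> * inverse rm)" using irm S by (intro mult_left_mono) auto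
      then show "m \<le> S * (\<epsilon> * inverse rm)" using m by linarith
    qed auto
    ultimately have "m * (x\<^sup>2 + y\<^sup>2) \<le> \<epsilon> * (inverse re * x\<^sup>2 + S * inverse rm * y\<^sup>2)"
      by (simp add: algebra_simps)
    also have "\<dots> \<le> \<epsilon> * (C * (s + t) * (x + y))" using up eps by (intro mult_left_mono) auto
    finally have lo: "m * (x\<^sup>2 + y\<^sup>2) \<le> \<epsilon> * C * (s + t) * (x + y)" by (simp add: mult.assoc)
    have "(x + y)\<^sup>2 \<le> 2 * (x\<^sup>2 + y\<^sup>2)" using sum_squares_bound[of x y] by (simp add: power2_sum)
    then have "m * (x + y)\<^sup>2 \<le> m * (2 * (x\<^sup>2 + y\<^sup>2))" using m by (intro mult_left_mono) auto
    also have "\<dots> = 2 * (m * (x\<^sup>2 + y\<^sup>2))" by (simp only: mult.left_commute)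
    also have "\<dots> \<le> 2 * (\<epsilon> * C * (s + t) * (x + y))" using lo by simp
    finally have "2 * (m * (x + y)\<^sup>2) \<le> 4 * (\<epsilon> * C) * ((s + t) * (x + y))" by (simp add: algebra_simps)
    also have "\<dots> \<le> m * ((s + t) * (x + y))" using epsC nn by (intro mult_right_mono) auto
    finally have "m * (2 * (x + y) * (x + y)) \<le> m * ((s + t) * (x + y))"
      by (simp add: power2_eq_square algebra_simps)
    then have "2 * (x + y) * (x + y) \<le> (s + t) * (x + y)" using m by simp
    then have "2 * (x + y) \<le> s + t" using nn by (cases "x + y = 0") auto
    then show "V.nrm (u3 - u2) + W.nrm (j3 - j2) \<le> (V.nrm (u2 - u1) + W.nrm (j2 - j1)) / 2"
      by (simp add: x_def y_def s_def t_def)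
  qed
qed

section \<open>Convergence of the abstract iterates\<close>

theorem picard_converges:
  "\<exists>\<epsilon>>0. \<forall>re rm. 0 < re \<and> re < \<epsilon> \<and> 0 < rm \<and> rm < \<epsilon> \<longrightarrow>
    (\<forall>u p E B j. div_free (u 0) \<and> B 0 \<in> D \<and>
       (\<forall>n. step re rm (u n) (B n) (u (Suc n)) (p (Suc n)) (E (Suc n)) (B (Suc n)) (j (Suc n))) \<longrightarrow>
       has_limits u p E B j)"
proof -
  obtain \<epsilon> where eps: "0 < \<epsilon>" "\<epsilon> \<le> 1" and contr:
    "\<And>re rm u0 B0 u1 p1 E1 B1 j1 u2 p2 E2 B2 j2 u3 p3 E3 B3 j3.
       0 < re \<Longrightarrow> re < \<epsilon> \<Longrightarrow> 0 < rm \<Longrightarrow> rm < \<epsilon> \<Longrightarrow> div_free u0 \<Longrightarrow> B0 \<in> D \<Longrightarrow>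
       step re rm u0 B0 u1 p1 E1 B1 j1 \<Longrightarrow> step re rm u1 B1 u2 p2 E2 B2 j2 \<Longrightarrow>
       step re rm u2 B2 u3 p3 E3 B3 j3 \<Longrightarrow>
       V.nrm (u3 - u2) + W.nrm (j3 - j2) \<le> (V.nrm (u2 - u1) + W.nrm (j2 - j1)) / 2"
    by (rule step_contraction) blast
  define Z where "Z = {B\<in>D. dd B B = 0}"
  have ZD: "Z \<subseteq> D" by (auto simp: Z_def)
  have Zs: "subspace Z" unfolding Z_def by (rule dd_kernel_subspace)
  interpret Z: fin_semi_inner_space Z ip
    using Zs fin_dim_subset[OF fin(3) Zs ZD] semi_inner_subset[OF D.semi_inner ZD] by unfold_locales
  show ?thesis
  proof (intro exI[of _ \<epsilon>] conjI eps(1) allI impI, elim conjE)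
    fix re rm u p E B j
    assume re: "0 < re" "re < \<epsilon>" and rm: "0 < rm" "rm < \<epsilon>" and u0: "div_free (u 0)" and B0: "B 0 \<in> D"
      and st: "\<forall>n. step re rm (u n) (B n) (u (Suc n)) (p (Suc n)) (E (Suc n)) (B (Suc n)) (j (Suc n))"
    note d = stepD[OF st[rule_format]]
    have BD: "B n \<in> D" and df: "div_free (u n)" for n using B0 u0 d by (cases n; simp)+
    \<comment> \<open>The increments start between iterates 1 and 2, since \<open>j 0\<close> is
      arbitrary and \<open>B 0\<close> comes from no step.\<close>
    define s where "s n = V.nrm (u (Suc (Suc n)) - u (Suc n)) + W.nrm (j (Suc (Suc n)) - j (Suc n))" for n
    have ss: "s (Suc n) \<le> s n / 2" for n
      unfolding s_def using contr[OF re rm df BD st[rule_format] st[rule_format] st[rule_format]] .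
    have s: "s n \<le> s 0 * (1/2) ^ n" for n
      by (induction n) (use ss in \<open>auto intro: order_trans\<close>)
    have du: "u (Suc (Suc n)) - u (Suc n) \<in> V" and dj: "j (Suc (Suc n)) - j (Suc n) \<in> W" for n
      using d sub by (auto intro: subspace_diff)
    have su: "V.nrm (u (Suc (Suc n)) - u (Suc n)) \<le> s 0 * (1/2) ^ n"
      and sj: "W.nrm (j (Suc (Suc n)) - j (Suc n)) \<le> s 0 * (1/2) ^ n" for n
      using s[of n] V.nrm_nonneg[OF du[of n]] W.nrm_nonneg[OF dj[of n]] by (auto simp: s_def)
    obtain u' where u': "u' \<in> V" "(\<lambda>n. V.nrm (u (Suc n) - u')) \<longlonglongrightarrow> 0"
    proof (rule V.weak_imp_strong)
      show "convergent (\<lambda>n. gi (u (Suc n)) e)" if "e \<in> V" for e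
      proof (rule convergent_geometric)
        show "\<bar>gi (u (Suc (Suc n))) e - gi (u (Suc n)) e\<bar> \<le> (s 0 * V.nrm e) * (1/2) ^ n" for n
          using V.cauchy_schwarz[OF du that, of n] mult_right_mono[OF su V.nrm_nonneg[OF that], of n] d(1) that
          by (simp add: V.diff_l mult.commute mult.left_commute)
      qed
    qed (use d in auto)
    obtain j' where j': "j' \<in> W" "(\<lambda>n. W.nrm (j (Suc n) - j')) \<longlonglongrightarrow> 0"
    proof (rule W.weak_imp_strong)
      show "convergent (\<lambda>n. ip (j (Suc n)) e)" if "e \<in> W" for e
      proof (rule convergent_geometric)
        show "\<bar>ip (j (Suc (Suc n))) e - ip (j (Suc n)) e\<bar> \<le> (s 0 * W.nrm e) * (1/2) ^ n" for n
          using W.cauchy_schwarz[OF dj that, of n] mult_right_mono[OF sj W.nrm_nonneg[OF that], of n] d(5) that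
          by (simp add: W.diff_l mult.commute mult.left_commute)
      qed
    qed (use d in auto)
    have conv_lim: "convergent (\<lambda>n. l (x n))"
      if "fin_semi_inner_space X g" "lin_on X l" "\<And>x. x \<in> X \<Longrightarrow> g x x = 0 \<Longrightarrow> l x = 0"
        "\<And>n. x n \<in> X" "x' \<in> X" "(\<lambda>n. semi_inner_space.nrm g (x n - x')) \<longlonglongrightarrow> 0"
      for X :: "'a set" and g l x x'
      using lin_tendsto[OF that] by (auto simp: convergent_def)
    have conv2_lim: "convergent (\<lambda>n. t (x n) (y n))"
      if X: "fin_semi_inner_space X g" and Y: "fin_semi_inner_space Y h" and t: "bilin X Y t"
        and "\<And>x y. x \<in> X \<Longrightarrow> y \<in> Y \<Longrightarrow> g x x = 0 \<or> h y y = 0 \<Longrightarrow> t x y = 0"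
        "\<And>n. x n \<in> X" "x' \<in> X" "(\<lambda>n. semi_inner_space.nrm g (x n - x')) \<longlonglongrightarrow> 0"
        "\<And>n. y n \<in> Y" "y' \<in> Y" "(\<lambda>n. semi_inner_space.nrm h (y n - y')) \<longlonglongrightarrow> 0"
      for X Y :: "'a set" and g h t x x' y y'
      using bilin_tendsto[OF that] by (auto simp: convergent_def)
    have BZ: "B (Suc n) \<in> Z" for n using d by (simp add: Z_def)
    obtain B' where B': "B' \<in> Z" "(\<lambda>n. Z.nrm (B (Suc n) - B')) \<longlonglongrightarrow> 0"
    proof (rule Z.weak_imp_strong[OF BZ])
      \<comment> \<open>With a potential \<open>F\<close> of the divergence-free \<open>C\<close>,
        Ampere's law makes the pairing of \<open>B\<close> with \<open>C\<close> a pairing of the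
        convergent currents with \<open>F\<close>.\<close>
      fix C assume C: "C \<in> Z"
      then obtain F where F: "F \<in> W" "\<And>x. x \<in> L \<Longrightarrow> ip x C = ip x (rot F)"
        using rot_onto[of C] by (auto simp: Z_def)
      have "convergent (\<lambda>n. ip (j (Suc n)) F)"
        by (rule conv_lim[OF W_fin bilinD2[OF W.bilin F(1)] W.null[OF _ F(1)] d(5) j'])
      then show "convergent (\<lambda>n. ip (B (Suc n)) C)" using F d DL by simp
    qed blast
    have B'D: "B' \<in> D" using B' ZD by auto
    \<comment> \<open>The unshifted form is needed as well: step n + 1 contains the lagged field
      \<open>B n\<close>.\<close>
    have Bn: "(\<lambda>n. D.nrm (B n - B')) \<longlonglongrightarrow> 0" using B'(2) by (rule LIMSEQ_imp_Suc)
    have cr_lim: "convergent (\<lambda>n. cr (x n) (B n) k)"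
      if X: "fin_semi_inner_space X g" "X \<subseteq> L" "\<And>x. x \<in> X \<Longrightarrow> g x x = 0 \<Longrightarrow> ip x x = 0"
        and x: "\<And>n. x n \<in> X" "x' \<in> X" "(\<lambda>n. semi_inner_space.nrm g (x n - x')) \<longlonglongrightarrow> 0" and k: "k \<in> L"
      for X g x x' k
    proof (rule conv2_lim[OF X(1) D_fin _ _ x BD B'D Bn])
      show "bilin X D (\<lambda>x y. cr x y k)"
        using cr k X(2) L unfolding trilin_def bilin_def lin_on_def by (meson subsetD)
      show "cr x y k = 0" if "x \<in> X" "y \<in> D" "g x x = 0 \<or> ip y y = 0" for x y
        using that cr_null_any[OF subsetD[OF X(2)] DL k] X(3) by blast
    qed
    have un: "(\<lambda>n. V.nrm (u n - u')) \<longlonglongrightarrow> 0" using u'(2) by (rule LIMSEQ_imp_Suc)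
    have jn: "(\<lambda>n. W.nrm (j n - j')) \<longlonglongrightarrow> 0" using j'(2) by (rule LIMSEQ_imp_Suc)
    have uV: "u n \<in> V" for n using df by (simp add: div_free_def)
    obtain E' where E': "E' \<in> W" "(\<lambda>n. W.nrm (E (Suc n) - E')) \<longlonglongrightarrow> 0"
    proof (rule W.weak_imp_strong)
      fix k assume k: "k \<in> W"
      have 1: "convergent (\<lambda>n. ip (j (Suc n)) k)"
        by (rule conv_lim[OF W_fin bilinD2[OF W.bilin k] W.null[OF _ k] d(5) j'])
      have 2: "convergent (\<lambda>n. cr (u (Suc n)) (B n) k)"
        by (rule cr_lim[OF V_fin L(2) poincare d(1) u' WL[OF k]])
      have 3: "convergent (\<lambda>n. cr (j (Suc n)) (B n) k)"
        by (rule cr_lim[OF W_fin L(3) _ d(5) j' WL[OF k]])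
      have "ip (E (Suc n)) k = inverse rm * ip (j (Suc n)) k - cr (u (Suc n)) (B n) k + RH * cr (j (Suc n)) (B n) k" for n
        using d(10)[OF k] by simp
      moreover have "convergent (\<lambda>n. inverse rm * ip (j (Suc n)) k - cr (u (Suc n)) (B n) k + RH * cr (j (Suc n)) (B n) k)"
        using 1 2 3 by (intro convergent_add convergent_diff convergent_mult convergent_const)
      ultimately show "convergent (\<lambda>n. ip (E (Suc n)) k)" by simp
    qed (use d in auto)
    obtain p' where p': "p' \<in> Q" "(\<lambda>n. Q.nrm (p (Suc n) - p')) \<longlonglongrightarrow> 0"
    proof (rule Q.weak_imp_strong)
      fix q assume q: "q \<in> Q"
      \<comment> \<open>Inf-sup stability as solvability: some velocity \<open>v\<close> represents
        the pairing with \<open>q\<close> through \<open>b\<close>. Testing the momentum equation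
        with it expresses the pressure coefficient by convergent quantities.\<close>
      obtain v where v: "v \<in> V" "\<And>q'. q' \<in> Q \<Longrightarrow> b v q' = iq q q'"
      proof (rule bilin_solve[OF fin(1) sub(4) b bilinD1[OF Q.bilin q]])
        show "iq q y = 0" if "y \<in> Q" "\<And>x. x \<in> V \<Longrightarrow> b x y = 0" for y
          using inf_sup[OF that] Q.null[OF that(1) q] Q.sym[OF that(1) q] by simp
      qed blast
      have 1: "convergent (\<lambda>n. gi (u (Suc n)) v)"
        by (rule conv_lim[OF V_fin bilinD2[OF V.bilin v(1)] V.null[OF _ v(1)] d(1) u'])
      have 2: "convergent (\<lambda>n. conv (u n) (u (Suc n)) v)"
      proof (rule conv2_lim[OF V_fin V_fin _ _ uV u'(1) un d(1) u'])
        show "bilin V V (\<lambda>x y. conv x y v)"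
          using conv v(1) unfolding trilin_def bilin_def lin_on_def by meson
        show "conv x y v = 0" if "x \<in> V" "y \<in> V" "gi x x = 0 \<or> gi y y = 0" for x y
          using that conv_null v(1) by blast
      qed
      have 3: "convergent (\<lambda>n. cr (j (Suc n)) (B n) v)"
        by (rule cr_lim[OF W_fin L(3) _ d(5) j' VL[OF v(1)]])
      have "iq (p (Suc n)) q = inverse re * gi (u (Suc n)) v + conv (u n) (u (Suc n)) v - S * cr (j (Suc n)) (B n) v - f v" for n
        using d(6)[OF v(1), of n] v(2)[OF d(2), of n] Q.sym[OF d(2) q, of n] by simp
      moreover have "convergent (\<lambda>n. inverse re * gi (u (Suc n)) v + conv (u n) (u (Suc n)) v - S * cr (j (Suc n)) (B n) v - f v)"
        using 1 2 3 by (intro convergent_add convergent_diff convergent_mult convergent_const)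
      ultimately show "convergent (\<lambda>n. iq (p (Suc n)) q)" by simp
    qed (use d in auto)
    have En: "(\<lambda>n. W.nrm (E n - E')) \<longlonglongrightarrow> 0" using E'(2) by (rule LIMSEQ_imp_Suc)
    have pn: "(\<lambda>n. Q.nrm (p n - p')) \<longlonglongrightarrow> 0" using p'(2) by (rule LIMSEQ_imp_Suc)
    have "\<forall>n. dd (B (Suc n) - B') (B (Suc n) - B') = 0"
      using subspace_diff[OF Zs BZ B'(1)] by (simp add: Z_def)
    with u'(1) p'(1) E'(1) B'D j'(1) un pn En Bn jn
    show "has_limits u p E B j" unfolding has_limits_def by blast
  qed
qed

end

section \<open>Smooth functions\<close>

lemma partialI: "(f has_derivative f') (at x) \<Longrightarrow> partial i f x = f' (axis i 1)"
  by (simp add: partial_def frechet_derivative_at[symmetric])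

lemma Ck_SucD: "Ck (Suc k) f \<Longrightarrow> Ck k f"
proof (induction k arbitrary: f)
  case 0
  then show ?case
    by (auto intro!: differentiable_imp_continuous_on simp: differentiable_on_def)
next
  case (Suc k)
  then show ?case by (metis Ck.simps(2))
qed

lemma Ck_const: "Ck k (\<lambda>x. c)"
proof (induction k arbitrary: c)
  case (Suc k)
  have "partial i (\<lambda>x. c) = (\<lambda>x. 0)" for i
    by (rule ext, subst partialI[OF has_derivative_const]) simp
  then show ?case using Suc by simp
qed simp

lemma partial_add:
  assumes "f differentiable (at x)" "g differentiable (at x)"
  shows "partial i (\<lambda>x. f x + g x) x = partial i f x + partial i g x"
  using partialI[OF has_derivative_add[OF assms[unfolded frechet_derivative_works]], of i]
  by (simp add: partial_def)

lemma partial_mult: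
  assumes "f differentiable (at x)" "g differentiable (at x)"
  shows "partial i (\<lambda>x. f x * g x) x = f x * partial i g x + partial i f x * g x"
  using partialI[OF has_derivative_mult[OF assms[unfolded frechet_derivative_works]], of i]
  by (simp add: partial_def)

lemma Ck_add: "Ck k f \<Longrightarrow> Ck k g \<Longrightarrow> Ck k (\<lambda>x. f x + g x)"
proof (induction k arbitrary: f g)
  case (Suc k)
  then have "partial i (\<lambda>x. f x + g x) = (\<lambda>x. partial i f x + partial i g x)" for i
    by (intro ext partial_add) auto
  then show ?case using Suc by (auto intro: differentiable_add)
qed (auto intro: continuous_on_add)

lemma Ck_mult: "Ck k f \<Longrightarrow> Ck k g \<Longrightarrow> Ck k (\<lambda>x. f x * g x)"
proof (induction k arbitrary: f g)
  case (Suc k)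
  then have "partial i (\<lambda>x. f x * g x) = (\<lambda>x. f x * partial i g x + partial i f x * g x)" for i
    by (intro ext partial_mult) auto
  moreover have "Ck k f" "Ck k g" using Suc.prems by (auto dest: Ck_SucD simp del: Ck.simps)
  ultimately show ?case using Suc by (auto intro!: differentiable_mult Ck_add)
qed (auto intro: continuous_on_mult)

lemma Ck_prod: "finite I \<Longrightarrow> (\<And>i. i \<in> I \<Longrightarrow> Ck k (f i)) \<Longrightarrow> Ck k (\<lambda>x. \<Prod>i\<in>I. f i x)"
proof (induction I rule: finite_induct)
  case empty
  then show ?case using Ck_const[of k 1] by simp
qed (auto intro: Ck_mult)

lemma coord_derivative: "((\<lambda>x::real^3. x $ i) has_derivative (\<lambda>h. h $ i)) (at x)"
  by (rule bounded_linear_imp_has_derivative) (rule bounded_linear_vec_nth)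

lemma partial_coord: "partial j (\<lambda>x. x $ i) x = (if j = i then 1 else 0)"
  by (simp add: partialI[OF coord_derivative] axis_def)

lemma Ck_coord: "Ck k (\<lambda>x. x $ i)"
proof (cases k)
  case (Suc m)
  have "partial j (\<lambda>x. x $ i) = (\<lambda>x. if j = i then 1 else 0)" for j
    by (rule ext) (rule partial_coord)
  then show ?thesis using coord_derivative[of i] Ck_const[of m]
    by (auto simp: Suc differentiable_def)
qed (simp add: continuous_intros)

text \<open>These functions contain \<open>exp (- 1 / t)\<close> and are closed under differentiation.\<close>

definition flat :: "real poly \<Rightarrow> real \<Rightarrow> real" where
  "flat p t = (if 0 < t then poly p (1 / t) * exp (- (1 / t)) else 0)"

lemma poly_times_exp_tendsto_0: "((\<lambda>s::real. poly p s * exp (- s)) \<longlongrightarrow> 0) at_top"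
proof -
  have "((\<lambda>s::real. \<Sum>i\<le>degree p. coeff p i * (s ^ i / exp s)) \<longlongrightarrow> (\<Sum>i\<le>degree p. coeff p i * 0)) at_top"
    by (intro tendsto_intros tendsto_power_div_exp_0)
  then show ?thesis by (simp add: poly_altdef sum_distrib_right exp_minus divide_inverse mult.assoc)
qed

lemma flat_tendsto_0: "(flat p \<longlongrightarrow> 0) (at 0)"
proof -
  have "((\<lambda>t. poly p (inverse t) * exp (- inverse t)) \<longlongrightarrow> 0) (at_right 0)"
    by (rule filterlim_compose[OF poly_times_exp_tendsto_0 filterlim_inverse_at_top_right])
  then have "(flat p \<longlongrightarrow> 0) (at_right 0)"
    by (rule Lim_transform_eventually)
      (auto simp: eventually_at_filter flat_def inverse_eq_divide)
  moreover have "(flat p \<longlongrightarrow> 0) (at_left 0)"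
    by (rule Lim_transform_eventually[OF tendsto_const]) (auto simp: eventually_at_filter flat_def)
  ultimately show ?thesis by (simp add: filterlim_split_at)
qed

text \<open>By the product and chain rules the derivative at t > 0 is \<open>1 / t\<^sup>2\<close>
  times \<open>p - pderiv p\<close> at 1/t, times the exponential; multiplication by
  \<open>monom 1 2\<close> is that factor \<open>1 / t\<^sup>2\<close>.\<close>

lemma flat_has_derivative:
  "(flat p has_real_derivative flat (monom 1 2 * (p - pderiv p)) t) (at t)"
proof -
  consider "t > 0" | "t < 0" | "t = 0" by linarith
  then show ?thesis
  proof cases
    case 1
    have "((\<lambda>t. poly p (1 / t) * exp (- (1 / t))) has_real_derivative
        flat (monom 1 2 * (p - pderiv p)) t) (at t)"
      using 1 by (auto intro!: derivative_eq_intros DERIV_chain2[OF poly_DERIV]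
          simp: flat_def poly_monom field_simps power2_eq_square)
    then show ?thesis
      by (rule DERIV_cong_ev[THEN iffD1, rotated -1])
        (use 1 eventually_nhds_in_open[of "{0<..}" t] in \<open>auto simp: flat_def elim!: eventually_mono\<close>)
  next
    case 2
    have "((\<lambda>t. 0) has_real_derivative flat (monom 1 2 * (p - pderiv p)) t) (at t)"
      using 2 by (simp add: flat_def)
    then show ?thesis
      by (rule DERIV_cong_ev[THEN iffD1, rotated -1])
        (use 2 eventually_nhds_in_open[of "{..<0}" t] in \<open>auto simp: flat_def elim!: eventually_mono\<close>)
  next
    case 3
    \<comment> \<open>Dividing by h multiplies the polynomial in 1/h by its variable, hence
      \<open>pCons 0 p\<close>; at h = 0 both sides are 0 by the convention for division.\<close>
    have "(\<lambda>h. (flat p (0 + h) - flat p 0) / h) = flat (pCons 0 p)"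
      by (auto simp: flat_def fun_eq_iff field_simps)
    then show ?thesis using flat_tendsto_0[of "pCons 0 p"] by (simp add: 3 DERIV_def) (simp add: flat_def)
  qed
qed

lemma Ck_flat_coord: "Ck k (\<lambda>x. flat p (c * x $ i + d))"
proof (induction k arbitrary: p)
  case 0
  have "continuous_on UNIV (flat p)"
    using flat_has_derivative DERIV_continuous continuous_at_imp_continuous_on by blast
  then have "continuous_on UNIV (flat p \<circ> (\<lambda>x::real^3. c * x $ i + d))"
    by (intro continuous_on_compose continuous_intros) (auto intro: continuous_on_subset)
  then show ?case by (simp add: o_def)
next
  case (Suc k)
  let ?q = "monom 1 2 * (p - pderiv p)"
  have der: "((\<lambda>x::real^3. flat p (c * x $ i + d)) has_derivative
      (\<lambda>h. flat ?q (c * x $ i + d) * (c * h $ i))) (at x)" for x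
    using has_derivative_compose[of "\<lambda>x::real^3. c * x $ i + d" "\<lambda>h. c * h $ i" x UNIV "flat p"]
      flat_has_derivative[of p "c * x $ i + d"]
    by (simp add: has_field_derivative_def has_derivative_mult_right coord_derivative
        has_derivative_add_const)
  have "partial j (\<lambda>x. flat p (c * x $ i + d)) =
      (\<lambda>x. (if j = i then c else 0) * flat ?q (c * x $ i + d))" for j
    by (rule ext, subst partialI[OF der]) (simp add: axis_def)
  then show ?case using der Suc
    by (auto intro!: Ck_mult Ck_const simp: differentiable_def simp del: if_split)
qed

section \<open>Test functions and bumps\<close>

lemma smooth_const: "(\<lambda>x. c) \<in> smooth" and smooth_coord: "(\<lambda>x. x $ i) \<in> smooth"
  by (simp_all add: smooth_def Ck_const Ck_coord)

lemma smooth_mult: "f \<in> smooth \<Longrightarrow> g \<in> smooth \<Longrightarrow> (\<lambda>x. f x * g x) \<in> smooth"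
  by (simp add: smooth_def Ck_mult)

lemma smooth_Ck: "f \<in> smooth \<Longrightarrow> Ck k f"
  by (simp add: smooth_def)

lemma smooth_partial: "f \<in> smooth \<Longrightarrow> partial i f \<in> smooth"
  unfolding smooth_def
proof (intro CollectI allI)
  fix k
  assume "f \<in> {\<phi>. \<forall>k. Ck k \<phi>}"
  then have "Ck (Suc k) f" by blast
  then show "Ck k (partial i f)" by simp
qed

lemma smooth_differentiable: "f \<in> smooth \<Longrightarrow> f differentiable (at x)"
  using smooth_Ck[of f "Suc 0"] by simp

lemma smooth_continuous: "f \<in> smooth \<Longrightarrow> continuous_on UNIV f"
  using smooth_Ck[of f 0] by simp

lemma test_smooth: "\<phi> \<in> test \<Omega> \<Longrightarrow> \<phi> \<in> smooth"
  by (simp add: test_def)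

lemma testI: "\<phi> \<in> smooth \<Longrightarrow> compact K \<Longrightarrow> K \<subseteq> \<Omega> \<Longrightarrow> (\<And>x. x \<notin> K \<Longrightarrow> \<phi> x = 0) \<Longrightarrow> \<phi> \<in> test \<Omega>"
  unfolding test_def by blast

lemma testE:
  assumes "\<phi> \<in> test \<Omega>"
  obtains K where "compact K" "K \<subseteq> \<Omega>" "\<And>x. x \<notin> K \<Longrightarrow> \<phi> x = 0"
  using assms unfolding test_def by blast

lemma test_mult: "\<phi> \<in> test \<Omega> \<Longrightarrow> f \<in> smooth \<Longrightarrow> (\<lambda>x. f x * \<phi> x) \<in> test \<Omega>"
  by (rule testE, assumption, rule testI) (auto intro: smooth_mult test_smooth)

lemma partial_zero_outside:
  assumes "compact K" "\<And>x. x \<notin> K \<Longrightarrow> \<phi> x = 0" "x \<notin> K"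
  shows "partial i \<phi> x = 0"
proof -
  have "((\<lambda>x. 0) has_derivative (\<lambda>h. 0)) (at x)" by simp
  then have "(\<phi> has_derivative (\<lambda>h. 0)) (at x)"
    by (rule has_derivative_transform_within_open[where s="- K"])
      (use assms compact_imp_closed in auto)
  then show ?thesis by (rule partialI)
qed

lemma test_partial: "\<phi> \<in> test \<Omega> \<Longrightarrow> partial i \<phi> \<in> test \<Omega>"
  by (rule testE, assumption, rule testI) (auto intro: smooth_partial test_smooth partial_zero_outside)

lemma test_zero: "(\<lambda>x. 0) \<in> test \<Omega>"
  by (rule testI[of _ "{}"]) (auto intro: smooth_const)

lemma test_bounded:
  assumes "\<phi> \<in> test \<Omega>"
  obtains M where "\<And>x. \<bar>\<phi> x\<bar> \<le> M"
proof -
  obtain K where K: "compact K" "\<And>x. x \<notin> K \<Longrightarrow> \<phi> x = 0" using assms by (auto simp: test_def)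
  have "bounded (\<phi> ` K)"
    using K smooth_continuous[OF test_smooth[OF assms]]
    by (intro compact_imp_bounded compact_continuous_image) (auto intro: continuous_on_subset)
  then obtain M where "\<And>x. x \<in> K \<Longrightarrow> norm (\<phi> x) \<le> M" by (auto simp: bounded_iff)
  then have "\<bar>\<phi> x\<bar> \<le> max M 0" for x using K(2)[of x] by (cases "x \<in> K") fastforce+
  then show thesis by (rule that)
qed

text \<open>With \<open>g t = exp (- 1 / t)\<close>, \<open>g (n * t)\<close> is the \<open>n\<close>-th root of \<open>g t\<close>; so the bumps increase to the
  indicator of the box.\<close>

definition bump :: "real^3 \<Rightarrow> real^3 \<Rightarrow> nat \<Rightarrow> scalar_fun" where
  "bump a b n x = (\<Prod>i\<in>UNIV. flat 1 (real n * x $ i + - real n * a $ i) * flat 1 (- real n * x $ i + real n * b $ i))"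

lemma flat_1: "flat 1 t = (if 0 < t then exp (- (1 / t)) else 0)"
  by (simp add: flat_def)

lemma flat_1_bounds: "0 \<le> flat 1 t" "flat 1 t \<le> 1"
  by (auto simp: flat_1)

lemma bump_bounds: "0 \<le> bump a b n x" "bump a b n x \<le> 1"
  unfolding bump_def using flat_1_bounds by (auto intro!: prod_nonneg prod_le_1 mult_le_one)

lemma bump_outside:
  assumes "x \<notin> box a b"
  shows "bump a b n x = 0"
proof -
  obtain i where "x $ i \<le> a $ i \<or> b $ i \<le> x $ i" using assms by (auto simp: mem_box_cart not_less)
  then have "real n * x $ i + - real n * a $ i \<le> 0 \<or> - real n * x $ i + real n * b $ i \<le> 0"
    by (auto intro: mult_left_mono)
  then show ?thesis unfolding bump_def by (intro prod_zero bexI[of _ i]) (auto simp: flat_1)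
qed

lemma bump_test:
  assumes "cbox a b \<subseteq> \<Omega>"
  shows "bump a b n \<in> test \<Omega>"
proof -
  have "bump a b n \<in> smooth"
    unfolding smooth_def bump_def[abs_def]
    by (intro CollectI allI Ck_prod Ck_mult Ck_flat_coord finite)
  then show ?thesis
    by (rule testI[of _ "cbox a b"]) (use assms in \<open>auto intro: bump_outside dest: subsetD[OF box_subset_cbox]\<close>)
qed

lemma bump_tendsto: "(\<lambda>n. bump a b n x) \<longlonglongrightarrow> indicator (box a b) x"
proof (cases "x \<in> box a b")
  case True
  have flat_lim: "(\<lambda>n. flat 1 (real n * t)) \<longlonglongrightarrow> 1" if "t > 0" for t
  proof -
    have "(\<lambda>n. exp (- (1 / t) * inverse (real n))) \<longlonglongrightarrow> exp (- (1 / t) * 0)"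
      by (intro tendsto_intros lim_inverse_n)
    then have "(\<lambda>n. exp (- (1 / t) * inverse (real n))) \<longlonglongrightarrow> 1" by simp
    then show ?thesis
      by (rule Lim_transform_eventually)
        (use that in \<open>auto simp: flat_1 eventually_sequentially field_simps intro!: exI[of _ 1]\<close>)
  qed
  have "(\<lambda>n. bump a b n x) \<longlonglongrightarrow> (\<Prod>i\<in>(UNIV::3 set). 1 * 1)"
    unfolding bump_def
  proof (intro tendsto_intros)
    fix i
    show "(\<lambda>n. flat 1 (real n * x $ i + - real n * a $ i)) \<longlonglongrightarrow> 1"
      using flat_lim[of "x $ i - a $ i"] True by (simp add: mem_box_cart right_diff_distrib)
    show "(\<lambda>n. flat 1 (- real n * x $ i + real n * b $ i)) \<longlonglongrightarrow> 1"
      using flat_lim[of "b $ i - x $ i"] True by (simp add: mem_box_cart right_diff_distrib)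
  qed
  then show ?thesis using True by simp
qed (simp add: bump_outside)

text \<open>The integrals of the difference quotients vanish by translation invariance.\<close>

lemma integral_partial_lborel:
  assumes psi: "\<psi> \<in> test \<Omega>"
  shows "integrable lborel (partial i \<psi>)" "(LINT x|lborel. partial i \<psi> x) = 0"
proof -
  obtain K where K: "compact K" "\<And>x. x \<notin> K \<Longrightarrow> \<psi> x = 0" using psi by (auto simp: test_def)
  obtain R where R: "\<And>x. x \<in> K \<Longrightarrow> norm x \<le> R" using compact_imp_bounded[OF K(1)] by (auto simp: bounded_iff)
  obtain M where M: "\<And>x. \<bar>partial i \<psi> x\<bar> \<le> M" using test_bounded[OF test_partial[OF psi]] by blast
  define e :: "real^3" where "e = axis i 1"
  have e: "norm e = 1" by (simp add: e_def)
  have der: "(\<psi> has_derivative frechet_derivative \<psi> (at x)) (at x)" for x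
    using smooth_differentiable[OF test_smooth[OF psi]] frechet_derivative_works by blast
  have line: "((\<lambda>t. \<psi> (x + t *\<^sub>R e)) has_real_derivative partial i \<psi> (x + t *\<^sub>R e)) (at t)" for x t
  proof -
    have l: "((\<lambda>t. x + t *\<^sub>R e) has_derivative (\<lambda>h. h *\<^sub>R e)) (at t)"
      by (auto intro!: derivative_eq_intros)
    have "((\<lambda>t. \<psi> (x + t *\<^sub>R e)) has_derivative (\<lambda>h. frechet_derivative \<psi> (at (x + t *\<^sub>R e)) (h *\<^sub>R e))) (at t)"
      using has_derivative_compose[OF l der] .
    moreover have "frechet_derivative \<psi> (at y) (h *\<^sub>R e) = partial i \<psi> y * h" for y h
      using linear_scale[OF has_derivative_linear[OF der]] by (simp add: partial_def e_def)
    ultimately show ?thesis by (simp add: has_field_derivative_def)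
  qed
  define D where "D n x = real (Suc n) * (\<psi> (x + inverse (real (Suc n)) *\<^sub>R e) - \<psi> x)" for n x
  have Dlim: "(\<lambda>n. D n x) \<longlonglongrightarrow> partial i \<psi> x" for x
  proof -
    have "((\<lambda>h. (\<psi> (x + (0 + h) *\<^sub>R e) - \<psi> (x + 0 *\<^sub>R e)) / h) \<longlongrightarrow> partial i \<psi> (x + 0 *\<^sub>R e)) (at 0)"
      using line[of x 0] unfolding DERIV_def .
    then have "((\<lambda>h. (\<psi> (x + h *\<^sub>R e) - \<psi> x) / h) \<longlongrightarrow> partial i \<psi> x) (at 0)" by simp
    moreover have "filterlim (\<lambda>n. inverse (real (Suc n))) (at 0) sequentially"
      using LIMSEQ_inverse_real_of_nat by (auto simp: filterlim_at)
    ultimately have "(\<lambda>n. (\<psi> (x + inverse (real (Suc n)) *\<^sub>R e) - \<psi> x) / inverse (real (Suc n))) \<longlonglongrightarrow> partial i \<psi> x"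
      by (rule filterlim_compose)
    then show ?thesis by (simp add: D_def divide_inverse mult.commute)
  qed
  \<comment> \<open>Inside the ball the mean value theorem applies; outside, both points of the
    quotient miss \<open>K\<close> because the step length is at most 1. Hence the radius R +
    1.\<close>
  have Dbound: "\<bar>D n x\<bar> \<le> M * indicator (cball 0 (R + 1)) x" for n x
  proof (cases "x \<in> cball 0 (R + 1)")
    case True
    obtain z where "\<psi> (x + inverse (real (Suc n)) *\<^sub>R e) - \<psi> (x + 0 *\<^sub>R e) = (inverse (real (Suc n)) - 0) * partial i \<psi> (x + z *\<^sub>R e)"
      using MVT2[of 0 "inverse (real (Suc n))" "\<lambda>t. \<psi> (x + t *\<^sub>R e)" "\<lambda>t. partial i \<psi> (x + t *\<^sub>R e)"] line by auto
    then have "D n x = partial i \<psi> (x + z *\<^sub>R e)" by (simp add: D_def)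
    then show ?thesis using M True by simp
  next
    case False
    then have "norm x > R + 1" by (simp add: not_le)
    moreover have "norm (x + inverse (real (Suc n)) *\<^sub>R e) \<ge> norm x - 1"
    proof -
      have "norm (inverse (real (Suc n)) *\<^sub>R e) \<le> 1" by (simp add: e inverse_le_1_iff)
      then show ?thesis using norm_diff_ineq[of x "inverse (real (Suc n)) *\<^sub>R e"] by linarith
    qed
    ultimately have "x \<notin> K" "x + inverse (real (Suc n)) *\<^sub>R e \<notin> K" using R by fastforce+
    then show ?thesis using False K(2) by (simp add: D_def)
  qed
  have mpsi: "\<psi> \<in> borel_measurable borel" "partial i \<psi> \<in> borel_measurable borel"
    using smooth_continuous test_smooth psi test_partial borel_measurable_continuous_onI by blast+
  then have mD: "D n \<in> borel_measurable lborel" for n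
    unfolding D_def by measurable
  have w: "integrable lborel (\<lambda>x. M * indicator (cball (0::real^3) (R + 1)) x)"
    by (intro integrable_mult_right integrable_real_indicator) (use emeasure_bounded_finite[OF bounded_cball] in \<open>auto simp: infinity_ennreal_def\<close>)
  have "integrable lborel \<psi>"
  proof -
    obtain M' where M': "\<And>x. \<bar>\<psi> x\<bar> \<le> M'" using test_bounded[OF psi] by blast
    have "integrable lborel (\<lambda>x. M' * indicator (cball (0::real^3) R) x)"
      by (intro integrable_mult_right integrable_real_indicator) (use emeasure_bounded_finite[OF bounded_cball] in \<open>auto simp: infinity_ennreal_def\<close>)
    then show ?thesis
      by (rule Bochner_Integration.integrable_bound)
        (use M' R K(2) mpsi in \<open>auto simp: indicator_def intro: order_trans[OF _ abs_ge_self]\<close>)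
  qed
  have trans: "integrable lborel (\<lambda>x. \<psi> (x + c))" "(LINT x|lborel. \<psi> (x + c)) = (LINT x|lborel. \<psi> x)" for c
  proof -
    have d: "distr lborel borel ((+) c) = lborel" by (rule lborel_distr_plus)
    show "(LINT x|lborel. \<psi> (x + c)) = (LINT x|lborel. \<psi> x)"
      using integral_distr[of "(+) c" lborel borel \<psi>] mpsi d by (simp add: add.commute)
    show "integrable lborel (\<lambda>x. \<psi> (x + c))"
      using integrable_distr_eq[of "(+) c" lborel borel \<psi>] mpsi d \<open>integrable lborel \<psi>\<close> by (simp add: add.commute)
  qed
  have "(LINT x|lborel. D n x) = 0" for n
    unfolding D_def using trans \<open>integrable lborel \<psi>\<close> by simp
  moreover have "(\<lambda>n. LINT x|lborel. D n x) \<longlonglongrightarrow> (LINT x|lborel. partial i \<psi> x)"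
    by (rule integral_dominated_convergence[where s=D and w="\<lambda>x. M * indicator (cball 0 (R + 1)) x"])
      (use mpsi mD w Dlim Dbound in auto)
  ultimately show "(LINT x|lborel. partial i \<psi> x) = 0" by (simp add: LIMSEQ_const_iff)
  show "integrable lborel (partial i \<psi>)"
    by (rule integrable_dominated_convergence[where s=D and w="\<lambda>x. M * indicator (cball 0 (R + 1)) x"])
      (use mpsi mD w Dlim Dbound in auto)
qed

section \<open>Square integrable and essentially bounded functions\<close>

text \<open>Puts function spaces under the general theory of \<open>span\<close> and
  \<open>subspace\<close>, with pointwise operations.\<close>

instantiation "fun" :: (type, real_vector) real_vector
begin

definition scaleR_fun :: "real \<Rightarrow> ('a \<Rightarrow> 'b) \<Rightarrow> 'a \<Rightarrow> 'b" where
  "scaleR_fun c f = (\<lambda>x. c *\<^sub>R f x)"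

instance
  by standard (auto simp: scaleR_fun_def fun_eq_iff algebra_simps)

end

lemma scaleR_fun_apply [simp]: "(c *\<^sub>R f) x = c *\<^sub>R f x"
  by (simp add: scaleR_fun_def)

locale bounded_domain =
  fixes \<Omega> :: "(real^3) set"
  assumes open_dom: "open \<Omega>" and bounded_dom: "bounded \<Omega>"
begin

abbreviation M where "M \<equiv> lebesgue_on \<Omega>"

lemma dom_sets: "\<Omega> \<in> sets lebesgue"
  using open_dom by simp

lemma dom_sets': "\<Omega> \<inter> space lebesgue \<in> sets lebesgue"
  using dom_sets by simp

sublocale finite_measure M
proof
  have "emeasure lborel \<Omega> < \<infinity>" using emeasure_bounded_finite[OF bounded_dom] .
  then show "emeasure M (space M) \<noteq> \<infinity>"
    using dom_sets open_dom by (simp add: emeasure_restrict_space)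
qed

lemma L2_iff: "f \<in> L2 \<Omega> \<longleftrightarrow> f \<in> borel_measurable M \<and> integrable M (\<lambda>x. (norm (f x))\<^sup>2)"
  for f :: "real^3 \<Rightarrow> 'b::euclidean_space"
  by (simp add: L2_def set_borel_measurable_def set_integrable_def
      borel_measurable_restrict_space_iff[OF dom_sets'] integrable_restrict_space[OF dom_sets'])

lemma l2_inner_eq: "l2_inner \<Omega> f g = (LINT x|M. f x \<bullet> g x)"
  by (simp add: l2_inner_def set_lebesgue_integral_def integral_restrict_space[OF dom_sets'])

lemma ae_eq_iff: "ae_eq \<Omega> f g \<longleftrightarrow> (AE x in M. f x = g x)"
  by (simp add: ae_eq_def AE_restrict_space_iff[OF dom_sets'])

lemma L2_measurable: "f \<in> L2 \<Omega> \<Longrightarrow> f \<in> borel_measurable M"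
  by (simp add: L2_iff)

lemma L2_integrable_inner:
  assumes "f \<in> L2 \<Omega>" "g \<in> L2 \<Omega>"
  shows "integrable M (\<lambda>x. f x \<bullet> g x)"
proof (rule Bochner_Integration.integrable_bound)
  show "integrable M (\<lambda>x. (norm (f x))\<^sup>2 + (norm (g x))\<^sup>2)"
    using assms by (auto simp: L2_iff)
  show "AE x in M. norm (f x \<bullet> g x) \<le> norm ((norm (f x))\<^sup>2 + (norm (g x))\<^sup>2)"
  proof (rule AE_I2)
    fix x
    have "\<bar>f x \<bullet> g x\<bar> \<le> norm (f x) * norm (g x)" by (rule Cauchy_Schwarz_ineq2)
    also have "\<dots> \<le> (norm (f x))\<^sup>2 + (norm (g x))\<^sup>2"
    proof -
      have "2 * (norm (f x) * norm (g x)) \<le> (norm (f x))\<^sup>2 + (norm (g x))\<^sup>2"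
        using sum_squares_bound[of "norm (f x)" "norm (g x)"] by (simp add: mult.assoc)
      moreover have "0 \<le> norm (f x) * norm (g x)" by simp
      ultimately show ?thesis by linarith
    qed
    finally show "norm (f x \<bullet> g x) \<le> norm ((norm (f x))\<^sup>2 + (norm (g x))\<^sup>2)" by simp
  qed
qed (use assms in \<open>auto simp: L2_iff\<close>)

lemma subspace_L2: "subspace (L2 \<Omega> :: (real^3 \<Rightarrow> 'b::euclidean_space) set)"
  unfolding subspace_def
proof (intro conjI ballI allI)
  fix f g :: "real^3 \<Rightarrow> 'b" and c :: real
  show "0 \<in> (L2 \<Omega> :: (real^3 \<Rightarrow> 'b) set)" by (simp add: L2_iff zero_fun_def)
  assume f: "f \<in> L2 \<Omega>"
  then show "c *\<^sub>R f \<in> L2 \<Omega>" by (auto simp: L2_iff scaleR_fun_def power_mult_distrib)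
  assume g: "g \<in> L2 \<Omega>"
  have "integrable M (\<lambda>x. (norm (f x))\<^sup>2 + 2 * (f x \<bullet> g x) + (norm (g x))\<^sup>2)"
    using f g L2_integrable_inner[OF f g] by (auto simp: L2_iff)
  moreover have "(norm (f x + g x))\<^sup>2 = (norm (f x))\<^sup>2 + 2 * (f x \<bullet> g x) + (norm (g x))\<^sup>2" for x
    unfolding power2_norm_eq_inner by (simp add: inner_simps inner_commute)
  ultimately show "f + g \<in> L2 \<Omega>" using f g by (auto simp: L2_iff plus_fun_def)
qed

lemma semi_inner_L2: "semi_inner (L2 \<Omega>) (l2_inner \<Omega>)"
  unfolding semi_inner_def bilin_def lin_on_def
  by (auto simp: l2_inner_eq inner_simps L2_integrable_inner inner_commute)

lemma l2_space: "semi_inner_space (L2 \<Omega>) (l2_inner \<Omega>)"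
  by (simp add: semi_inner_space_def subspace_L2 semi_inner_L2)

lemma l2_null_iff: "f \<in> L2 \<Omega> \<Longrightarrow> l2_inner \<Omega> f f = 0 \<longleftrightarrow> ae_eq \<Omega> f (\<lambda>x. 0)"
  by (subst l2_inner_eq, subst integral_nonneg_eq_0_iff_AE)
    (auto simp: L2_integrable_inner ae_eq_iff)

lemma l2_inner_cong:
  assumes "f \<in> L2 \<Omega>" "g \<in> L2 \<Omega>" "f' \<in> L2 \<Omega>" "g' \<in> L2 \<Omega>" "ae_eq \<Omega> f f'" "ae_eq \<Omega> g g'"
  shows "l2_inner \<Omega> f g = l2_inner \<Omega> f' g'"
  unfolding l2_inner_eq using assms
  by (intro integral_cong_AE) (auto dest!: L2_measurable simp: ae_eq_iff)

lemma l2_inner_commute: "l2_inner \<Omega> f g = l2_inner \<Omega> g f"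
  by (simp add: l2_inner_def inner_commute)

lemma ae_eq_diff_null: "ae_eq \<Omega> f g \<longleftrightarrow> ae_eq \<Omega> (f - g) (\<lambda>x. 0)"
  for f g :: "real^3 \<Rightarrow> 'b::euclidean_space"
  by (simp add: ae_eq_def)

text \<open>The ambient space for triple products: three square integrable fields need not have an
  integrable product, but bounded fields on a bounded domain do. The bound is almost everywhere
  because a finite element function is unconstrained on cell faces.\<close>

definition Linf :: "(real^3 \<Rightarrow> 'b::euclidean_space) set" where
  "Linf = {f \<in> borel_measurable M. \<exists>C. AE x in M. norm (f x) \<le> C}"

lemma LinfE:
  assumes "f \<in> Linf"
  obtains C where "C \<ge> 0" "AE x in M. norm (f x) \<le> C"
proof -
  obtain C where "AE x in M. norm (f x) \<le> C" using assms by (auto simp: Linf_def)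
  then have "AE x in M. norm (f x) \<le> max C 0" by eventually_elim simp
  then show thesis by (intro that[of "max C 0"]) auto
qed

lemma Linf_measurable: "f \<in> Linf \<Longrightarrow> f \<in> borel_measurable M"
  by (simp add: Linf_def)

lemma Linf_L2: "f \<in> Linf \<Longrightarrow> f \<in> L2 \<Omega>"
proof -
  assume f: "f \<in> Linf"
  then obtain C where C: "C \<ge> 0" "AE x in M. norm (f x) \<le> C" by (rule LinfE)
  have "integrable M (\<lambda>x. (norm (f x))\<^sup>2)"
  proof (rule integrable_const_bound[where B="C\<^sup>2"])
    show "AE x in M. norm ((norm (f x))\<^sup>2) \<le> C\<^sup>2"
      using C(2) by eventually_elim (simp add: power_mono)
  qed (use Linf_measurable[OF f] in measurable)
  then show ?thesis using Linf_measurable[OF f] by (simp add: L2_iff)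
qed

lemma subspace_Linf: "subspace (Linf :: (real^3 \<Rightarrow> 'b::euclidean_space) set)"
  unfolding subspace_def
proof (intro conjI ballI allI)
  fix f g :: "real^3 \<Rightarrow> 'b" and c :: real
  show "0 \<in> (Linf :: (real^3 \<Rightarrow> 'b) set)" by (auto simp: Linf_def zero_fun_def intro!: exI[of _ 0])
  assume f: "f \<in> Linf"
  then obtain C where C: "C \<ge> 0" "AE x in M. norm (f x) \<le> C" by (rule LinfE)
  have "AE x in M. norm (c *\<^sub>R f x) \<le> \<bar>c\<bar> * C"
    using C(2) by eventually_elim (simp add: mult_left_mono)
  then show "c *\<^sub>R f \<in> Linf" using f by (auto simp: Linf_def scaleR_fun_def)
  assume g: "g \<in> Linf"
  then obtain D where D: "D \<ge> 0" "AE x in M. norm (g x) \<le> D" by (rule LinfE)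
  have "AE x in M. norm (f x + g x) \<le> C + D"
    using C(2) D(2) by eventually_elim (rule norm_triangle_le, simp)
  then show "f + g \<in> Linf" using f g by (auto simp: Linf_def plus_fun_def)
qed

lemma Linf_cong: "g \<in> Linf \<Longrightarrow> f \<in> borel_measurable M \<Longrightarrow> ae_eq \<Omega> f g \<Longrightarrow> f \<in> Linf"
proof -
  assume g: "g \<in> Linf" and f: "f \<in> borel_measurable M" and eq: "ae_eq \<Omega> f g"
  obtain C where "AE x in M. norm (g x) \<le> C" using g by (auto simp: Linf_def)
  then have "AE x in M. norm (f x) \<le> C" using eq unfolding ae_eq_iff by eventually_elim simp
  then show ?thesis using f by (auto simp: Linf_def)
qed

lemma L2_bounded_by:
  fixes G :: "real^3 \<Rightarrow> 'c::euclidean_space" and f :: "real^3 \<Rightarrow> 'b::euclidean_space"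
  assumes "G \<in> L2 \<Omega>" "f \<in> borel_measurable M" "AE x in M. norm (f x) \<le> C * norm (G x)" "C \<ge> 0"
  shows "f \<in> L2 \<Omega>" "sqrt (l2_inner \<Omega> f f) \<le> C * sqrt (l2_inner \<Omega> G G)"
proof -
  have sq: "AE x in M. (norm (f x))\<^sup>2 \<le> C\<^sup>2 * (norm (G x))\<^sup>2"
    using assms(3)
  proof eventually_elim
    case (elim x)
    then have "(norm (f x))\<^sup>2 \<le> (C * norm (G x))\<^sup>2" by (intro power_mono) auto
    then show ?case by (simp add: power_mult_distrib)
  qed
  have iG: "integrable M (\<lambda>x. C\<^sup>2 * (norm (G x))\<^sup>2)" using assms(1) by (simp add: L2_iff)
  have i: "integrable M (\<lambda>x. (norm (f x))\<^sup>2)"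
    by (rule Bochner_Integration.integrable_bound[OF iG]) (use assms(2) sq in auto)
  then show "f \<in> L2 \<Omega>" using assms by (simp add: L2_iff)
  have "(LINT x|M. (norm (f x))\<^sup>2) \<le> (LINT x|M. C\<^sup>2 * (norm (G x))\<^sup>2)"
    by (rule integral_mono_AE[OF i iG sq])
  then have "l2_inner \<Omega> f f \<le> C\<^sup>2 * l2_inner \<Omega> G G"
    by (simp add: l2_inner_eq power2_norm_eq_inner)
  then have "sqrt (l2_inner \<Omega> f f) \<le> sqrt (C\<^sup>2 * l2_inner \<Omega> G G)" by (rule real_sqrt_le_mono)
  then show "sqrt (l2_inner \<Omega> f f) \<le> C * sqrt (l2_inner \<Omega> G G)"
    using assms(4) by (simp add: real_sqrt_mult)
qed

text \<open>\<open>C\<close> is fixed before \<open>G\<close>: multiplication by a bounded field is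
  continuous on L2, as the density argument for convection requires.\<close>

lemma L2_inner_Linf:
  fixes w :: "real^3 \<Rightarrow> 'b::euclidean_space"
  assumes "w \<in> Linf"
  obtains C where "C \<ge> 0"
    "\<And>G :: real^3 \<Rightarrow> 'b. G \<in> L2 \<Omega> \<Longrightarrow> (\<lambda>x. w x \<bullet> G x) \<in> L2 \<Omega> \<and>
      sqrt (l2_inner \<Omega> (\<lambda>x. w x \<bullet> G x) (\<lambda>x. w x \<bullet> G x)) \<le> C * sqrt (l2_inner \<Omega> G G)"
proof -
  obtain C where C: "C \<ge> 0" "AE x in M. norm (w x) \<le> C" using assms by (rule LinfE)
  show thesis
  proof (rule that[OF C(1)])
    fix G :: "real^3 \<Rightarrow> 'b" assume G: "G \<in> L2 \<Omega>"
    have m: "(\<lambda>x. w x \<bullet> G x) \<in> borel_measurable M"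
      using Linf_measurable[OF assms] L2_measurable[OF G] by measurable
    have "AE x in M. norm (w x \<bullet> G x) \<le> C * norm (G x)"
      using C(2)
    proof eventually_elim
      case (elim x)
      have "norm (w x \<bullet> G x) \<le> norm (w x) * norm (G x)" by (simp add: Cauchy_Schwarz_ineq2)
      also have "\<dots> \<le> C * norm (G x)" using elim by (intro mult_right_mono) auto
      finally show ?case .
    qed
    from L2_bounded_by[OF G m this C(1)]
    show "(\<lambda>x. w x \<bullet> G x) \<in> L2 \<Omega> \<and>
      sqrt (l2_inner \<Omega> (\<lambda>x. w x \<bullet> G x) (\<lambda>x. w x \<bullet> G x)) \<le> C * sqrt (l2_inner \<Omega> G G)" by blast
  qed
qed

lemma Linf_cross:
  assumes "u \<in> Linf" "v \<in> Linf"
  shows "(\<lambda>x. cross3 (u x) (v x)) \<in> Linf"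
proof -
  obtain C where C: "C \<ge> 0" "AE x in M. norm (u x) \<le> C" using assms(1) by (rule LinfE)
  obtain D where D: "D \<ge> 0" "AE x in M. norm (v x) \<le> D" using assms(2) by (rule LinfE)
  have "AE x in M. norm (cross3 (u x) (v x)) \<le> C * D"
    using C(2) D(2)
  proof eventually_elim
    case (elim x)
    have "(norm (cross3 (u x) (v x)))\<^sup>2 \<le> (norm (u x) * norm (v x))\<^sup>2"
      by (simp add: norm_cross power_mult_distrib)
    then have "norm (cross3 (u x) (v x)) \<le> norm (u x) * norm (v x)" by (rule power2_le_imp_le) simp
    also have "\<dots> \<le> C * D" using elim C(1) by (intro mult_mono) auto
    finally show ?case .
  qed
  moreover have "(\<lambda>x. cross3 (u x) (v x)) \<in> borel_measurable M"
    using Linf_measurable[OF assms(1)] Linf_measurable[OF assms(2)]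
    by (intro borel_measurable_continuous_Pair[where H=cross3]) (auto intro!: continuous_on_cross continuous_intros)
  ultimately show ?thesis by (auto simp: Linf_def)
qed

lemma continuous_Linf:
  assumes "continuous_on UNIV f"
  shows "f \<in> Linf"
proof -
  have "bounded (f ` closure \<Omega>)"
    using assms bounded_dom
    by (intro compact_imp_bounded compact_continuous_image) (auto intro: continuous_on_subset simp: compact_closure)
  then obtain C where "\<And>x. x \<in> \<Omega> \<Longrightarrow> norm (f x) \<le> C"
    unfolding bounded_iff using closure_subset by blast
  moreover have "f \<in> borel_measurable lborel" using borel_measurable_continuous_onI[OF assms] by simp
  then have "f \<in> borel_measurable M" by (intro measurable_restrict_space1 measurable_completion)
  ultimately show ?thesis by (auto simp: Linf_def intro!: exI[of _ C] AE_I2)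
qed

lemma smooth_Linf: "f \<in> smooth \<Longrightarrow> f \<in> Linf"
  by (intro continuous_Linf smooth_continuous)

lemma smooth_L2: "f \<in> smooth \<Longrightarrow> f \<in> L2 \<Omega>"
  by (intro Linf_L2 smooth_Linf)

lemma test_L2: "\<phi> \<in> test \<Omega> \<Longrightarrow> \<phi> \<in> L2 \<Omega>"
  by (intro smooth_L2 test_smooth)

section \<open>The fundamental lemma of the calculus of variations\<close>

lemma integral_partial:
  assumes "\<psi> \<in> test \<Omega>"
  shows "(LINT x|M. partial i \<psi> x) = 0"
proof -
  obtain K where K: "K \<subseteq> \<Omega>" "\<And>x. x \<notin> K \<Longrightarrow> partial i \<psi> x = 0"
    using testE[OF test_partial[OF assms]] by metis
  have "(LINT x|M. partial i \<psi> x) = (LINT x|lebesgue. indicator \<Omega> x *\<^sub>R partial i \<psi> x)"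
    by (rule integral_restrict_space[OF dom_sets'])
  also have "(\<lambda>x. indicator \<Omega> x *\<^sub>R partial i \<psi> x) = partial i \<psi>"
    using K by (auto simp: fun_eq_iff indicator_def)
  also have "(LINT x|lebesgue. partial i \<psi> x) = (LINT x|lborel. partial i \<psi> x)"
    using integral_partial_lborel(1)[OF assms, of i] by (intro integral_completion) auto
  finally show ?thesis using integral_partial_lborel(2)[OF assms] by simp
qed

text \<open>The bumps are test functions that tend to the indicator of the box; the products are
  dominated by \<open>\<bar>g\<bar>\<close>, which is integrable since the domain has finite
  measure.\<close>

lemma integral_box_zero:
  assumes g: "g \<in> L2 \<Omega>" and orth: "\<And>\<phi>. \<phi> \<in> test \<Omega> \<Longrightarrow> l2_inner \<Omega> g \<phi> = 0" and sub: "cbox a b \<subseteq> \<Omega>"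
  shows "(LINT x|M. g x * indicator (box a b) x) = 0"
proof -
  have ig: "integrable M g"
    using L2_integrable_inner[OF g smooth_L2[OF smooth_const[of 1]]] by simp
  note [measurable] = L2_measurable[OF g]
  have mb [measurable]: "bump a b n \<in> borel_measurable M" for n
    using L2_measurable[OF test_L2[OF bump_test[OF sub]]] .
  have mi: "(indicator (box a b) :: real^3 \<Rightarrow> real) \<in> borel_measurable M"
    by (intro measurable_restrict_space1 borel_measurable_indicator) simp
  note [measurable] = mi
  have "(\<lambda>n. LINT x|M. g x * bump a b n x) \<longlonglongrightarrow> (LINT x|M. g x * indicator (box a b) x)"
  proof (rule integral_dominated_convergence[where w="\<lambda>x. \<bar>g x\<bar>"])
    show "AE x in M. (\<lambda>n. g x * bump a b n x) \<longlonglongrightarrow> g x * indicator (box a b) x"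
      by (intro AE_I2 tendsto_intros bump_tendsto)
    show "AE x in M. norm (g x * bump a b n x) \<le> \<bar>g x\<bar>" for n
      by (rule AE_I2) (use bump_bounds[of a b n] in \<open>auto simp: abs_mult mult_left_le\<close>)
  qed (use ig in auto)
  moreover have "(LINT x|M. g x * bump a b n x) = 0" for n
    using orth[OF bump_test[OF sub]] by (simp add: l2_inner_eq)
  ultimately show ?thesis by (simp add: LIMSEQ_const_iff)
qed

text \<open>The averages of \<open>g\<close> over small cubes inside \<Omega> vanish, and by
  Lebesgue differentiation they recover \<open>g\<close> at almost every point.\<close>

lemma fundamental:
  assumes g: "g \<in> L2 \<Omega>" and orth: "\<And>\<phi>. \<phi> \<in> test \<Omega> \<Longrightarrow> l2_inner \<Omega> g \<phi> = 0"
  shows "ae_eq \<Omega> g (\<lambda>x. 0)"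
proof -
  define G where "G x = indicator \<Omega> x *\<^sub>R g x" for x
  have "integrable M g"
    using L2_integrable_inner[OF g smooth_L2[OF smooth_const[of 1]]] by simp
  then have iG: "integrable lebesgue G"
    unfolding G_def by (simp add: integrable_restrict_space[OF dom_sets'])
  have iGA: "set_integrable lebesgue A G" if "A \<in> sets lebesgue" for A
    unfolding set_integrable_def using integrable_mult_indicator[OF that iG] .
  have "G integrable_on cbox a b" for a b
    using set_lebesgue_integral_eq_integral(1)[OF iGA[of "cbox a b"]] by simp
  then obtain N where N: "negligible N" and lim: "\<And>x e. \<lbrakk>x \<notin> N; 0 < e\<rbrakk> \<Longrightarrow>
      \<exists>d>0. \<forall>h. 0 < h \<and> h < d \<longrightarrow>
        norm (integral (cbox x (x + h *\<^sub>R One)) G /\<^sub>R h ^ DIM(real^3) - G x) < e"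
    by (rule integrable_ccontinuous_explicit) blast
  have zero: "integral (cbox a b) G = 0" if "cbox a b \<subseteq> \<Omega>" for a b
  proof -
    have "0 = (LINT x|M. g x * indicator (box a b) x)" using integral_box_zero[OF g orth that] by simp
    also have "\<dots> = (LINT x|lebesgue. indicator \<Omega> x *\<^sub>R (g x * indicator (box a b) x))"
      by (rule integral_restrict_space[OF dom_sets'])
    also have "\<dots> = (LINT x:box a b|lebesgue. G x)"
      by (simp add: set_lebesgue_integral_def G_def mult_ac)
    also have "\<dots> = integral (box a b) G"
      by (rule set_lebesgue_integral_eq_integral(2)[OF iGA]) simp
    finally show ?thesis by (simp add: integral_open_interval)
  qed
  have "g x = 0" if x: "x \<in> \<Omega>" "x \<notin> N" for x
  proof (rule ccontr)
    assume "g x \<noteq> 0"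
    then have "norm (G x) > 0" using x by (simp add: G_def)
    from lim[OF x(2) this] obtain d where d: "d > 0" "\<And>h. 0 < h \<Longrightarrow> h < d \<Longrightarrow>
      norm (integral (cbox x (x + h *\<^sub>R One)) G /\<^sub>R h ^ DIM(real^3) - G x) < norm (G x)" by blast
    obtain r where r: "r > 0" "cball x r \<subseteq> \<Omega>" using open_dom x by (auto simp: open_contains_cball)
    \<comment> \<open>Small enough for the differentiation estimate and for the cube with corner
      \<open>x\<close> to stay in the ball of radius \<open>r\<close>.\<close>
    define h where "h = min (d / 2) (r / (norm (One::real^3) + 1))"
    have pos: "norm (One::real^3) + 1 > 0" by (smt (verit) norm_ge_zero)
    have h: "0 < h" "h < d" using d r pos by (auto simp: h_def)
    have hr: "h * norm (One::real^3) \<le> r"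
    proof -
      have "h * (norm (One::real^3) + 1) \<le> r / (norm (One::real^3) + 1) * (norm (One::real^3) + 1)"
        using pos by (intro mult_right_mono) (auto simp: h_def)
      then have "h * (norm (One::real^3) + 1) \<le> r" using pos by simp
      then show ?thesis using h by (simp add: algebra_simps)
    qed
    have "cbox x (x + h *\<^sub>R One) \<subseteq> cball x r"
    proof
      fix y assume y: "y \<in> cbox x (x + h *\<^sub>R One)"
      have "norm (y - x) \<le> norm (h *\<^sub>R (One::real^3))"
      proof (rule norm_le_componentwise)
        fix b :: "real^3" assume "b \<in> Basis"
        then show "\<bar>(y - x) \<bullet> b\<bar> \<le> \<bar>(h *\<^sub>R One) \<bullet> b\<bar>" using y h
          by (auto simp: mem_box inner_simps)
      qed
      then show "y \<in> cball x r" using hr h by (simp add: dist_norm norm_minus_commute)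
    qed
    then have "integral (cbox x (x + h *\<^sub>R One)) G = 0" using r by (intro zero) auto
    then show False using d(2)[OF h] by simp
  qed
  moreover have "AE x in lebesgue. x \<notin> N" using N by (simp add: negligible_iff_null_sets AE_not_in)
  ultimately show ?thesis unfolding ae_eq_def by (auto elim!: eventually_mono)
qed

end

section \<open>Weak derivatives\<close>

lemma component_add: "component (u + v) i = component u i + component v i"
  and component_scale: "component (c *\<^sub>R u) i = c *\<^sub>R component u i"
  and component_grad: "component (grad \<phi>) i = partial i \<phi>"
  by (auto simp: component_def grad_def fun_eq_iff)

text \<open>Common frame for gradient, curl and divergence: a relation compatible with linear
  combinations whose values are unique almost everywhere. \<open>Op\<close> chooses among these
  values, so \<open>Op (u + v)\<close> and \<open>Op u + Op v\<close> agree only almost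
  everywhere.\<close>

locale weak_operator = bounded_domain +
  fixes R :: "(real^3 \<Rightarrow> 'b::euclidean_space) \<Rightarrow> (real^3 \<Rightarrow> 'c::euclidean_space) \<Rightarrow> bool"
    and Op :: "(real^3 \<Rightarrow> 'b) \<Rightarrow> (real^3 \<Rightarrow> 'c)"
  assumes Op: "Op u = (SOME d. R u d)"
    and R_L2: "R u d \<Longrightarrow> d \<in> L2 \<Omega>"
    and R_add: "u \<in> L2 \<Omega> \<Longrightarrow> v \<in> L2 \<Omega> \<Longrightarrow> R u d \<Longrightarrow> R v e \<Longrightarrow> R (u + v) (d + e)"
    and R_scale: "u \<in> L2 \<Omega> \<Longrightarrow> R u d \<Longrightarrow> R (c *\<^sub>R u) (c *\<^sub>R d)"
    and R_zero: "R 0 0"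
    and R_unique: "R u d \<Longrightarrow> R u e \<Longrightarrow> ae_eq \<Omega> d e"
begin

definition dom where "dom = {u \<in> L2 \<Omega>. \<exists>d. R u d}"

lemma dom_L2: "u \<in> dom \<Longrightarrow> u \<in> L2 \<Omega>" by (simp add: dom_def)

lemma domI: "u \<in> L2 \<Omega> \<Longrightarrow> R u d \<Longrightarrow> u \<in> dom" by (auto simp: dom_def)

lemma Op_works: "u \<in> dom \<Longrightarrow> R u (Op u)"
  unfolding Op using someI_ex[of "R u"] by (simp add: dom_def)

lemma Op_L2: "u \<in> dom \<Longrightarrow> Op u \<in> L2 \<Omega>" using Op_works R_L2 by blast

lemma Op_eq: "u \<in> dom \<Longrightarrow> R u d \<Longrightarrow> ae_eq \<Omega> (Op u) d" using Op_works R_unique by blast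

lemma subspace_dom: "subspace dom"
  unfolding subspace_def
proof (intro conjI ballI allI)
  show "0 \<in> dom" using R_zero subspace_0[OF subspace_L2] by (rule domI[rotated])
  show "u + v \<in> dom" if "u \<in> dom" "v \<in> dom" for u v
    using domI[OF _ R_add[OF dom_L2 dom_L2 Op_works Op_works]] that subspace_add[OF subspace_L2] dom_L2 by blast
  show "c *\<^sub>R u \<in> dom" if "u \<in> dom" for c u
    using domI[OF _ R_scale[OF dom_L2 Op_works]] that subspace_scale[OF subspace_L2] dom_L2 by blast
qed

lemma Op_add: "u \<in> dom \<Longrightarrow> v \<in> dom \<Longrightarrow> ae_eq \<Omega> (Op (u + v)) (Op u + Op v)"
  by (intro Op_eq R_add) (auto simp: dom_L2 Op_works subspace_add[OF subspace_dom])

lemma Op_scale: "u \<in> dom \<Longrightarrow> ae_eq \<Omega> (Op (c *\<^sub>R u)) (c *\<^sub>R Op u)"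
  by (intro Op_eq R_scale) (auto simp: dom_L2 Op_works subspace_scale[OF subspace_dom])

lemma ae_eq_refl: "ae_eq \<Omega> f f" by (simp add: ae_eq_def)

text \<open>The inner product does not see null sets, so pairing with a fixed function makes the
  choice-dependent \<open>Op\<close> genuinely linear.\<close>

lemma lin_on_Op: "X \<in> L2 \<Omega> \<Longrightarrow> lin_on dom (\<lambda>u. l2_inner \<Omega> (Op u) X)"
proof -
  assume X: "X \<in> L2 \<Omega>"
  interpret semi_inner_space "L2 \<Omega> :: (real^3 \<Rightarrow> 'c) set" "l2_inner \<Omega>" by (rule l2_space)
  show ?thesis
    unfolding lin_on_def
  proof (intro conjI ballI allI)
    show "l2_inner \<Omega> (Op (u + v)) X = l2_inner \<Omega> (Op u) X + l2_inner \<Omega> (Op v) X"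
      if "u \<in> dom" "v \<in> dom" for u v
      using l2_inner_cong[OF _ X _ X Op_add[OF that] ae_eq_refl] that X
      by (simp add: Op_L2 subspace_add[OF subspace_dom] subspace_add[OF subspace] add_l)
    show "l2_inner \<Omega> (Op (c *\<^sub>R u)) X = c * l2_inner \<Omega> (Op u) X" if "u \<in> dom" for c u
      using l2_inner_cong[OF _ X _ X Op_scale[OF that, of c] ae_eq_refl] that X
      by (simp add: Op_L2 subspace_scale[OF subspace_dom] subspace_scale[OF subspace] scale_l)
  qed
qed

lemma semi_inner_Op: "semi_inner dom (\<lambda>u v. l2_inner \<Omega> (Op u) (Op v))"
proof -
  interpret semi_inner_space "L2 \<Omega> :: (real^3 \<Rightarrow> 'c) set" "l2_inner \<Omega>" by (rule l2_space)
  have 1: "lin_on dom (\<lambda>u. l2_inner \<Omega> (Op u) (Op v))" if "v \<in> dom" for v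
    using that by (intro lin_on_Op Op_L2)
  moreover have "lin_on dom (\<lambda>v. l2_inner \<Omega> (Op u) (Op v))" if "u \<in> dom" for u
    using 1[OF that] by (subst l2_inner_commute)
  moreover have "l2_inner \<Omega> (Op u) (Op v) = l2_inner \<Omega> (Op v) (Op u)" for u v
    by (rule l2_inner_commute)
  ultimately show ?thesis
    unfolding semi_inner_def bilin_def using nonneg Op_L2 by blast
qed

end

context bounded_domain
begin

sublocale sc: semi_inner_space "L2 \<Omega> :: scalar_fun set" "l2_inner \<Omega>" by (rule l2_space)
sublocale ve: semi_inner_space "L2 \<Omega> :: vector_fun set" "l2_inner \<Omega>" by (rule l2_space)

lemma component_L2: "u \<in> L2 \<Omega> \<Longrightarrow> component u i \<in> L2 \<Omega>"
proof (rule L2_bounded_by(1)[where C=1])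
  assume u: "u \<in> L2 \<Omega>"
  have "(\<lambda>x. u x \<bullet> axis i 1) \<in> borel_measurable M" using L2_measurable[OF u] by measurable
  then show "component u i \<in> borel_measurable M" by (simp add: component_def[abs_def] inner_axis)
  show "AE x in M. norm (component u i x) \<le> 1 * norm (u x)"
    by (rule AE_I2) (simp add: component_def component_le_norm_cart)
qed auto

lemma component_expand: "u = (\<lambda>x. \<Sum>i\<in>UNIV. component u i x *\<^sub>R axis i 1)"
  by (rule ext) (simp add: component_def vec_eq_iff axis_def if_distrib cong: if_cong)

lemma L2_componentsI:
  assumes "\<And>i. component u i \<in> L2 \<Omega>"
  shows "u \<in> L2 \<Omega>"
proof -
  have m: "(\<lambda>x. \<Sum>i\<in>UNIV. component u i x *\<^sub>R axis i 1 :: real^3) \<in> borel_measurable M"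
    using L2_measurable[OF assms] by measurable
  have "(norm (u x))\<^sup>2 = (\<Sum>i\<in>UNIV. (norm (component u i x))\<^sup>2)" for x
    unfolding power2_norm_eq_inner by (simp add: inner_vec_def component_def)
  then have "integrable M (\<lambda>x. (norm (u x))\<^sup>2)" using assms by (simp add: L2_iff)
  then show ?thesis using m component_expand[of u] by (simp add: L2_iff)
qed

lemma l2_inner_components:
  assumes "u \<in> L2 \<Omega>" "v \<in> L2 \<Omega>"
  shows "l2_inner \<Omega> u v = (\<Sum>i\<in>UNIV. l2_inner \<Omega> (component u i) (component v i))"
proof -
  have "(\<Sum>i\<in>UNIV. l2_inner \<Omega> (component u i) (component v i)) =
      (LINT x|M. (\<Sum>i\<in>UNIV. component u i x \<bullet> component v i x))"
    unfolding l2_inner_eq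
    by (rule Bochner_Integration.integral_sum[symmetric]) (intro L2_integrable_inner component_L2 assms)
  then show ?thesis by (simp add: l2_inner_eq inner_vec_def component_def)
qed

lemma ae_eq_components: "(\<And>i. ae_eq \<Omega> (component u i) (component v i)) \<Longrightarrow> ae_eq \<Omega> u v"
proof -
  assume "\<And>i. ae_eq \<Omega> (component u i) (component v i)"
  then have "AE x in M. \<forall>i. component u i x = component v i x"
    unfolding ae_eq_iff by (subst AE_all_countable) auto
  then show ?thesis unfolding ae_eq_iff
    by eventually_elim (simp add: component_def vec_eq_iff)
qed

lemma fundamental_eq:
  assumes "c \<in> L2 \<Omega>" "d \<in> L2 \<Omega>" "\<And>\<phi>. \<phi> \<in> test \<Omega> \<Longrightarrow> l2_inner \<Omega> c \<phi> = l2_inner \<Omega> d \<phi>"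
  shows "ae_eq \<Omega> c d"
proof -
  have "ae_eq \<Omega> (c - d) (\<lambda>x. 0)"
    using assms sc.subspace by (intro fundamental) (auto intro: subspace_diff simp: sc.diff_l test_L2)
  then show ?thesis by (simp add: ae_eq_diff_null[of c])
qed

sublocale grad: weak_operator \<Omega> "is_weak_grad \<Omega>" "weak_grad \<Omega>"
proof
  note tl = test_L2 test_partial component_L2 subspace_add[OF sc.subspace]
    subspace_scale[OF sc.subspace] subspace_add[OF ve.subspace] subspace_scale[OF ve.subspace]
  show "is_weak_grad \<Omega> (u + v) (d + e)"
    if "u \<in> L2 \<Omega>" "v \<in> L2 \<Omega>" "is_weak_grad \<Omega> u d" "is_weak_grad \<Omega> v e" for u v d e
    using that unfolding is_weak_grad_def by (simp add: component_add tl sc.add_l)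
  show "is_weak_grad \<Omega> (c *\<^sub>R u) (c *\<^sub>R d)" if "u \<in> L2 \<Omega>" "is_weak_grad \<Omega> u d" for u c d
    using that unfolding is_weak_grad_def by (simp add: component_scale tl sc.scale_l)
  show "is_weak_grad \<Omega> 0 0"
    using subspace_0[OF ve.subspace] by (simp add: is_weak_grad_def l2_inner_def component_def)
  show "ae_eq \<Omega> d e" if "is_weak_grad \<Omega> u d" "is_weak_grad \<Omega> u e" for u d e
    using that unfolding is_weak_grad_def
    by (intro ae_eq_components fundamental_eq) (auto simp: tl)
qed (auto simp: weak_grad_def is_weak_grad_def)

lemma test_vec_L2: "\<phi> \<in> test_vec \<Omega> \<Longrightarrow> \<phi> \<in> L2 \<Omega>"
  by (intro L2_componentsI test_L2) (simp add: test_vec_def)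

lemma curl_test_L2: "\<phi> \<in> test_vec \<Omega> \<Longrightarrow> curl \<phi> \<in> L2 \<Omega>"
proof (rule L2_componentsI)
  fix i assume "\<phi> \<in> test_vec \<Omega>"
  then have p: "partial k (component \<phi> j) \<in> L2 \<Omega>" for j k
    by (intro test_L2 test_partial) (simp add: test_vec_def)
  have "component (curl \<phi>) i \<in>
    {partial 2 (component \<phi> 3) - partial 3 (component \<phi> 2),
     partial 3 (component \<phi> 1) - partial 1 (component \<phi> 3),
     partial 1 (component \<phi> 2) - partial 2 (component \<phi> 1)}"
    using exhaust_3[of i] by (auto simp: component_def curl_def fun_eq_iff vector_3)
  then show "component (curl \<phi>) i \<in> L2 \<Omega>" using p subspace_diff[OF sc.subspace] by auto
qed

text \<open>Test fields with a single nonzero component reduce uniqueness of the weak curl to the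
  scalar fundamental lemma.\<close>

lemma test_vec_axis:
  assumes "\<phi> \<in> test \<Omega>"
  shows "(\<lambda>x. axis i (\<phi> x)) \<in> test_vec \<Omega>"
  unfolding test_vec_def
proof (intro CollectI allI)
  fix j
  have "component (\<lambda>x. axis i (\<phi> x)) j = (if j = i then \<phi> else (\<lambda>x. 0))"
    by (auto simp: component_def axis_def fun_eq_iff)
  then show "component (\<lambda>x. axis i (\<phi> x)) j \<in> test \<Omega>" using assms test_zero by simp
qed

lemma l2_inner_axis: "l2_inner \<Omega> c (\<lambda>x. axis i (\<phi> x)) = l2_inner \<Omega> (component c i) \<phi>"
  by (simp add: l2_inner_def component_def inner_axis)

sublocale curl: weak_operator \<Omega> "is_weak_curl \<Omega>" "weak_curl \<Omega>"
proof
  note tl = test_vec_L2 curl_test_L2 subspace_add[OF ve.subspace] subspace_scale[OF ve.subspace]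
  show "is_weak_curl \<Omega> (u + v) (d + e)"
    if "u \<in> L2 \<Omega>" "v \<in> L2 \<Omega>" "is_weak_curl \<Omega> u d" "is_weak_curl \<Omega> v e" for u v d e
    using that unfolding is_weak_curl_def by (simp add: tl ve.add_l)
  show "is_weak_curl \<Omega> (c *\<^sub>R u) (c *\<^sub>R d)" if "u \<in> L2 \<Omega>" "is_weak_curl \<Omega> u d" for u c d
    using that unfolding is_weak_curl_def by (simp add: tl ve.scale_l)
  show "is_weak_curl \<Omega> 0 0"
    using subspace_0[OF ve.subspace] by (simp add: is_weak_curl_def l2_inner_def)
  show "ae_eq \<Omega> d e" if "is_weak_curl \<Omega> u d" "is_weak_curl \<Omega> u e" for u d e
  proof (intro ae_eq_components fundamental_eq component_L2)
    show "l2_inner \<Omega> (component d i) \<phi> = l2_inner \<Omega> (component e i) \<phi>" if "\<phi> \<in> test \<Omega>" for i \<phi>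
      using \<open>is_weak_curl \<Omega> u d\<close> \<open>is_weak_curl \<Omega> u e\<close> test_vec_axis[OF that, of i]
      unfolding is_weak_curl_def l2_inner_axis[symmetric] by auto
  qed (use that in \<open>auto simp: is_weak_curl_def\<close>)
qed (auto simp: weak_curl_def is_weak_curl_def)

lemma grad_test_L2: "\<phi> \<in> test \<Omega> \<Longrightarrow> grad \<phi> \<in> L2 \<Omega>"
  by (intro L2_componentsI) (simp add: component_grad test_L2 test_partial)

sublocale div: weak_operator \<Omega> "is_weak_div \<Omega>" "weak_div \<Omega>"
proof
  note tl = test_L2 grad_test_L2 subspace_add[OF sc.subspace] subspace_scale[OF sc.subspace]
  show "is_weak_div \<Omega> (u + v) (d + e)"
    if "u \<in> L2 \<Omega>" "v \<in> L2 \<Omega>" "is_weak_div \<Omega> u d" "is_weak_div \<Omega> v e" for u v d e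
    using that unfolding is_weak_div_def by (simp add: tl ve.add_l sc.add_l)
  show "is_weak_div \<Omega> (c *\<^sub>R u) (c *\<^sub>R d)" if "u \<in> L2 \<Omega>" "is_weak_div \<Omega> u d" for u c d
    using that unfolding is_weak_div_def by (simp add: tl ve.scale_l sc.scale_l)
  show "is_weak_div \<Omega> 0 0"
    using subspace_0[OF sc.subspace] by (simp add: is_weak_div_def l2_inner_def)
  show "ae_eq \<Omega> d e" if "is_weak_div \<Omega> u d" "is_weak_div \<Omega> u e" for u d e
    using that unfolding is_weak_div_def by (intro fundamental_eq) auto
qed (auto simp: weak_div_def is_weak_div_def)

lemma H1_eq: "H1 \<Omega> = grad.dom" and Hcurl_eq: "Hcurl \<Omega> = curl.dom" and Hdiv_eq: "Hdiv \<Omega> = div.dom"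
  by (simp_all add: H1_def grad.dom_def Hcurl_def curl.dom_def Hdiv_def div.dom_def)

section \<open>Poincare inequality and transport terms\<close>

sublocale h1: semi_inner_space "H1 \<Omega>" "\<lambda>u v. l2_inner \<Omega> (weak_grad \<Omega> u) (weak_grad \<Omega> v)"
  unfolding H1_eq by unfold_locales (rule grad.subspace_dom grad.semi_inner_Op)+

lemma H1_L2: "u \<in> H1 \<Omega> \<Longrightarrow> u \<in> L2 \<Omega>" by (simp add: H1_def)

lemma weak_grad_L2: "u \<in> H1 \<Omega> \<Longrightarrow> weak_grad \<Omega> u \<in> L2 \<Omega>"
  unfolding H1_eq by (rule grad.Op_L2)

text \<open>The product of two test functions is a test function, so its partial derivatives
  integrate to zero; the product rule turns this into integration by parts.\<close>

lemma test_weak_grad: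
  assumes phi: "\<phi> \<in> test \<Omega>"
  shows "is_weak_grad \<Omega> \<phi> (grad \<phi>)"
  unfolding is_weak_grad_def component_grad
proof (intro conjI ballI allI grad_test_L2 phi)
  fix \<psi> i assume psi: "\<psi> \<in> test \<Omega>"
  note l = test_L2[OF phi] test_L2[OF psi] test_L2[OF test_partial[OF phi]] test_L2[OF test_partial[OF psi]]
  have "0 = (LINT x|M. partial i (\<lambda>x. \<phi> x * \<psi> x) x)"
    using integral_partial[OF test_mult[OF psi test_smooth[OF phi]]] by simp
  also have "\<dots> = (LINT x|M. \<phi> x \<bullet> partial i \<psi> x + partial i \<phi> x \<bullet> \<psi> x)"
    using phi psi by (simp add: partial_mult smooth_differentiable[OF test_smooth])
  also have "\<dots> = l2_inner \<Omega> \<phi> (partial i \<psi>) + l2_inner \<Omega> (partial i \<phi>) \<psi>"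
    unfolding l2_inner_eq by (rule Bochner_Integration.integral_add) (intro L2_integrable_inner l)+
  finally show "l2_inner \<Omega> \<phi> (partial i \<psi>) = - l2_inner \<Omega> (partial i \<phi>) \<psi>" by simp
qed

lemma test_H1: "\<phi> \<in> test \<Omega> \<Longrightarrow> \<phi> \<in> H1 \<Omega>"
  unfolding H1_eq by (rule grad.domI[OF test_L2 test_weak_grad])

lemma test_grad_eq: "\<phi> \<in> test \<Omega> \<Longrightarrow> ae_eq \<Omega> (weak_grad \<Omega> \<phi>) (grad \<phi>)"
  using grad.Op_eq[OF _ test_weak_grad] test_H1 unfolding H1_eq by blast

text \<open>Integrate \<open>\<partial>\<^sub>1 (x\<^sub>1 \<phi>\<^sup>2)\<close>.\<close>

lemma poincare_test:
  obtains C where "C \<ge> 0" "\<And>\<phi>. \<phi> \<in> test \<Omega> \<Longrightarrow> sc.nrm \<phi> \<le> C * h1.nrm \<phi>"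
proof -
  have "(\<lambda>x::real^3. x $ 1) \<in> Linf" by (intro smooth_Linf smooth_coord)
  then obtain R where R: "R \<ge> 0" "AE x in M. norm (x $ 1) \<le> R" by (rule LinfE)
  show thesis
  proof (rule that[of "2 * R"])
    fix \<phi> assume phi: "\<phi> \<in> test \<Omega>"
    \<comment> \<open>The derivative of \<open>x\<^sub>1 \<phi>\<^sup>2\<close> is
      \<open>\<phi>\<^sup>2 + 2 \<phi> \<eta>\<close>, and the length of \<eta> is at most
      \<open>R\<close> times that of the gradient. Cauchy-Schwarz then gives the constant 2
      R.\<close>
    define \<eta> where "\<eta> = (\<lambda>x. x $ 1 * partial 1 \<phi> x)"
    have eta: "\<eta> \<in> test \<Omega>" unfolding \<eta>_def by (intro test_mult test_partial phi smooth_coord)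
    note l = test_L2[OF phi] test_L2[OF eta]
    have "AE x in M. norm (\<eta> x) \<le> R * norm (grad \<phi> x)"
      using R(2)
    proof eventually_elim
      case (elim x)
      have "\<bar>partial 1 \<phi> x\<bar> \<le> norm (grad \<phi> x)" using component_le_norm_cart[of "grad \<phi> x" 1] by (simp add: grad_def)
      then show ?case using elim R(1) unfolding \<eta>_def by (simp add: abs_mult) (intro mult_mono, auto)
    qed
    then have "sc.nrm \<eta> \<le> R * ve.nrm (grad \<phi>)"
      unfolding sc.nrm_def ve.nrm_def
      by (intro L2_bounded_by(2) grad_test_L2 phi L2_measurable l R(1))
    also have "ve.nrm (grad \<phi>) = h1.nrm \<phi>"
      unfolding ve.nrm_def h1.nrm_def
      using l2_inner_cong[OF _ _ _ _ test_grad_eq[OF phi] test_grad_eq[OF phi]]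
        grad_test_L2[OF phi] weak_grad_L2[OF test_H1[OF phi]] by simp
    finally have eb: "sc.nrm \<eta> \<le> R * h1.nrm \<phi>" .
    have sq: "(\<lambda>x. x $ 1 * \<phi> x) \<in> test \<Omega>" by (intro test_mult phi smooth_coord)
    have "0 = (LINT x|M. partial 1 (\<lambda>x. \<phi> x * (x $ 1 * \<phi> x)) x)"
      using integral_partial[OF test_mult[OF sq test_smooth[OF phi]]] by simp
    also have "\<dots> = (LINT x|M. \<phi> x \<bullet> \<phi> x + 2 * (\<phi> x \<bullet> \<eta> x))"
    proof (rule arg_cong[where f="integral\<^sup>L M"], rule ext)
      fix x
      have d: "\<phi> differentiable (at x)" "(\<lambda>x::real^3. x $ 1) differentiable (at x)"
        using smooth_differentiable test_smooth[OF phi] smooth_coord by blast+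
      then have "partial 1 (\<lambda>x. x $ 1 * \<phi> x) x = x $ 1 * partial 1 \<phi> x + \<phi> x"
        by (simp add: partial_mult partial_coord)
      moreover have "partial 1 (\<lambda>x. \<phi> x * (x $ 1 * \<phi> x)) x =
          \<phi> x * partial 1 (\<lambda>x. x $ 1 * \<phi> x) x + partial 1 \<phi> x * (x $ 1 * \<phi> x)"
        using d by (intro partial_mult differentiable_mult)
      ultimately show "partial 1 (\<lambda>x. \<phi> x * (x $ 1 * \<phi> x)) x = \<phi> x \<bullet> \<phi> x + 2 * (\<phi> x \<bullet> \<eta> x)"
        by (simp add: \<eta>_def algebra_simps)
    qed
    also have "\<dots> = l2_inner \<Omega> \<phi> \<phi> + 2 * l2_inner \<Omega> \<phi> \<eta>"
      unfolding l2_inner_eq using L2_integrable_inner[OF l(1,1)] L2_integrable_inner[OF l]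
      by (subst Bochner_Integration.integral_add) auto
    finally have "sc.nrm \<phi> * sc.nrm \<phi> = - 2 * l2_inner \<Omega> \<phi> \<eta>"
      using sc.nrm_sq[OF l(1)] by (simp add: power2_eq_square)
    also have "\<dots> \<le> 2 * (sc.nrm \<phi> * sc.nrm \<eta>)" using sc.cauchy_schwarz[OF l] by linarith
    also have "\<dots> \<le> 2 * (sc.nrm \<phi> * (R * h1.nrm \<phi>))"
      using eb sc.nrm_nonneg[OF l(1)] by (intro mult_left_mono) auto
    finally have "sc.nrm \<phi> * sc.nrm \<phi> \<le> sc.nrm \<phi> * (2 * R * h1.nrm \<phi>)" by (simp add: algebra_simps)
    then show "sc.nrm \<phi> \<le> 2 * R * h1.nrm \<phi>"
      using sc.nrm_nonneg[OF l(1)] h1.nrm_nonneg[OF test_H1[OF phi]] R(1)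
      by (cases "sc.nrm \<phi> = 0") auto
  qed (use R in simp)
qed

lemma H10_approx:
  assumes "u \<in> H10 \<Omega>"
  obtains \<phi> where "\<And>n::nat. \<phi> n \<in> test \<Omega>" "(\<lambda>n. sc.nrm (\<phi> n - u)) \<longlonglongrightarrow> 0" "(\<lambda>n. h1.nrm (\<phi> n - u)) \<longlonglongrightarrow> 0"
proof -
  obtain \<phi> where u: "u \<in> H1 \<Omega>" and phi: "\<And>n::nat. \<phi> n \<in> test \<Omega>"
    and lim: "(\<lambda>n. h1_norm \<Omega> (\<lambda>x. u x - \<phi> n x)) \<longlonglongrightarrow> 0" using assms by (auto simp: H10_def)
  have d: "u - \<phi> n \<in> H1 \<Omega>" for n using u test_H1[OF phi] h1.subspace by (auto intro: subspace_diff)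
  have eq: "h1_norm \<Omega> (\<lambda>x. u x - \<phi> n x) = sqrt ((sc.nrm (u - \<phi> n))\<^sup>2 + (h1.nrm (u - \<phi> n))\<^sup>2)" for n
    by (simp add: h1_norm_def l2_norm_def sc.nrm_def h1.nrm_def fun_diff_def)
  have swap: "sc.nrm (\<phi> n - u) = sc.nrm (u - \<phi> n)" "h1.nrm (\<phi> n - u) = h1.nrm (u - \<phi> n)" for n
    using sc.nrm_scale[of "u - \<phi> n" "-1"] h1.nrm_scale[of "u - \<phi> n" "-1"] d[of n] H1_L2 by auto
  have "(\<lambda>n. sc.nrm (\<phi> n - u)) \<longlonglongrightarrow> 0"
    by (rule Lim_null_comparison[OF always_eventually lim])
      (auto simp: swap eq H1_L2 d)
  moreover have "(\<lambda>n. h1.nrm (\<phi> n - u)) \<longlonglongrightarrow> 0"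
    by (rule Lim_null_comparison[OF always_eventually lim])
      (auto simp: swap eq d real_le_rsqrt)
  ultimately show thesis using that phi by blast
qed

text \<open>Density carries the Poincare inequality from test functions to H10. Its consequence for
  null functions is enough, since finite dimension turns that into an estimate.\<close>

lemma poincare_null:
  assumes u: "u \<in> H10 \<Omega>" and z: "h1.nrm u = 0"
  shows "sc.nrm u = 0"
proof -
  obtain \<phi> where phi: "\<And>n::nat. \<phi> n \<in> test \<Omega>"
    and lim: "(\<lambda>n. sc.nrm (\<phi> n - u)) \<longlonglongrightarrow> 0" "(\<lambda>n. h1.nrm (\<phi> n - u)) \<longlonglongrightarrow> 0" using H10_approx[OF u] by blast
  obtain C where C: "C \<ge> 0" "\<And>\<phi>. \<phi> \<in> test \<Omega> \<Longrightarrow> sc.nrm \<phi> \<le> C * h1.nrm \<phi>" using poincare_test by blast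
  have uH: "u \<in> H1 \<Omega>" using u by (simp add: H10_def)
  note m = uH H1_L2[OF uH] test_H1[OF phi] test_L2[OF phi]
  have "sc.nrm u \<le> C * h1.nrm (\<phi> n - u) + sc.nrm (\<phi> n - u)" for n
  proof -
    have "sc.nrm u \<le> sc.nrm (\<phi> n) + sc.nrm (u - \<phi> n)" using m by (intro sc.nrm_triangle_diff)
    moreover have "sc.nrm (u - \<phi> n) = sc.nrm (\<phi> n - u)"
      using sc.nrm_scale[of "\<phi> n - u" "-1"] m subspace_diff[OF sc.subspace] by simp
    moreover have "sc.nrm (\<phi> n) \<le> C * h1.nrm (\<phi> n)" by (rule C(2)[OF phi])
    moreover have "h1.nrm (\<phi> n) \<le> h1.nrm u + h1.nrm (\<phi> n - u)" using m by (intro h1.nrm_triangle_diff)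
    then have "C * h1.nrm (\<phi> n) \<le> C * h1.nrm (\<phi> n - u)" using z C(1) by (intro mult_left_mono) auto
    ultimately show ?thesis by linarith
  qed
  moreover have "(\<lambda>n. C * h1.nrm (\<phi> n - u) + sc.nrm (\<phi> n - u)) \<longlonglongrightarrow> C * 0 + 0"
    by (intro tendsto_intros lim)
  ultimately have "sc.nrm u \<le> 0" by (intro LIMSEQ_le_const[of _ 0]) auto
  then show ?thesis using sc.nrm_nonneg[OF m(2)] by simp
qed

lemma transport_L2: "w \<in> Linf \<Longrightarrow> u \<in> H1 \<Omega> \<Longrightarrow> (\<lambda>x. w x \<bullet> weak_grad \<Omega> u x) \<in> L2 \<Omega>"
  using L2_inner_Linf[of w] weak_grad_L2 by metis

lemma transport_bilin:
  assumes w: "w \<in> Linf"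
  shows "bilin (H1 \<Omega>) (L2 \<Omega>) (\<lambda>u v. l2_inner \<Omega> (\<lambda>x. w x \<bullet> weak_grad \<Omega> u x) v)"
  unfolding bilin_def
proof (intro conjI ballI)
  show "lin_on (L2 \<Omega>) (\<lambda>v. l2_inner \<Omega> (\<lambda>x. w x \<bullet> weak_grad \<Omega> u x) v)" if "u \<in> H1 \<Omega>" for u
    using bilinD1[OF sc.bilin transport_L2[OF w that]] .
  fix v :: scalar_fun assume v: "v \<in> L2 \<Omega>"
  have H: "H1 \<Omega> = grad.dom" by (rule H1_eq)
  show "lin_on (H1 \<Omega>) (\<lambda>u. l2_inner \<Omega> (\<lambda>x. w x \<bullet> weak_grad \<Omega> u x) v)"
    unfolding lin_on_def
  proof (intro conjI ballI allI)
    fix u u' :: scalar_fun and c :: real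
    assume u: "u \<in> H1 \<Omega>"
    have "ae_eq \<Omega> (\<lambda>x. w x \<bullet> weak_grad \<Omega> (c *\<^sub>R u) x) (c *\<^sub>R (\<lambda>x. w x \<bullet> weak_grad \<Omega> u x))"
      using grad.Op_scale[of u c] u unfolding H ae_eq_iff by (auto elim!: eventually_mono)
    then show "l2_inner \<Omega> (\<lambda>x. w x \<bullet> weak_grad \<Omega> (c *\<^sub>R u) x) v = c * l2_inner \<Omega> (\<lambda>x. w x \<bullet> weak_grad \<Omega> u x) v"
      using l2_inner_cong[OF transport_L2[OF w subspace_scale[OF h1.subspace u, of c]] v
          subspace_scale[OF sc.subspace transport_L2[OF w u], of c] v _ grad.ae_eq_refl]
        sc.scale_l[OF v transport_L2[OF w u], of c] by simp
    assume u': "u' \<in> H1 \<Omega>"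
    have "ae_eq \<Omega> (\<lambda>x. w x \<bullet> weak_grad \<Omega> (u + u') x) ((\<lambda>x. w x \<bullet> weak_grad \<Omega> u x) + (\<lambda>x. w x \<bullet> weak_grad \<Omega> u' x))"
      using grad.Op_add[of u u'] u u' unfolding H ae_eq_iff by (auto elim!: eventually_mono simp: inner_simps)
    then show "l2_inner \<Omega> (\<lambda>x. w x \<bullet> weak_grad \<Omega> (u + u') x) v =
        l2_inner \<Omega> (\<lambda>x. w x \<bullet> weak_grad \<Omega> u x) v + l2_inner \<Omega> (\<lambda>x. w x \<bullet> weak_grad \<Omega> u' x) v"
      using l2_inner_cong[OF transport_L2[OF w subspace_add[OF h1.subspace u u']] v
          subspace_add[OF sc.subspace transport_L2[OF w u] transport_L2[OF w u']] v _ grad.ae_eq_refl]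
        sc.add_l[OF v transport_L2[OF w u] transport_L2[OF w u']] by simp
  qed
qed

text \<open>For a test function the integrand is half of \<open>w\<close> against the gradient of
  \<open>\<phi>\<^sup>2\<close>, and this integrates to zero because the weak divergence of
  \<open>w\<close> vanishes. Boundedness of \<open>w\<close> makes the form continuous on H1 times
  L2, so the identity passes to H10.\<close>

lemma transport_skew:
  assumes w: "w \<in> Linf" and div: "w \<in> Hdiv \<Omega>" "ae_eq \<Omega> (weak_div \<Omega> w) (\<lambda>x. 0)" and u: "u \<in> H10 \<Omega>"
  shows "l2_inner \<Omega> (\<lambda>x. w x \<bullet> weak_grad \<Omega> u x) u = 0"
proof -
  obtain \<phi> where phi: "\<And>n::nat. \<phi> n \<in> test \<Omega>"
    and lim: "(\<lambda>n. sc.nrm (\<phi> n - u)) \<longlonglongrightarrow> 0" "(\<lambda>n. h1.nrm (\<phi> n - u)) \<longlonglongrightarrow> 0" using H10_approx[OF u] by blast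
  have uH: "u \<in> H1 \<Omega>" using u by (simp add: H10_def)
  obtain C where C: "C \<ge> 0" "\<And>G. G \<in> L2 \<Omega> \<Longrightarrow> (\<lambda>x. w x \<bullet> G x) \<in> L2 \<Omega> \<and>
      sqrt (l2_inner \<Omega> (\<lambda>x. w x \<bullet> G x) (\<lambda>x. w x \<bullet> G x)) \<le> C * sqrt (l2_inner \<Omega> G G)"
    by (rule L2_inner_Linf[OF w]) blast
  let ?\<beta> = "\<lambda>u v. l2_inner \<Omega> (\<lambda>x. w x \<bullet> weak_grad \<Omega> u x) v"
  have "(\<lambda>n. ?\<beta> (\<phi> n) (\<phi> n)) \<longlonglongrightarrow> ?\<beta> u u"
  proof (rule bounded_bilin_tendsto[OF h1.semi_inner_space_axioms sc.semi_inner_space_axioms transport_bilin[OF w]])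
    fix x y :: scalar_fun assume x: "x \<in> H1 \<Omega>" and y: "y \<in> L2 \<Omega>"
    have "\<bar>?\<beta> x y\<bar> \<le> sc.nrm (\<lambda>z. w z \<bullet> weak_grad \<Omega> x z) * sc.nrm y"
      by (rule sc.cauchy_schwarz[OF transport_L2[OF w x] y])
    also have "\<dots> \<le> (C * h1.nrm x) * sc.nrm y"
      using C(2)[OF weak_grad_L2[OF x]] sc.nrm_nonneg[OF y]
      by (intro mult_right_mono) (auto simp: sc.nrm_def h1.nrm_def)
    finally show "\<bar>?\<beta> x y\<bar> \<le> C * h1.nrm x * sc.nrm y" .
  qed (use phi test_H1 test_L2 uH H1_L2 lim in auto)
  moreover have "?\<beta> \<phi> \<phi> = 0" if "\<phi> \<in> test \<Omega>" for \<phi>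
  proof -
    have sq: "(\<lambda>x. \<phi> x * \<phi> x) \<in> test \<Omega>" by (intro test_mult test_smooth[OF that] that)
    have g: "grad (\<lambda>x. \<phi> x * \<phi> x) = (\<lambda>x. (2 * \<phi> x) *\<^sub>R grad \<phi> x)"
      using smooth_differentiable[OF test_smooth[OF that]]
      by (auto simp: grad_def fun_eq_iff vec_eq_iff partial_mult)
    have wL: "w \<in> L2 \<Omega>" "weak_div \<Omega> w \<in> L2 \<Omega>" "is_weak_div \<Omega> w (weak_div \<Omega> w)"
      using div(1) unfolding Hdiv_eq by (rule div.dom_L2 div.Op_L2 div.Op_works)+
    have "l2_inner \<Omega> w (grad (\<lambda>x. \<phi> x * \<phi> x)) = - l2_inner \<Omega> (weak_div \<Omega> w) (\<lambda>x. \<phi> x * \<phi> x)"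
      using wL(3) sq by (auto simp: is_weak_div_def)
    also have "l2_inner \<Omega> (weak_div \<Omega> w) (\<lambda>x. \<phi> x * \<phi> x) = 0"
      using sc.null[OF wL(2) test_L2[OF sq]] l2_null_iff[OF wL(2)] div(2) by simp
    finally have "0 = l2_inner \<Omega> w (\<lambda>x. (2 * \<phi> x) *\<^sub>R grad \<phi> x)" by (simp add: g)
    also have "\<dots> = (LINT x|M. 2 * ((w x \<bullet> grad \<phi> x) * \<phi> x))"
      unfolding l2_inner_eq by (simp add: mult_ac)
    also have "\<dots> = 2 * l2_inner \<Omega> (\<lambda>x. w x \<bullet> grad \<phi> x) \<phi>" by (simp add: l2_inner_eq)
    also have "l2_inner \<Omega> (\<lambda>x. w x \<bullet> grad \<phi> x) \<phi> = ?\<beta> \<phi> \<phi>"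
    proof (rule l2_inner_cong)
      show "ae_eq \<Omega> (\<lambda>x. w x \<bullet> grad \<phi> x) (\<lambda>x. w x \<bullet> weak_grad \<Omega> \<phi> x)"
        using test_grad_eq[OF that] unfolding ae_eq_iff by eventually_elim simp
    qed (use that C(2) grad_test_L2 test_L2 transport_L2[OF w test_H1] grad.ae_eq_refl in auto)
    finally show ?thesis by simp
  qed
  ultimately show ?thesis using phi by (simp add: LIMSEQ_const_iff)
qed

text \<open>A polynomial is bounded on a compact cell, and the cell interiors cover \<Omega> up to
  the cell boundaries, which are negligible because cells are convex.\<close>

lemma fe_space_Linf:
  assumes "mesh \<Omega> \<T>" "fe_space \<T> V" "v \<in> V" "v \<in> L2 \<Omega>"
  shows "v \<in> Linf"
proof -
  have T: "finite \<T>" "\<And>K. K \<in> \<T> \<Longrightarrow> polytope K" "\<Union>\<T> = closure \<Omega>" using assms(1) by (auto simp: mesh_def)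
  have "\<forall>K\<in>\<T>. \<exists>C\<ge>0. \<forall>x\<in>interior K. norm (v x) \<le> C"
  proof
    fix K assume K: "K \<in> \<T>"
    have "\<forall>v\<in>V. \<forall>K\<in>\<T>. \<exists>p. polynomial_function p \<and> (\<forall>x\<in>interior K. v x = p x)"
      using assms(2) unfolding fe_space_def by (rule conjunct2)
    from this[rule_format, OF assms(3) K] obtain p
      where p: "polynomial_function p" "\<And>x. x \<in> interior K \<Longrightarrow> v x = p x" by auto
    have "bounded (p ` K)"
      using p(1) T(2)[OF K] by (intro compact_imp_bounded compact_continuous_image
          continuous_on_polymonial_function polytope_imp_compact)
    then obtain C where C: "\<And>x. x \<in> K \<Longrightarrow> norm (p x) \<le> C" by (auto simp: bounded_iff)
    have "norm (v x) \<le> max C 0" if "x \<in> interior K" for x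
      using C[of x] p(2)[OF that] that interior_subset by fastforce
    then show "\<exists>C\<ge>0. \<forall>x\<in>interior K. norm (v x) \<le> C" by (intro exI[of _ "max C 0"]) auto
  qed
  then obtain C where C: "\<And>K. K \<in> \<T> \<Longrightarrow> C K \<ge> 0" "\<And>K x. K \<in> \<T> \<Longrightarrow> x \<in> interior K \<Longrightarrow> norm (v x) \<le> C K"
    by metis
  have "negligible (\<Union>K\<in>\<T>. frontier K)"
    using T by (intro negligible_Union) (auto intro: negligible_convex_frontier polytope_imp_convex)
  then have "AE x in lebesgue. x \<notin> (\<Union>K\<in>\<T>. frontier K)"
    unfolding negligible_iff_null_sets by (rule AE_not_in)
  then have "AE x in lebesgue. x \<in> \<Omega> \<longrightarrow> norm (v x) \<le> sum C \<T>"
  proof eventually_elim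
    case (elim x)
    show ?case
    proof
      assume "x \<in> \<Omega>"
      then obtain K where K: "K \<in> \<T>" "x \<in> K" using T(3) closure_subset by blast
      then have "x \<in> interior K" using elim closure_subset[of K] by (auto simp: frontier_def)
      then have "norm (v x) \<le> C K" using C(2) K by blast
      also have "\<dots> \<le> sum C \<T>" using member_le_sum[of K \<T> C] K C(1) T(1) by auto
      finally show "norm (v x) \<le> sum C \<T>" .
    qed
  qed
  then have "AE x in M. norm (v x) \<le> sum C \<T>" by (simp add: AE_restrict_space_iff[OF dom_sets'])
  then show ?thesis using L2_measurable[OF assms(4)] by (auto simp: Linf_def)
qed

end

lemma sum_fun_apply: "(\<Sum>i\<in>I. f i) x = (\<Sum>i\<in>I. f i x)"
  by (induction I rule: infinite_finite_induct) auto

lemma fe_space_fin_dim: "fe_space \<T> V \<Longrightarrow> fin_dim V"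
proof -
  assume "fe_space \<T> V"
  then obtain B where B: "finite B" "V = {(\<lambda>x. \<Sum>b\<in>B. c b *\<^sub>R b x) | c. True}"
    unfolding fe_space_def by blast
  have "V = span B"
    unfolding B(2) span_finite[OF B(1)] by (auto simp: fun_eq_iff sum_fun_apply image_iff)
  then show ?thesis using B(1) by (auto simp: fin_dim_def)
qed

context bounded_domain
begin

lemma l2_norm_sq: "(l2_norm \<Omega> f)\<^sup>2 = l2_inner \<Omega> f f"
  by (simp add: l2_norm_def l2_inner_eq)

lemma H10_vecD:
  assumes "v \<in> H10_vec \<Omega>"
  shows "component v i \<in> H10 \<Omega>" "component v i \<in> H1 \<Omega>" "component v i \<in> L2 \<Omega>" "v \<in> L2 \<Omega>"
proof -
  show *: "component v i \<in> H10 \<Omega>" "component v i \<in> H1 \<Omega>" "component v i \<in> L2 \<Omega>" for i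
    using assms by (auto simp: H10_vec_def H10_def H1_def)
  show "v \<in> L2 \<Omega>" by (intro L2_componentsI *)
qed

text \<open>The trace of the weak Jacobian is a weak divergence.\<close>

lemma H10_vec_Hdiv:
  assumes v: "v \<in> H10_vec \<Omega>"
  shows "v \<in> Hdiv \<Omega>"
proof -
  let ?G = "\<lambda>i. component (weak_grad \<Omega> (component v i)) i"
  have G: "?G i \<in> L2 \<Omega>" for i by (intro component_L2 weak_grad_L2 H10_vecD[OF v])
  have wg: "is_weak_grad \<Omega> (component v i) (weak_grad \<Omega> (component v i))" for i
    using H10_vecD(2)[OF v] unfolding H1_eq by (rule grad.Op_works)
  have "is_weak_div \<Omega> v (\<Sum>i\<in>UNIV. ?G i)"
    unfolding is_weak_div_def
  proof (intro conjI ballI)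
    show "(\<Sum>i\<in>UNIV. ?G i) \<in> L2 \<Omega>" by (intro subspace_sum[OF sc.subspace] G)
    fix \<phi> assume phi: "\<phi> \<in> test \<Omega>"
    have "l2_inner \<Omega> v (grad \<phi>) = (\<Sum>i\<in>UNIV. l2_inner \<Omega> (component v i) (partial i \<phi>))"
      using l2_inner_components[OF H10_vecD(4)[OF v] grad_test_L2[OF phi]] by (simp add: component_grad)
    also have "\<dots> = (\<Sum>i\<in>UNIV. - l2_inner \<Omega> (?G i) \<phi>)"
      using wg phi by (intro sum.cong) (auto simp: is_weak_grad_def)
    also have "\<dots> = - l2_inner \<Omega> (\<Sum>i\<in>UNIV. ?G i) \<phi>"
      by (simp add: sum_negf lin_on_sum[OF bilinD2[OF sc.bilin test_L2[OF phi]] sc.subspace G])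
    finally show "l2_inner \<Omega> v (grad \<phi>) = - l2_inner \<Omega> (\<Sum>i\<in>UNIV. ?G i) \<phi>" .
  qed
  then show ?thesis using H10_vecD(4)[OF v] by (auto simp: Hdiv_def)
qed

lemma l2_null_left: "f \<in> L2 \<Omega> \<Longrightarrow> g \<in> L2 \<Omega> \<Longrightarrow> ae_eq \<Omega> f (\<lambda>x. 0) \<Longrightarrow> l2_inner \<Omega> f g = 0"
  for f g :: "real^3 \<Rightarrow> 'b::euclidean_space"
  using semi_inner_space.null[OF l2_space] l2_null_iff by blast

lemma ae_eq_sym: "ae_eq \<Omega> f g \<Longrightarrow> ae_eq \<Omega> g f"
  unfolding ae_eq_def by (auto elim!: eventually_mono)

lemma l2_inner_cong_right:
  fixes f :: "real^3 \<Rightarrow> 'b::euclidean_space"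
  assumes "f \<in> Linf" "g \<in> Linf" "h \<in> Linf" "ae_eq \<Omega> g h"
  shows "l2_inner \<Omega> f g = l2_inner \<Omega> f h"
  using assms by (intro l2_inner_cong Linf_L2) (auto simp: ae_eq_def)

lemma convection_component: "component (convection \<Omega> w u) i = (\<lambda>x. w x \<bullet> weak_grad \<Omega> (component u i) x)"
  by (simp add: component_def convection_def fun_eq_iff)

lemma convection_L2: "w \<in> Linf \<Longrightarrow> (\<And>i. component u i \<in> H1 \<Omega>) \<Longrightarrow> convection \<Omega> w u \<in> L2 \<Omega>"
  by (intro L2_componentsI) (simp add: convection_component transport_L2)

lemma convection_inner:
  assumes "w \<in> Linf" "\<And>i. component u i \<in> H1 \<Omega>" "v \<in> L2 \<Omega>"
  shows "l2_inner \<Omega> (convection \<Omega> w u) v =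
    (\<Sum>i\<in>UNIV. l2_inner \<Omega> (\<lambda>x. w x \<bullet> weak_grad \<Omega> (component u i) x) (component v i))"
  using l2_inner_components[OF convection_L2[OF assms(1,2)] assms(3)] by (simp add: convection_component)

end

section \<open>The discretised equations\<close>

locale mhd_discretisation = bounded_domain +
  fixes \<T> :: "(real^3) set set" and Hg Lh Q :: "scalar_fun set" and Hc Hd V :: "vector_fun set"
    and S RH :: real and f :: "3 \<Rightarrow> scalar_fun \<Rightarrow> real"
  assumes mesh: "mesh \<Omega> \<T>"
    and fe_spaces: "fe_space \<T> Hc" "fe_space \<T> Hd" "fe_space \<T> V" "fe_space \<T> Q"
    and conforming: "Hc \<subseteq> H0curl \<Omega>" "Hd \<subseteq> H0div \<Omega>" "V \<subseteq> H10_vec \<Omega>" "Q \<subseteq> L20 \<Omega>"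
    and de_rham: "exact_de_rham \<Omega> Hg Hc Hd Lh"
    and stokes: "inf_sup_stable \<Omega> V Q" "exactly_incompressible \<Omega> V Q"
    and params: "S > 0" "RH \<ge> 0"
    and force: "\<forall>i. f i \<in> Hm1 \<Omega>"
begin

section \<open>Verification of the abstract hypotheses\<close>

lemma Q_L2: "q \<in> Q \<Longrightarrow> q \<in> L2 \<Omega>" using conforming by (auto simp: L20_def)
lemma Hc_Hcurl: "F \<in> Hc \<Longrightarrow> F \<in> curl.dom" using conforming by (auto simp: H0curl_def Hcurl_eq)
lemma Hd_Hdiv: "B \<in> Hd \<Longrightarrow> B \<in> div.dom" using conforming by (auto simp: H0div_def Hdiv_eq)
lemma V_H10: "v \<in> V \<Longrightarrow> v \<in> H10_vec \<Omega>" using conforming by auto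
lemma V_Hdiv: "v \<in> V \<Longrightarrow> v \<in> div.dom" using H10_vec_Hdiv V_H10 by (simp add: Hdiv_eq)

lemma V_Linf: "v \<in> V \<Longrightarrow> v \<in> Linf"
  using fe_space_Linf[OF mesh fe_spaces(3)] V_H10 H10_vecD(4) by blast
lemma Hc_Linf: "F \<in> Hc \<Longrightarrow> F \<in> Linf"
  using fe_space_Linf[OF mesh fe_spaces(1)] Hc_Hcurl curl.dom_L2 by blast
lemma Hd_Linf: "B \<in> Hd \<Longrightarrow> B \<in> Linf"
  using fe_space_Linf[OF mesh fe_spaces(2)] Hd_Hdiv div.dom_L2 by blast

lemmas sub_V = fin_dim_subspace[OF fe_space_fin_dim[OF fe_spaces(3)]]

lemma rot_Hd: "F \<in> Hc \<Longrightarrow> \<exists>C\<in>Hd. ae_eq \<Omega> C (weak_curl \<Omega> F)"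
  using de_rham unfolding exact_de_rham_def by blast

text \<open>The de Rham sequence puts a representative of the curl into \<open>Hd\<close>, whose
  members are bounded; the chosen \<open>weak_curl\<close> differs from it only on a null
  set.\<close>

lemma weak_curl_Linf: "F \<in> Hc \<Longrightarrow> weak_curl \<Omega> F \<in> Linf"
  using rot_Hd[of F] curl.Op_L2[OF Hc_Hcurl] by (auto intro: Linf_cong Hd_Linf L2_measurable ae_eq_sym)

lemma grad_inner_eq: "grad_inner \<Omega> = (\<lambda>u v. \<Sum>i\<in>UNIV. l2_inner \<Omega> (weak_grad \<Omega> (component u i)) (weak_grad \<Omega> (component v i)))"
  by (intro ext) (simp add: grad_inner_def)

lemma semi_inner_V: "semi_inner V (grad_inner \<Omega>)"
  unfolding grad_inner_eq
proof (rule semi_inner_sum)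
  fix i
  show "semi_inner V (\<lambda>u v. l2_inner \<Omega> (weak_grad \<Omega> (component u i)) (weak_grad \<Omega> (component v i)))"
    using h1.semi_inner V_H10 H10_vecD(2) sub_V
    unfolding semi_inner_def bilin_def lin_on_def
    by (auto simp: component_add component_scale)
qed

lemma grad_null:
  assumes "v \<in> V" "grad_inner \<Omega> v v = 0"
  shows "h1.nrm (component v i) = 0" "sc.nrm (component v i) = 0"
proof -
  have m: "component v i \<in> H1 \<Omega>" "component v i \<in> H10 \<Omega>" for i using H10_vecD V_H10 assms by blast+
  have "(\<Sum>i\<in>UNIV. (h1.nrm (component v i))\<^sup>2) = 0"
    using assms(2) by (simp add: grad_inner_def h1.nrm_sq m)
  then show "h1.nrm (component v i) = 0" by (simp add: sum_nonneg_eq_0_iff)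
  then show "sc.nrm (component v i) = 0" using poincare_null m by blast
qed

lemma grad_null_ae:
  assumes "v \<in> V" "grad_inner \<Omega> v v = 0"
  shows "ae_eq \<Omega> v (\<lambda>x. 0)" "ae_eq \<Omega> (weak_grad \<Omega> (component v i)) (\<lambda>x. 0)"
proof -
  note H = H10_vecD[OF V_H10[OF assms(1)]]
  have "ae_eq \<Omega> (component v i) (component (\<lambda>x. 0) i)" for i
    using grad_null(2)[OF assms, of i] l2_null_iff[OF H(3), of i] sc.nrm_sq[OF H(3), of i]
    by (simp add: component_def[abs_def])
  then show "ae_eq \<Omega> v (\<lambda>x. 0)" by (rule ae_eq_components)
  show "ae_eq \<Omega> (weak_grad \<Omega> (component v i)) (\<lambda>x. 0)"
    using grad_null(1)[OF assms, of i] l2_null_iff[OF weak_grad_L2[OF H(2)], of i] h1.nrm_sq[OF H(2), of i] by simp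
qed

text \<open>For \<open>q\<close> of nonzero norm the inner supremum would run over zeros and be at
  most 0, contradicting the positive infimum.\<close>

lemma inf_sup:
  assumes q: "q \<in> Q" and z: "\<And>v. v \<in> V \<Longrightarrow> l2_inner \<Omega> (weak_div \<Omega> v) q = 0"
  shows "l2_inner \<Omega> q q = 0"
proof (rule ccontr)
  assume "l2_inner \<Omega> q q \<noteq> 0"
  then have "q \<in> {q\<in>Q. l2_norm \<Omega> q \<noteq> 0}" using q l2_norm_sq[of q] by auto
  then have "(INF q\<in>{q\<in>Q. l2_norm \<Omega> q \<noteq> 0}. SUP v\<in>{v\<in>V. h1_norm_vec \<Omega> v \<noteq> 0}.
            ereal (l2_inner \<Omega> (weak_div \<Omega> v) q / (h1_norm_vec \<Omega> v * l2_norm \<Omega> q)))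
      \<le> (SUP v\<in>{v\<in>V. h1_norm_vec \<Omega> v \<noteq> 0}.
            ereal (l2_inner \<Omega> (weak_div \<Omega> v) q / (h1_norm_vec \<Omega> v * l2_norm \<Omega> q)))"
    by (rule INF_lower)
  also have "\<dots> \<le> 0" by (rule SUP_least) (simp add: z)
  finally show False using stokes(1) by (simp add: inf_sup_stable_def)
qed

lemma Linf_cross_L2: "u \<in> Linf \<Longrightarrow> v \<in> Linf \<Longrightarrow> (\<lambda>x. cross3 (u x) (v x)) \<in> L2 \<Omega>"
  by (intro Linf_L2 Linf_cross)

lemma cross_trilin: "trilin Linf Linf Linf (\<lambda>a B c. l2_inner \<Omega> (\<lambda>x. cross3 (a x) (B x)) c)"
proof -
  have l: "(\<lambda>x. cross3 ((a + a') x) (B x)) = (\<lambda>x. cross3 (a x) (B x)) + (\<lambda>x. cross3 (a' x) (B x))"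
    "(\<lambda>x. cross3 (a x) ((B + B') x)) = (\<lambda>x. cross3 (a x) (B x)) + (\<lambda>x. cross3 (a x) (B' x))"
    "(\<lambda>x. cross3 ((r *\<^sub>R a) x) (B x)) = r *\<^sub>R (\<lambda>x. cross3 (a x) (B x))"
    "(\<lambda>x. cross3 (a x) ((r *\<^sub>R B) x)) = r *\<^sub>R (\<lambda>x. cross3 (a x) (B x))" for a a' B B' r
    by (auto simp: fun_eq_iff cross_add_left cross_add_right cross_mult_left cross_mult_right)
  show ?thesis
    unfolding trilin_def bilin_def lin_on_def l
    by (auto simp: ve.add_l ve.add_r ve.scale_l ve.scale_r Linf_cross_L2 Linf_L2)
qed

lemma cross_anti: "l2_inner \<Omega> (\<lambda>x. cross3 (a x) (B x)) c = - l2_inner \<Omega> (\<lambda>x. cross3 (c x) (B x)) a"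
proof -
  have "cross3 a b \<bullet> c = - (cross3 c b \<bullet> a)" for a b c :: "real^3" by (simp add: cross3_simps)
  then have "(\<lambda>x. cross3 (a x) (B x) \<bullet> c x) = (\<lambda>x. - (cross3 (c x) (B x) \<bullet> a x))" by (intro ext)
  then show ?thesis unfolding l2_inner_eq by simp
qed

lemma cross_null:
  assumes "a \<in> Linf" "B \<in> Linf" "c \<in> Linf" "l2_inner \<Omega> a a = 0 \<or> l2_inner \<Omega> B B = 0"
  shows "l2_inner \<Omega> (\<lambda>x. cross3 (a x) (B x)) c = 0"
proof (rule l2_null_left[OF Linf_cross_L2[OF assms(1,2)] Linf_L2[OF assms(3)]])
  have "ae_eq \<Omega> a (\<lambda>x. 0) \<or> ae_eq \<Omega> B (\<lambda>x. 0)" using assms l2_null_iff Linf_L2 by blast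
  then show "ae_eq \<Omega> (\<lambda>x. cross3 (a x) (B x)) (\<lambda>x. 0)"
    unfolding ae_eq_def by (auto elim!: eventually_mono)
qed

lemma convection_trilin: "trilin V V V (\<lambda>w u v. l2_inner \<Omega> (convection \<Omega> w u) v)"
proof -
  let ?t = "\<lambda>w u v i. l2_inner \<Omega> (\<lambda>x. w x \<bullet> weak_grad \<Omega> (component u i) x) (component v i)"
  have eq: "l2_inner \<Omega> (convection \<Omega> w u) v = (\<Sum>i\<in>UNIV. ?t w u v i)" if "w \<in> V" "u \<in> V" "v \<in> V" for w u v
    using that H10_vecD[OF V_H10] by (intro convection_inner V_Linf) auto
  have m: "component u i \<in> H1 \<Omega>" "component u i \<in> L2 \<Omega>" if "u \<in> V" for u i
    using H10_vecD[OF V_H10[OF that]] by auto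
  have u: "?t w (u + u') v i = ?t w u v i + ?t w u' v i" "?t w (r *\<^sub>R u) v i = r * ?t w u v i"
    if "w \<in> V" "u \<in> V" "u' \<in> V" "v \<in> V" for w u u' v i r
    using bilinD2[OF transport_bilin[OF V_Linf[OF that(1)]] m(2)[OF that(4)]] m that
    by (auto simp: component_add component_scale lin_on_def)
  have v: "?t w u (v + v') i = ?t w u v i + ?t w u v' i" "?t w u (r *\<^sub>R v) i = r * ?t w u v i"
    if "w \<in> V" "u \<in> V" "v' \<in> V" "v \<in> V" for w u v v' i r
    using bilinD1[OF transport_bilin[OF V_Linf[OF that(1)]] m(1)[OF that(2)]] m that
    by (auto simp: component_add component_scale lin_on_def)
  have w: "l2_inner \<Omega> (\<lambda>x. (w x + w' x) \<bullet> weak_grad \<Omega> (component u i) x) (component v i) = ?t w u v i + ?t w' u v i"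
    "l2_inner \<Omega> (\<lambda>x. r * (w x \<bullet> weak_grad \<Omega> (component u i) x)) (component v i) = r * ?t w u v i"
    if "w \<in> V" "w' \<in> V" "u \<in> V" "v \<in> V" for w w' u v i r
  proof -
    have "(\<lambda>x. (w x + w' x) \<bullet> G x) = (\<lambda>x. w x \<bullet> G x) + (\<lambda>x. w' x \<bullet> G x)"
      "(\<lambda>x. r * (w x \<bullet> G x)) = r *\<^sub>R (\<lambda>x. w x \<bullet> G x)" for G
      by (auto simp: fun_eq_iff inner_simps)
    then show "l2_inner \<Omega> (\<lambda>x. (w x + w' x) \<bullet> weak_grad \<Omega> (component u i) x) (component v i) = ?t w u v i + ?t w' u v i"
      "l2_inner \<Omega> (\<lambda>x. r * (w x \<bullet> weak_grad \<Omega> (component u i) x)) (component v i) = r * ?t w u v i"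
      using that m V_Linf by (simp_all add: sc.add_l sc.scale_l transport_L2)
  qed
  show ?thesis
    unfolding trilin_def bilin_def lin_on_def
    using subspace_add[OF sub_V] subspace_scale[OF sub_V]
    by (auto simp: eq u v w sum.distrib sum_distrib_left)
qed

text \<open>By the Poincare inequality a null vector of the gradient form vanishes almost everywhere
  together with its weak gradients, which covers all three slots.\<close>

lemma convection_null:
  assumes "w \<in> V" "u \<in> V" "v \<in> V" "grad_inner \<Omega> w w = 0 \<or> grad_inner \<Omega> u u = 0 \<or> grad_inner \<Omega> v v = 0"
  shows "l2_inner \<Omega> (convection \<Omega> w u) v = 0"
proof -
  have m: "convection \<Omega> w u \<in> L2 \<Omega>" "v \<in> L2 \<Omega>"
    using assms H10_vecD V_H10 V_Linf by (auto intro!: convection_L2)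
  consider "ae_eq \<Omega> v (\<lambda>x. 0)"
    | "\<And>i. ae_eq \<Omega> w (\<lambda>x. 0) \<or> ae_eq \<Omega> (weak_grad \<Omega> (component u i)) (\<lambda>x. 0)"
    using assms grad_null_ae by blast
  then show ?thesis
  proof cases
    case 1
    then show ?thesis using l2_null_left[OF m(2,1)] l2_inner_commute by metis
  next
    case 2
    have "ae_eq \<Omega> (component (convection \<Omega> w u) i) (component (\<lambda>x. 0) i)" for i
      using 2[of i] unfolding ae_eq_def convection_component
      by (auto elim!: eventually_mono simp: component_def)
    then have "ae_eq \<Omega> (convection \<Omega> w u) (\<lambda>x. 0)" by (rule ae_eq_components)
    then show ?thesis by (rule l2_null_left[OF m])
  qed
qed

text \<open>Exact incompressibility turns orthogonality to \<open>Q\<close> into a divergence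
  vanishing almost everywhere, as \<open>transport_skew\<close> requires; that lemma is then summed
  over the components of \<open>u\<close>.\<close>

lemma convection_skew:
  assumes "w \<in> V" "u \<in> V" "\<And>q. q \<in> Q \<Longrightarrow> l2_inner \<Omega> (weak_div \<Omega> w) q = 0"
  shows "l2_inner \<Omega> (convection \<Omega> w u) u = 0"
proof -
  have "ae_eq \<Omega> (weak_div \<Omega> w) (\<lambda>x. 0)"
    using stokes(2) assms by (auto simp: exactly_incompressible_def)
  then show ?thesis
    using assms H10_vecD[OF V_H10] V_Linf H10_vec_Hdiv V_H10
    by (subst convection_inner) (auto intro!: sum.neutral transport_skew)
qed

lemma duality_linear: "lin_on V (duality f)"
proof -
  have "component v i \<in> H10 \<Omega>" if "v \<in> V" for v i using H10_vecD V_H10 that by blast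
  then have "f i (component (u + v) i) = f i (component u i) + f i (component v i)"
    "f i (component (c *\<^sub>R u) i) = c * f i (component u i)" if "u \<in> V" "v \<in> V" for u v c i
    using force that unfolding component_add component_scale by (auto simp: Hm1_def plus_fun_def scaleR_fun_def)
  then show ?thesis
    unfolding lin_on_def duality_def by (simp add: sum.distrib sum_distrib_left)
qed

text \<open>A null gradient form forces the full H1 norm of each component to vanish, and the load
  is bounded in that norm.\<close>

lemma duality_null:
  assumes "v \<in> V" "grad_inner \<Omega> v v = 0"
  shows "duality f v = 0"
  unfolding duality_def
proof (rule sum.neutral, intro ballI)
  fix i
  have "h1_norm \<Omega> (component v i) = 0"
    using grad_null[OF assms, of i] by (simp add: h1_norm_def l2_norm_def sc.nrm_def h1.nrm_def)
  moreover have "\<exists>M. \<forall>u\<in>H10 \<Omega>. \<bar>f i u\<bar> \<le> M * h1_norm \<Omega> u"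
    using force[rule_format, of i] by (simp add: Hm1_def)
  ultimately show "f i (component v i) = 0" using H10_vecD(1)[OF V_H10[OF assms(1)], of i] by fastforce
qed

lemma div_null: "B \<in> Hd \<Longrightarrow> l2_inner \<Omega> (weak_div \<Omega> B) (weak_div \<Omega> B) = 0 \<longleftrightarrow> (\<exists>E\<in>Hc. ae_eq \<Omega> B (weak_curl \<Omega> E))"
  using de_rham l2_null_iff[OF div.Op_L2[OF Hd_Hdiv]] unfolding exact_de_rham_def by blast

sublocale picard V Hc Hd Linf Q "grad_inner \<Omega>" "l2_inner \<Omega>" "\<lambda>B C. l2_inner \<Omega> (weak_div \<Omega> B) (weak_div \<Omega> C)"
  "l2_inner \<Omega>" "\<lambda>v q. l2_inner \<Omega> (weak_div \<Omega> v) q" "weak_curl \<Omega>" "\<lambda>w u v. l2_inner \<Omega> (convection \<Omega> w u) v"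
  "\<lambda>a B c. l2_inner \<Omega> (\<lambda>x. cross3 (a x) (B x)) c" "duality f" S RH
proof
  show "fin_dim V" "fin_dim Hc" "fin_dim Hd" "fin_dim Q" using fe_spaces fe_space_fin_dim by blast+
  show "subspace (Linf :: vector_fun set)" by (rule subspace_Linf)
  show "V \<subseteq> Linf" "Hc \<subseteq> Linf" "Hd \<subseteq> Linf" using V_Linf Hc_Linf Hd_Linf by auto
  show "semi_inner V (grad_inner \<Omega>)" by (rule semi_inner_V)
  show "semi_inner (Linf :: vector_fun set) (l2_inner \<Omega>)"
    using ve.semi_inner by (rule semi_inner_subset) (auto intro: Linf_L2)
  show "semi_inner Hd (\<lambda>B C. l2_inner \<Omega> (weak_div \<Omega> B) (weak_div \<Omega> C))"
    using div.semi_inner_Op by (rule semi_inner_subset) (auto intro: Hd_Hdiv)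
  show "semi_inner Q (l2_inner \<Omega>)"
    using sc.semi_inner by (rule semi_inner_subset) (auto intro: Q_L2)
  show "l2_inner \<Omega> v v = 0" if "v \<in> V" "grad_inner \<Omega> v v = 0" for v
    using grad_null_ae(1)[OF that] l2_null_iff Linf_L2[OF V_Linf[OF that(1)]] by blast
  show "bilin V Q (\<lambda>v q. l2_inner \<Omega> (weak_div \<Omega> v) q)"
    unfolding bilin_def
  proof (intro conjI ballI)
    show "lin_on Q (l2_inner \<Omega> (weak_div \<Omega> v))" if "v \<in> V" for v
      using bilinD1[OF sc.bilin div.Op_L2[OF V_Hdiv[OF that]]] by (rule lin_on_subset) (auto intro: Q_L2)
    show "lin_on V (\<lambda>v. l2_inner \<Omega> (weak_div \<Omega> v) q)" if "q \<in> Q" for q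
      using div.lin_on_Op[OF Q_L2[OF that]] by (rule lin_on_subset) (auto intro: V_Hdiv)
  qed
  show "l2_inner \<Omega> q q = 0" if "q \<in> Q" "\<And>v. v \<in> V \<Longrightarrow> l2_inner \<Omega> (weak_div \<Omega> v) q = 0" for q
    using that by (rule inf_sup)
  show "weak_curl \<Omega> F \<in> Linf" if "F \<in> Hc" for F using that by (rule weak_curl_Linf)
  show "bilin Linf Hc (\<lambda>B F. l2_inner \<Omega> B (weak_curl \<Omega> F))"
    unfolding bilin_def
  proof (intro conjI ballI)
    show "lin_on Hc (\<lambda>F. l2_inner \<Omega> B (weak_curl \<Omega> F))" if "B \<in> Linf" for B
      using curl.lin_on_Op[OF Linf_L2[OF that]] unfolding l2_inner_commute[of B]
      by (rule lin_on_subset) (auto intro: Hc_Hcurl)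
    show "lin_on Linf (\<lambda>B. l2_inner \<Omega> B (weak_curl \<Omega> F))" if "F \<in> Hc" for F
      using bilinD2[OF ve.bilin curl.Op_L2[OF Hc_Hcurl[OF that]]] by (rule lin_on_subset) (auto intro: Linf_L2)
  qed
  \<comment> \<open>Exactness at \<open>Hd\<close>, read from curl to divergence: the representative
    of a curl has null divergence.\<close>
  show "\<exists>C\<in>Hd. (\<forall>B\<in>Linf. l2_inner \<Omega> B C = l2_inner \<Omega> B (weak_curl \<Omega> F)) \<and>
      (\<forall>B\<in>Hd. l2_inner \<Omega> (weak_div \<Omega> B) (weak_div \<Omega> C) = 0)" if F: "F \<in> Hc" for F
  proof -
    obtain C where C: "C \<in> Hd" "ae_eq \<Omega> C (weak_curl \<Omega> F)" using rot_Hd[OF F] by blast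
    have "l2_inner \<Omega> B C = l2_inner \<Omega> B (weak_curl \<Omega> F)" if "B \<in> Linf" for B
      using that Hd_Linf[OF C(1)] weak_curl_Linf[OF F] C(2) by (rule l2_inner_cong_right)
    moreover have "l2_inner \<Omega> (weak_div \<Omega> B) (weak_div \<Omega> C) = 0" if "B \<in> Hd" for B
      using div_null[OF C(1)] C(2) F sc.null[OF div.Op_L2[OF Hd_Hdiv[OF C(1)]] div.Op_L2[OF Hd_Hdiv[OF that]]]
      by (subst l2_inner_commute) blast
    ultimately show ?thesis using C(1) by blast
  qed
  \<comment> \<open>Exactness at \<open>Hd\<close> in the other direction supplies the vector
    potential.\<close>
  show "\<exists>F\<in>Hc. \<forall>C\<in>Linf. l2_inner \<Omega> C B = l2_inner \<Omega> C (weak_curl \<Omega> F)"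
    if B: "B \<in> Hd" "l2_inner \<Omega> (weak_div \<Omega> B) (weak_div \<Omega> B) = 0" for B
  proof -
    obtain F where F: "F \<in> Hc" "ae_eq \<Omega> B (weak_curl \<Omega> F)" using B div_null by blast
    have "l2_inner \<Omega> C B = l2_inner \<Omega> C (weak_curl \<Omega> F)" if "C \<in> Linf" for C
      using that Hd_Linf[OF B(1)] weak_curl_Linf[OF F(1)] F(2) by (rule l2_inner_cong_right)
    then show ?thesis using F by blast
  qed
qed (use convection_trilin convection_null convection_skew cross_trilin cross_anti cross_null
      duality_linear duality_null params in blast)+

section \<open>Return to the concrete iteration and its norms\<close>

lemma hall_term:
  assumes "u \<in> V" "E \<in> Hc" "j \<in> Hc" "B0 \<in> Hd" "k \<in> Hc"
  shows "l2_inner \<Omega> (\<lambda>x. E x + cross3 (u x) (B0 x) - RH *\<^sub>R cross3 (j x) (B0 x)) k =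
    l2_inner \<Omega> E k + l2_inner \<Omega> (\<lambda>x. cross3 (u x) (B0 x)) k - RH * l2_inner \<Omega> (\<lambda>x. cross3 (j x) (B0 x)) k"
proof -
  let ?X = "\<lambda>x. cross3 (u x) (B0 x)" and ?Y = "\<lambda>x. cross3 (j x) (B0 x)"
  have m: "E \<in> L2 \<Omega>" "?X \<in> L2 \<Omega>" "?Y \<in> L2 \<Omega>" "k \<in> L2 \<Omega>"
    using assms V_Linf Hc_Linf Hd_Linf Linf_L2 Linf_cross_L2 by auto
  have "(\<lambda>x. E x + ?X x - RH *\<^sub>R ?Y x) = E + ?X - RH *\<^sub>R ?Y" by (simp add: fun_eq_iff)
  then show ?thesis
    using m subspace_add[OF ve.subspace] subspace_scale[OF ve.subspace]
    by (simp add: ve.diff_l ve.add_l ve.scale_l)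
qed

text \<open>The joint quantifier splits because each equation involves one test variable and every
  space contains 0. Membership of \<open>B0\<close> in \<open>Hd\<close> makes the cross products
  square integrable, so that \<open>hall_term\<close> can separate them.\<close>

lemma picard_step_iff:
  assumes "B0 \<in> Hd"
  shows "picard_step \<Omega> Rey Rem S RH f (state_space V Q Hc Hd) u0 B0 (u, p, E, B, j) \<longleftrightarrow>
    step Rey Rem u0 B0 u p E B j"
proof (cases "u \<in> V \<and> p \<in> Q \<and> E \<in> Hc \<and> B \<in> Hd \<and> j \<in> Hc")
  case True
  have z: "0 \<in> V" "0 \<in> Q" "0 \<in> Hc" "0 \<in> Hd" using sub by (auto simp: subspace_0)
  have split: "(\<forall>v\<in>V. \<forall>q\<in>Q. \<forall>F\<in>Hc. \<forall>C\<in>Hd. \<forall>k\<in>Hc. P1 v \<and> P2 F \<and> P3 C \<and> P4 k \<and> P5 q) \<longleftrightarrow>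
      (\<forall>v\<in>V. P1 v) \<and> (\<forall>F\<in>Hc. P2 F) \<and> (\<forall>C\<in>Hd. P3 C) \<and> (\<forall>k\<in>Hc. P4 k) \<and> (\<forall>q\<in>Q. P5 q)"
    for P1 P2 P3 P4 P5 using z by blast
  have ball: "(\<forall>(v, q, F, C, k)\<in>state_space V Q Hc Hd. P v q F C k) \<longleftrightarrow>
      (\<forall>v\<in>V. \<forall>q\<in>Q. \<forall>F\<in>Hc. \<forall>C\<in>Hd. \<forall>k\<in>Hc. P v q F C k)" for P
    by (auto simp: state_space_def)
  show ?thesis
    unfolding picard_step_def step_def prod.case ball split
    using True assms by (simp add: state_space_def hall_term l2_inner_commute[of p])
qed (auto simp: picard_step_def step_def state_space_def)

lemma div_freeI: "u \<in> V \<Longrightarrow> ae_eq \<Omega> (weak_div \<Omega> u) (\<lambda>x. 0) \<Longrightarrow> div_free u"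
  using l2_null_left[OF div.Op_L2[OF V_Hdiv] Q_L2] by (simp add: div_free_def)

lemma h1_norm_vec_eq:
  assumes "v \<in> V"
  shows "h1_norm_vec \<Omega> v = sqrt (l2_inner \<Omega> v v + grad_inner \<Omega> v v)"
  using l2_inner_components[of v v] H10_vecD(4)[OF V_H10[OF assms]]
  by (simp add: h1_norm_vec_def h1_norm_def l2_norm_sq grad_inner_def sum.distrib l2_inner_eq)

text \<open>\<open>V.nrm\<close> is the gradient seminorm; \<open>poincare\<close> and
  \<open>dominated_tendsto\<close> recover the L2 part.\<close>

lemma h1_tendsto:
  assumes "\<And>n. x n \<in> V" "x' \<in> V" "(\<lambda>n. V.nrm (x n - x')) \<longlonglongrightarrow> 0"
  shows "(\<lambda>n. h1_norm_vec \<Omega> (x n - x')) \<longlonglongrightarrow> 0"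
proof -
  have "semi_inner V (\<lambda>u v. l2_inner \<Omega> u v + grad_inner \<Omega> u v)"
    using semi_inner_add semi_inner_V semi_inner_subset[OF Lp.semi_inner] VL by blast
  from dominated_tendsto[OF V_fin this _ assms] poincare
  show ?thesis using subspace_diff[OF sub_V] assms by (simp add: h1_norm_vec_eq)
qed

text \<open>On a fixed finite-dimensional space the curl is dominated by the L2 norm; the null
  condition holds because a field vanishing almost everywhere has weak curl zero.\<close>

lemma hcurl_tendsto:
  assumes "\<And>n. x n \<in> Hc" "x' \<in> Hc" "(\<lambda>n. W.nrm (x n - x')) \<longlonglongrightarrow> 0"
  shows "(\<lambda>n. hcurl_norm \<Omega> (x n - x')) \<longlonglongrightarrow> 0"
proof -
  have s: "semi_inner Hc (\<lambda>u v. l2_inner \<Omega> u v + l2_inner \<Omega> (weak_curl \<Omega> u) (weak_curl \<Omega> v))"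
    using semi_inner_add W.semi_inner semi_inner_subset[OF curl.semi_inner_Op] Hc_Hcurl by blast
  have null: "l2_inner \<Omega> F F + l2_inner \<Omega> (weak_curl \<Omega> F) (weak_curl \<Omega> F) = 0"
    if F: "F \<in> Hc" "l2_inner \<Omega> F F = 0" for F
  proof -
    have FL: "F \<in> L2 \<Omega>" using F Hc_Linf Linf_L2 by blast
    have "is_weak_curl \<Omega> F 0"
      using subspace_0[OF ve.subspace] F ve.null[OF FL curl_test_L2]
      by (simp add: is_weak_curl_def) (simp add: l2_inner_def)
    then have "ae_eq \<Omega> (weak_curl \<Omega> F) (\<lambda>x. 0)"
      using curl.Op_eq[OF Hc_Hcurl[OF F(1)]] by (simp add: zero_fun_def)
    then show ?thesis using F l2_null_iff[OF curl.Op_L2[OF Hc_Hcurl[OF F(1)]]] by simp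
  qed
  from dominated_tendsto[OF W_fin s null assms]
  show ?thesis by (simp add: hcurl_norm_def l2_norm_sq fun_diff_def)
qed

end

theorem theorem3:
  fixes \<Omega> :: "(real^3) set"
    and \<T> :: "nat \<Rightarrow> (real^3) set set" and h :: nat
    and Hg Lh Q :: "scalar_fun set"
    and Hc Hd V :: "vector_fun set"
    and S RH :: real
    and f :: "3 \<Rightarrow> scalar_fun \<Rightarrow> real"
  assumes domain: "lipschitz_polyhedron \<Omega>" "bounded \<Omega>" "contractible \<Omega>"
    and meshes: "quasi_uniform \<Omega> \<T>"
    and fe_spaces: "fe_space (\<T> h) Hg" "fe_space (\<T> h) Hc" "fe_space (\<T> h) Hd"
      "fe_space (\<T> h) Lh" "fe_space (\<T> h) V" "fe_space (\<T> h) Q"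
    and conforming: "Hg \<subseteq> H10 \<Omega>" "Hc \<subseteq> H0curl \<Omega>" "Hd \<subseteq> H0div \<Omega>" "Lh \<subseteq> L2 \<Omega>"
      "V \<subseteq> H10_vec \<Omega>" "Q \<subseteq> L20 \<Omega>"
    and de_rham: "exact_de_rham \<Omega> Hg Hc Hd Lh"
    and stokes: "inf_sup_stable \<Omega> V Q" "exactly_incompressible \<Omega> V Q"
    and params: "S > 0" "RH \<ge> 0"
    and force: "\<forall>i. f i \<in> Hm1 \<Omega>"
  shows "\<exists>Rey_max>0. \<exists>Rem_max>0. \<forall>Rey Rem. 0 < Rey \<and> Rey < Rey_max \<and> 0 < Rem \<and> Rem < Rem_max \<longrightarrow>
           (\<forall>u0\<in>V. \<forall>B0\<in>Hd. ae_eq \<Omega> (weak_div \<Omega> u0) (\<lambda>x. 0) \<longrightarrow>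
              (\<exists>z. picard_iterates \<Omega> Rey Rem S RH f (state_space V Q Hc Hd) u0 B0 z) \<and>
              (\<forall>z. picard_iterates \<Omega> Rey Rem S RH f (state_space V Q Hc Hd) u0 B0 z \<longrightarrow>
                   converges_in \<Omega> (state_space V Q Hc Hd) z))"
proof -
  have "open \<Omega>" using domain(1) by (simp add: lipschitz_polyhedron_def)
  moreover have "mesh \<Omega> (\<T> h)" using meshes by (simp add: quasi_uniform_def)
  ultimately interpret mhd_discretisation \<Omega> "\<T> h" Hg Lh Q Hc Hd V S RH f
    using assms by unfold_locales
  let ?X = "state_space V Q Hc Hd"
  obtain \<epsilon> where eps: "\<epsilon> > 0" and conv: "\<forall>re rm. 0 < re \<and> re < \<epsilon> \<and> 0 < rm \<and> rm < \<epsilon> \<longrightarrow>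
       (\<forall>u p E B j. div_free (u 0) \<and> B 0 \<in> Hd \<and>
       (\<forall>n. step re rm (u n) (B n) (u (Suc n)) (p (Suc n)) (E (Suc n)) (B (Suc n)) (j (Suc n))) \<longrightarrow>
       has_limits u p E B j)"
    using picard_converges by (elim exE conjE) (rule that)
  show ?thesis
  \<comment> \<open>The same \<epsilon> serves as both thresholds.\<close>
  proof (intro exI[of _ \<epsilon>] conjI eps allI impI ballI, goal_cases)
    case (1 Rey Rem u0 B0)
    then have pos: "0 < Rey" "0 < Rem" and u0: "u0 \<in> V" and B0: "B0 \<in> Hd"
      and d0: "ae_eq \<Omega> (weak_div \<Omega> u0) (\<lambda>x. 0)" by auto
    have df: "div_free u0" using u0 d0 by (rule div_freeI)
    \<comment> \<open>Dependent choice carries the two properties that \<open>step_exists\<close>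
      asks of the previous iterate; the remaining initial components are arbitrary and set to
      0.\<close>
    have "\<exists>z. \<forall>n. ((n = 0 \<longrightarrow> z n = (u0, 0, 0, B0, 0)) \<and> div_free (velocity (z n)) \<and> magnetic (z n) \<in> Hd) \<and>
        picard_step \<Omega> Rey Rem S RH f ?X (velocity (z n)) (magnetic (z n)) (z (Suc n))"
    proof (rule dependent_nat_choice)
      show "\<exists>z. (0 = 0 \<longrightarrow> z = (u0, 0, 0, B0, 0)) \<and> div_free (velocity z) \<and> magnetic z \<in> Hd"
        using df B0 by (auto simp: velocity_def magnetic_def)
      fix z :: state and n :: nat
      assume z: "(n = 0 \<longrightarrow> z = (u0, 0, 0, B0, 0)) \<and> div_free (velocity z) \<and> magnetic z \<in> Hd"
      then obtain u p E B j where st: "step Rey Rem (velocity z) (magnetic z) u p E B j"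
        using step_exists pos by blast
      then show "\<exists>z'. ((Suc n = 0 \<longrightarrow> z' = (u0, 0, 0, B0, 0)) \<and> div_free (velocity z') \<and> magnetic z' \<in> Hd) \<and>
          picard_step \<Omega> Rey Rem S RH f ?X (velocity z) (magnetic z) z'"
        using stepD(4,11)[OF st] z
        by (intro exI[of _ "(u, p, E, B, j)"]) (simp add: picard_step_iff velocity_def magnetic_def)
    qed
    then obtain z where z: "z 0 = (u0, 0, 0, B0, 0)"
      "\<And>n. picard_step \<Omega> Rey Rem S RH f ?X (velocity (z n)) (magnetic (z n)) (z (Suc n))" by blast
    have "picard_step \<Omega> Rey Rem S RH f ?X (velocity (z (n - 1))) (magnetic (z (n - 1))) (z n)" if "n \<ge> 1" for n
      using z(2)[of "n - 1"] that by simp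
    then have "picard_iterates \<Omega> Rey Rem S RH f ?X u0 B0 z"
      using z(1) by (simp add: picard_iterates_def velocity_def magnetic_def)
    then show ?case by blast
  next
    case (2 Rey Rem u0 B0 z)
    then have re: "0 < Rey" "Rey < \<epsilon>" and rm: "0 < Rem" "Rem < \<epsilon>" and u0: "u0 \<in> V" and B0: "B0 \<in> Hd"
      and d0: "ae_eq \<Omega> (weak_div \<Omega> u0) (\<lambda>x. 0)"
      and z: "picard_iterates \<Omega> Rey Rem S RH f ?X u0 B0 z" by auto
    have df: "div_free u0" using u0 d0 by (rule div_freeI)
    define u p E B j where "u n = velocity (z n)" and "p n = fst (snd (z n))"
      and "E n = fst (snd (snd (z n)))" and "B n = magnetic (z n)" and "j n = snd (snd (snd (snd (z n))))" for n
    note defs = u_def p_def E_def B_def j_def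
    have zz: "z n = (u n, p n, E n, B n, j n)" for n
      by (cases "z n") (simp add: defs velocity_def magnetic_def)
    have z0: "u 0 = u0" "B 0 = B0" using z by (auto simp: picard_iterates_def defs)
    have ps: "picard_step \<Omega> Rey Rem S RH f ?X (u n) (B n) (u (Suc n), p (Suc n), E (Suc n), B (Suc n), j (Suc n))" for n
      using z[unfolded picard_iterates_def] zz[of "Suc n"] by (auto simp: u_def[of n] B_def[of n] dest: spec[of _ "Suc n"])
    \<comment> \<open>Read off \<open>picard_step\<close> directly, since
      \<open>picard_step_iff\<close> presupposes it.\<close>
    have BH: "B n \<in> Hd" for n
      using B0 z0 ps by (cases n) (auto simp: picard_step_def state_space_def)
    have st: "step Rey Rem (u n) (B n) (u (Suc n)) (p (Suc n)) (E (Suc n)) (B (Suc n)) (j (Suc n))" for n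
      using ps picard_step_iff[OF BH] by blast
    have "div_free (u 0)" "B 0 \<in> Hd" using df z0 BH by auto
    from conv[rule_format, of Rey Rem u B p E j, OF conjI[OF re(1) conjI[OF re(2) conjI[OF rm]]]
      conjI[OF this(1) conjI[OF this(2) allI[OF st]]]]
    have "has_limits u p E B j" .
    then obtain u' p' E' B' j' where m: "u' \<in> V" "p' \<in> Q" "E' \<in> Hc" "B' \<in> Hd" "j' \<in> Hc"
      and lim: "(\<lambda>n. V.nrm (u n - u')) \<longlonglongrightarrow> 0" "(\<lambda>n. Q.nrm (p n - p')) \<longlonglongrightarrow> 0"
          "(\<lambda>n. W.nrm (E n - E')) \<longlonglongrightarrow> 0" "(\<lambda>n. D.nrm (B n - B')) \<longlonglongrightarrow> 0" "(\<lambda>n. W.nrm (j n - j')) \<longlonglongrightarrow> 0"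
      and div0: "\<And>n. l2_inner \<Omega> (weak_div \<Omega> (B (Suc n) - B')) (weak_div \<Omega> (B (Suc n) - B')) = 0"
      unfolding has_limits_def by blast
    \<comment> \<open>The norms are compared from index 1 on: the pressure, electric field and
      current of \<open>z 0\<close> need not lie in the discrete spaces.\<close>
    note lim' = lim[THEN LIMSEQ_Suc]
    have "(\<lambda>n. h1_norm_vec \<Omega> (u (Suc n) - u') + l2_norm \<Omega> (p (Suc n) - p') + hcurl_norm \<Omega> (E (Suc n) - E')
        + hdiv_norm \<Omega> (B (Suc n) - B') + hcurl_norm \<Omega> (j (Suc n) - j')) \<longlonglongrightarrow> 0 + 0 + 0 + 0 + 0"
    proof (intro tendsto_add)
      show "(\<lambda>n. h1_norm_vec \<Omega> (u (Suc n) - u')) \<longlonglongrightarrow> 0"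
        using stepD(1)[OF st] m lim'(1) by (intro h1_tendsto)
      show "(\<lambda>n. l2_norm \<Omega> (p (Suc n) - p')) \<longlonglongrightarrow> 0"
        using lim'(2) by (simp add: l2_norm_def Q.nrm_def)
      show "(\<lambda>n. hcurl_norm \<Omega> (E (Suc n) - E')) \<longlonglongrightarrow> 0"
        using stepD(3)[OF st] m lim'(3) by (intro hcurl_tendsto)
      \<comment> \<open>The divergence part is identically zero by \<open>div0\<close>, which leaves
        the L2 norm.\<close>
      show "(\<lambda>n. hdiv_norm \<Omega> (B (Suc n) - B')) \<longlonglongrightarrow> 0"
        using lim'(4) by (simp add: hdiv_norm_def l2_norm_sq div0 D.nrm_def)
      show "(\<lambda>n. hcurl_norm \<Omega> (j (Suc n) - j')) \<longlonglongrightarrow> 0"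
        using stepD(5)[OF st] m lim'(5) by (intro hcurl_tendsto)
    qed
    then have "(\<lambda>n. state_norm \<Omega> (state_diff (z (Suc n)) (u', p', E', B', j'))) \<longlonglongrightarrow> 0"
      by (simp add: zz fun_diff_def)
    then have "(\<lambda>n. state_norm \<Omega> (state_diff (z n) (u', p', E', B', j'))) \<longlonglongrightarrow> 0"
      by (rule LIMSEQ_imp_Suc)
    then show ?case
      unfolding converges_in_def using m by (intro bexI[of _ "(u', p', E', B', j')"]) (auto simp: state_space_def)
  qed
qed

end
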